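(* Let $n\ge 2$ and let $\Omega\subseteq\mathbb{R}^n$ be a bounded open set with $C^2$ boundary. (i) There exists a positive function $f_{\Omega,n}:\Omega\to(0,\infty)$, depending only on $\Omega$ and $n$, with $$f_{\Omega,n}\in\Big(\bigcap_{p\in[1,\infty)}L^p(\Omega)\Big)\cap C^0(\Omega),$$ such that for every $g\in\mathrm{Lip}(\partial\Omega)$, if $u\in C^2(\Omega)\cap C^0(\overline{\Omega})$ is the harmonic function solving $$\Delta u=0\ \text{ in }\Omega,\qquad u=g\ \text{ on }\partial\Omega,$$ then $$|\mathrm{D}u(x)|\le \mathrm{Lip}(g,\partial\Omega)\,f_{\Omega,n}(x)\qquad\text{for all }x\in\Omega.$$ (ii) Let $(g^m)_{m=1}^\infty\subseteq \mathrm{Lip}(\partial\Omega)$ satisfy, for some $C>0$, $$\mathrm{Lip}(g^m,\partial\Omega)+\max_{\partial\Omega}|g^m|\le C\qquad\text{for all }m\in\mathbb{N},$$ and let $u^m\in C^2(\Omega)\cap C^0(\overline{\Omega})$, $m\in\mathbb{N}$, be the harmonic functions solving $$\Delta u^m=0\ \text{ in }\Omega,\qquad u^m=g^m\ \text{ on }\partial\Omega.$$ Then $(u^m)_{m=1}^\infty$ is strongly precompact in $\bigcap_{p\in[1,\infty)}W^{1,p}(\Omega)$. Moreover, if $(g^{m_k})_{k=1}^\infty$ is a subsequence and $g:\partial\Omega\to\mathbb{R}$ is such that $g^{m_k}\to g$ in $C^0(\partial\Omega)$ as $k\to\infty$, then there is a unique limit point $u\in C^2(\Omega)\cap C^0(\overline{\Omega})$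 of the subsequence $(u^{m_k})_{k=1}^\infty$ such that, along perhaps a further subsequence, $$u^{m_k}\to u\quad\text{in }W^{1,p}(\Omega)\ \text{ for all }p\in[1,\infty),\ \text{ as }k\to\infty,$$ and the limit function $u$ solves $$\Delta u=0\ \text{ in }\Omega,\qquad u=g\ \text{ on }\partial\Omega.$$
   Context: For a function $g:\partial\Omega\to\mathbb{R}$, $g\in\mathrm{Lip}(\partial\Omega)$ means that $g\in C^0(\partial\Omega)$ and $$\mathrm{Lip}(g,\partial\Omega):=\sup_{x,y\in\partial\Omega,\ x\ne y}\frac{|g(x)-g(y)|}{|x-y|}<\infty .$$ $\mathrm{D}u$ denotes the gradient of $u$ and $|\cdot|$ the Euclidean norm. Convergence in $C^0(\partial\Omega)$ is uniform convergence on $\partial\Omega$. Strong precompactness of a sequence in $\bigcap_{p\in[1,\infty)}W^{1,p}(\Omega)$ means that every subsequence has a further subsequence converging in the norm of $W^{1,p}(\Omega)$ for every $p\in[1,\infty)$ to a common limit. *)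

theory Defs
  imports "HOL-Analysis.Analysis"
begin

text \<open>Functions on a set \<open>S\<close> are total functions of which only the values on \<open>S\<close> matter.\<close>

definition partial :: "'n \<Rightarrow> (real^'n \<Rightarrow> real) \<Rightarrow> real^'n \<Rightarrow> real" where
  "partial i u x = frechet_derivative u (at x) (axis i 1)"

definition gradient :: "(real^'n \<Rightarrow> real) \<Rightarrow> real^'n \<Rightarrow> real^'n" where
  "gradient u x = (\<chi> i. partial i u x)"

definition laplacian :: "(real^'n \<Rightarrow> real) \<Rightarrow> real^'n \<Rightarrow> real" where
  "laplacian u x = (\<Sum>i\<in>UNIV. partial i (partial i u) x)"

text \<open>\<open>C\<^sup>k(S)\<close>, for open \<open>S\<close>.\<close>

primrec Ck_on :: "nat \<Rightarrow> (real^'n) set \<Rightarrow> (real^'n \<Rightarrow> real) \<Rightarrow> bool" where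
  "Ck_on 0 S u \<longleftrightarrow> continuous_on S u"
| "Ck_on (Suc k) S u \<longleftrightarrow> (\<forall>x\<in>S. u differentiable at x) \<and> (\<forall>i. Ck_on k S (partial i u))"

text \<open>Near each boundary point, \<open>\<Omega>\<close> is the part of a ball lying strictly above the graph of a
  \<open>C\<^sup>2\<close> function \<open>\<gamma>\<close> of \<open>n - 1\<close> variables, in rotated Cartesian coordinates whose last axis is
  \<open>\<nu>\<close>. A function on the hyperplane orthogonal to \<open>\<nu>\<close> is encoded as a function on the whole space
  that is constant in the direction \<open>\<nu>\<close>.\<close>

definition C2_boundary :: "(real^'n) set \<Rightarrow> bool" where
  "C2_boundary \<Omega> \<longleftrightarrow>
    (\<forall>x\<^sub>0\<in>frontier \<Omega>. \<exists>r>0. \<exists>\<nu> \<gamma>. norm \<nu> = 1 \<and> Ck_on 2 UNIV \<gamma> \<and>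
       (\<forall>x t. \<gamma> (x + t *\<^sub>R \<nu>) = \<gamma> x) \<and>
       \<Omega> \<inter> ball x\<^sub>0 r = {x \<in> ball x\<^sub>0 r. \<gamma> x < x \<bullet> \<nu>})"

definition difference_quotients :: "(real^'n \<Rightarrow> real) \<Rightarrow> (real^'n) set \<Rightarrow> real set" where
  "difference_quotients g S = {\<bar>g x - g y\<bar> / norm (x - y) | x y. x \<in> S \<and> y \<in> S \<and> x \<noteq> y}"

definition Lip_const :: "(real^'n \<Rightarrow> real) \<Rightarrow> (real^'n) set \<Rightarrow> real" where
  "Lip_const g S = Sup (difference_quotients g S)"

definition Lip_on :: "(real^'n) set \<Rightarrow> (real^'n \<Rightarrow> real) \<Rightarrow> bool" where
  "Lip_on S g \<longleftrightarrow> continuous_on S g \<and> bdd_above (difference_quotients g S)"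

definition solves_dirichlet ::
    "(real^'n) set \<Rightarrow> (real^'n \<Rightarrow> real) \<Rightarrow> (real^'n \<Rightarrow> real) \<Rightarrow> bool" where
  "solves_dirichlet \<Omega> g u \<longleftrightarrow>
     Ck_on 2 \<Omega> u \<and> continuous_on (closure \<Omega>) u \<and>
     (\<forall>x\<in>\<Omega>. laplacian u x = 0) \<and> (\<forall>x\<in>frontier \<Omega>. u x = g x)"

definition Lp_on :: "(real^'n) set \<Rightarrow> real \<Rightarrow> (real^'n \<Rightarrow> 'b::euclidean_space) \<Rightarrow> bool" where
  "Lp_on \<Omega> p u \<longleftrightarrow> u \<in> borel_measurable (lebesgue_on \<Omega>) \<and>
     integrable (lebesgue_on \<Omega>) (\<lambda>x. norm (u x) powr p)"

definition locally_integrable_on :: "(real^'n) set \<Rightarrow> (real^'n \<Rightarrow> 'b::euclidean_space) \<Rightarrow> bool" where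
  "locally_integrable_on \<Omega> u \<longleftrightarrow> (\<forall>K. compact K \<and> K \<subseteq> \<Omega> \<longrightarrow> integrable (lebesgue_on K) u)"

definition test_function :: "(real^'n) set \<Rightarrow> (real^'n \<Rightarrow> real) \<Rightarrow> bool" where
  "test_function \<Omega> \<phi> \<longleftrightarrow> (\<forall>k. Ck_on k UNIV \<phi>) \<and>
     compact (closure {x. \<phi> x \<noteq> 0}) \<and> closure {x. \<phi> x \<noteq> 0} \<subseteq> \<Omega>"

definition is_weak_gradient ::
    "(real^'n) set \<Rightarrow> (real^'n \<Rightarrow> real) \<Rightarrow> (real^'n \<Rightarrow> real^'n) \<Rightarrow> bool" where
  "is_weak_gradient \<Omega> u v \<longleftrightarrow>
     locally_integrable_on \<Omega> u \<and> locally_integrable_on \<Omega> v \<and>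
     (\<forall>\<phi> i. test_function \<Omega> \<phi> \<longrightarrow>
        integral\<^sup>L (lebesgue_on \<Omega>) (\<lambda>x. u x * partial i \<phi> x)
        = - integral\<^sup>L (lebesgue_on \<Omega>) (\<lambda>x. v x $ i * \<phi> x))"

text \<open>Weak gradients are unique almost everywhere, so the choice does not affect the norm below.\<close>

definition weak_gradient :: "(real^'n) set \<Rightarrow> (real^'n \<Rightarrow> real) \<Rightarrow> real^'n \<Rightarrow> real^'n" where
  "weak_gradient \<Omega> u = (SOME v. is_weak_gradient \<Omega> u v)"

definition W1p_on :: "(real^'n) set \<Rightarrow> real \<Rightarrow> (real^'n \<Rightarrow> real) \<Rightarrow> bool" where
  "W1p_on \<Omega> p u \<longleftrightarrow> Lp_on \<Omega> p u \<and> (\<exists>v. is_weak_gradient \<Omega> u v \<and> Lp_on \<Omega> p v)"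

definition W1p_norm :: "(real^'n) set \<Rightarrow> real \<Rightarrow> (real^'n \<Rightarrow> real) \<Rightarrow> real" where
  "W1p_norm \<Omega> p u =
     (integral\<^sup>L (lebesgue_on \<Omega>) (\<lambda>x. \<bar>u x\<bar> powr p) +
      integral\<^sup>L (lebesgue_on \<Omega>) (\<lambda>x. norm (weak_gradient \<Omega> u x) powr p)) powr (1 / p)"

text \<open>Convergence in \<open>W\<^sup>1\<^sup>,\<^sup>p(\<Omega>)\<close> for every \<open>p \<in> [1,\<infinity>)\<close>, to a limit not depending on \<open>p\<close>.\<close>

definition converges_W1 ::
    "(real^'n) set \<Rightarrow> (nat \<Rightarrow> real^'n \<Rightarrow> real) \<Rightarrow> (real^'n \<Rightarrow> real) \<Rightarrow> bool" where
  "converges_W1 \<Omega> U v \<longleftrightarrow>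
     (\<forall>p\<ge>1. (\<forall>k. W1p_on \<Omega> p (U k)) \<and> W1p_on \<Omega> p v \<and>
        (\<lambda>k. W1p_norm \<Omega> p (\<lambda>x. U k x - v x)) \<longlonglongrightarrow> 0)"

definition limit_point_W1 ::
    "(real^'n) set \<Rightarrow> (nat \<Rightarrow> real^'n \<Rightarrow> real) \<Rightarrow> (real^'n \<Rightarrow> real) \<Rightarrow> bool" where
  "limit_point_W1 \<Omega> U v \<longleftrightarrow> (\<exists>\<tau>. strict_mono \<tau> \<and> converges_W1 \<Omega> (\<lambda>k. U (\<tau> k)) v)"

definition precompact_W1 :: "(real^'n) set \<Rightarrow> (nat \<Rightarrow> real^'n \<Rightarrow> real) \<Rightarrow> bool" where
  "precompact_W1 \<Omega> U \<longleftrightarrow>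
     (\<forall>p\<ge>1. \<forall>m. W1p_on \<Omega> p (U m)) \<and>
     (\<forall>\<sigma>. strict_mono \<sigma> \<longrightarrow> (\<exists>v. limit_point_W1 \<Omega> (\<lambda>k. U (\<sigma> k)) v))"

end

theory Submission
  imports Defs "HOL-Complex_Analysis.Great_Picard" "HOL-Real_Asymp.Real_Asymp"
begin

text \<open>
  Every point of the boundary is touched from outside by a ball of a fixed radius. A function
  on the boundary that grows like \<open>\<bar>x - y\<bar>\<close> away from a boundary point \<open>y\<close> is therefore dominated in
  \<open>\<Omega>\<close> by a barrier that is at most of order \<open>d (1 + \<bar>ln d\<bar>)\<close> at distance \<open>d\<close> from \<open>y\<close>
  (\<open>log_barrier_exists\<close>, \<open>uniform_exterior_quadric\<close>). If \<open>u\<close> is harmonic with Lipschitz boundary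
  values \<open>g\<close>, \<open>d\<close> is the distance of \<open>x\<close> to the boundary and \<open>y\<close> is a nearest boundary point, then
  comparison gives \<open>\<bar>u - g y\<bar> \<le> C Lip(g) d (1 + \<bar>ln d\<bar>)\<close> on the ball of radius \<open>d/2\<close> around \<open>x\<close>.
  The interior gradient estimate divides this oscillation by \<open>d\<close>, so
  \<open>f x = c (1 + \<bar>ln (dist x)\<bar>)\<close> is a gradient bound (\<open>gradient_bound_log\<close>). It lies in every \<open>L\<^sup>p\<close>,
  since the set where the distance to the boundary is less than \<open>t\<close> has volume \<open>O(t)\<close>: near the
  boundary it consists of thin layers over a graph (\<open>boundary_layer_volume\<close>).

  For the compactness statement, a bounded equi-Lipschitz sequence of boundary values has a uniformly
  convergent subsequence by the Arzela-Ascoli theorem. The maximum principle turns uniform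
  convergence of the boundary values into uniform convergence of the solutions on the closure of
  \<open>\<Omega>\<close>. Interior estimates of first and second derivatives then show that the limit is harmonic
  and that the gradients converge pointwise (\<open>harmonic_uniform_limit\<close>). All gradients are dominated
  by a multiple of \<open>f\<close>, so dominated convergence gives convergence in every \<open>W\<^sup>1\<^sup>,\<^sup>p\<close>
  (\<open>converges_W1_of_bounds\<close>), and limits in \<open>W\<^sup>1\<^sup>,\<^sup>p\<close> are unique almost everywhere.

  The whole theory of harmonic functions used here rests on the maximum principle alone. The interior
  gradient estimate compares the odd part of \<open>u\<close> under a reflection with a quadratic polynomial
  (\<open>harmonic_partial_le\<close>), and second derivatives are reached by applying it to difference quotients;
  neither the mean value property nor an integral representation occurs. The Sobolev norm is defined
  through an arbitrarily chosen weak gradient, which has to be identified with the classical one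
  (\<open>weak_gradient_eq_gradient\<close>). This takes an integration by parts, obtained from the translation
  invariance of the integral, and enough smooth test functions to recognise the zero function.\<close>

section \<open>Partial derivatives and \<open>C\<^sup>k\<close> functions\<close>

lemma partial_eqI: "(u has_derivative D) (at x) \<Longrightarrow> partial i u x = D (axis i 1)"
  by (simp add: partial_def frechet_derivative_at[symmetric])

lemma differentiable_has_derivative: "u differentiable at x \<Longrightarrow> (u has_derivative frechet_derivative u (at x)) (at x)"
  by (simp add: frechet_derivative_works)

lemma frechet_derivative_eq_gradient:
  fixes u :: "real^'n \<Rightarrow> real"
  assumes "u differentiable at x"
  shows "frechet_derivative u (at x) h = gradient u x \<bullet> h"
proof -
  interpret linear "frechet_derivative u (at x)"
    using assms linear_frechet_derivative by blast
  have "frechet_derivative u (at x) h = frechet_derivative u (at x) (\<Sum>i\<in>UNIV. (h$i) *\<^sub>R axis i 1)"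
    by (simp add: basis_expansion flip: scalar_mult_eq_scaleR)
  also have "\<dots> = (\<Sum>i\<in>UNIV. h$i * partial i u x)"
    by (simp add: sum scaleR partial_def)
  finally show ?thesis by (simp add: inner_vec_def gradient_def mult.commute)
qed

lemma has_derivative_gradient:
  fixes u :: "real^'n \<Rightarrow> real"
  assumes "u differentiable at x"
  shows "(u has_derivative (\<lambda>h. gradient u x \<bullet> h)) (at x)"
  using differentiable_has_derivative[OF assms] by (simp add: frechet_derivative_eq_gradient[OF assms, abs_def])

lemma partial_cong:
  assumes "open S" "x \<in> S" "\<And>y. y \<in> S \<Longrightarrow> u y = v y"
  shows "partial i u x = partial i v x"
proof -
  have "(u has_derivative D) (at x) \<longleftrightarrow> (v has_derivative D) (at x)" for D
    using has_derivative_transform_within_open[OF _ assms(1,2), of u D UNIV v]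
      has_derivative_transform_within_open[OF _ assms(1,2), of v D UNIV u] assms(3) by auto
  then show ?thesis by (simp add: partial_def frechet_derivative_def)
qed

lemma partial_add:
  assumes "u differentiable at x" "v differentiable at x"
  shows "partial i (\<lambda>y. u y + v y) x = partial i u x + partial i v x"
  using partial_eqI[OF has_derivative_add[OF assms[THEN differentiable_has_derivative]]]
  by (simp add: partial_def)

lemma partial_diff:
  assumes "u differentiable at x" "v differentiable at x"
  shows "partial i (\<lambda>y. u y - v y) x = partial i u x - partial i v x"
  using partial_eqI[OF has_derivative_diff[OF assms[THEN differentiable_has_derivative]]]
  by (simp add: partial_def)

lemma partial_mult:
  fixes u v :: "real^'n \<Rightarrow> real"
  assumes "u differentiable at x" "v differentiable at x"
  shows "partial i (\<lambda>y. u y * v y) x = u x * partial i v x + partial i u x * v x"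
  using partial_eqI[OF has_derivative_mult[OF assms[THEN differentiable_has_derivative]]]
  by (simp add: partial_def)

lemma partial_const: "partial i (\<lambda>y. c) x = 0"
  using partial_eqI[OF has_derivative_const] by metis

lemma partial_cmult:
  assumes "u differentiable at x"
  shows "partial i (\<lambda>y. c * u y) x = c * partial i u x"
  using partial_mult[of "\<lambda>_. c" x u i] assms by (simp add: partial_const)

lemma Ck_on_cong:
  assumes "open S"
  shows "\<lbrakk>\<And>x. x \<in> S \<Longrightarrow> u x = v x; Ck_on k S u\<rbrakk> \<Longrightarrow> Ck_on k S v"
proof (induction k arbitrary: u v)
  case 0 then show ?case by (metis Ck_on.simps(1) continuous_on_cong)
next
  case (Suc k)
  have "v differentiable at x" if "x \<in> S" for x
  proof -
    have "(u has_derivative frechet_derivative u (at x)) (at x)"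
      using Suc.prems(2) that by (auto intro: differentiable_has_derivative)
    then have "(v has_derivative frechet_derivative u (at x)) (at x)"
      by (rule has_derivative_transform_within_open[OF _ assms that]) (use Suc.prems in auto)
    then show ?thesis by (auto simp: differentiable_def)
  qed
  moreover have "Ck_on k S (partial i v)" for i
  proof (rule Suc.IH)
    show "partial i u x = partial i v x" if "x \<in> S" for x
      by (rule partial_cong[OF assms that Suc.prems(1)])
    show "Ck_on k S (partial i u)" using Suc.prems(2) by simp
  qed
  ultimately show ?case by simp
qed

lemma Ck_on_Suc_imp_continuous: "Ck_on (Suc k) S u \<Longrightarrow> continuous_on S u"
  by (auto intro!: continuous_at_imp_continuous_on differentiable_imp_continuous_within)

lemma Ck_on_SucD: "Ck_on (Suc k) S u \<Longrightarrow> Ck_on k S u"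
proof (induction k arbitrary: u)
  case 0 then show ?case using Ck_on_Suc_imp_continuous by (metis Ck_on.simps(1))
qed auto

lemma Ck_on_add:
  "\<lbrakk>open S; Ck_on k S u; Ck_on k S v\<rbrakk> \<Longrightarrow> Ck_on k S (\<lambda>x. u x + v x)"
proof (induction k arbitrary: u v)
  case 0 then show ?case by (auto intro!: continuous_intros)
next
  case (Suc k)
  have "Ck_on k S (partial i (\<lambda>x. u x + v x))" for i
    by (rule Ck_on_cong[of _ "\<lambda>x. partial i u x + partial i v x"])
       (use Suc in \<open>auto simp: partial_add\<close>)
  with Suc.prems show ?case by auto
qed

lemma Ck_on_mult:
  "\<lbrakk>open S; Ck_on k S u; Ck_on k S v\<rbrakk> \<Longrightarrow> Ck_on k S (\<lambda>x. u x * v x)"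
proof (induction k arbitrary: u v)
  case 0 then show ?case by (auto intro!: continuous_intros)
next
  case (Suc k)
  have "Ck_on k S (partial i (\<lambda>x. u x * v x))" for i
    by (rule Ck_on_cong[of _ "\<lambda>x. u x * partial i v x + partial i u x * v x"])
       (use Suc Ck_on_SucD[OF Suc.prems(2)] Ck_on_SucD[OF Suc.prems(3)] in
         \<open>auto simp: partial_mult intro!: Ck_on_add\<close>)
  with Suc.prems show ?case by auto
qed

lemma Ck_on_const: "Ck_on k S (\<lambda>x::real^'n. c)"
proof (induction k arbitrary: c)
  case (Suc k)
  have "partial i (\<lambda>x::real^'n. c) = (\<lambda>x. 0)" for i by (rule ext) (rule partial_const)
  then show ?case using Suc by simp
qed auto

lemma Ck_on_diff:
  assumes "open S" "Ck_on k S u" "Ck_on k S v"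
  shows "Ck_on k S (\<lambda>x. u x - v x)"
  using Ck_on_add[OF assms(1,2) Ck_on_mult[OF assms(1) Ck_on_const[of k S "-1"] assms(3)]] by simp

lemma Ck_on_subset: "Ck_on k T u \<Longrightarrow> S \<subseteq> T \<Longrightarrow> Ck_on k S u"
  by (induction k arbitrary: u) (auto intro: continuous_on_subset)

lemma Ck_on_2D:
  assumes "Ck_on 2 S u"
  shows "x \<in> S \<Longrightarrow> u differentiable at x" "x \<in> S \<Longrightarrow> partial i u differentiable at x"
    "continuous_on S u" "continuous_on S (partial i u)" "continuous_on S (partial j (partial i u))"
proof -
  have u: "Ck_on (Suc (Suc 0)) S u" using assms by (simp add: numeral_2_eq_2)
  then have i: "Ck_on (Suc 0) S (partial i u)" for i by simp
  show "x \<in> S \<Longrightarrow> u differentiable at x" "x \<in> S \<Longrightarrow> partial i u differentiable at x"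
    using u by auto
  show "continuous_on S u" "continuous_on S (partial i u)" "continuous_on S (partial j (partial i u))"
    using Ck_on_Suc_imp_continuous[OF u] Ck_on_Suc_imp_continuous[OF i] u by auto
qed

lemma continuous_on_gradient: "Ck_on 2 S u \<Longrightarrow> continuous_on S (gradient u)"
  unfolding gradient_def by (intro continuous_on_vec_lambda Ck_on_2D)

lemma laplacian_diff:
  assumes "open S" "Ck_on 2 S u" "Ck_on 2 S v" "x \<in> S"
  shows "laplacian (\<lambda>x. u x - v x) x = laplacian u x - laplacian v x"
proof -
  have "partial i (partial i (\<lambda>x. u x - v x)) x = partial i (partial i u) x - partial i (partial i v) x" for i
  proof -
    have "partial i (partial i (\<lambda>x. u x - v x)) x = partial i (\<lambda>x. partial i u x - partial i v x) x"
      by (rule partial_cong[OF assms(1,4)]) (simp add: partial_diff Ck_on_2D[OF assms(2)] Ck_on_2D[OF assms(3)])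
    then show ?thesis
      using Ck_on_2D(2)[OF assms(2,4)] Ck_on_2D(2)[OF assms(3,4)] by (simp add: partial_diff)
  qed
  then show ?thesis by (simp add: laplacian_def sum_subtractf)
qed

section \<open>Pointwise Laplacians and the maximum principle\<close>

text \<open>Only the restrictions of \<open>u\<close> to the axis-parallel lines through \<open>x\<close> enter, since these decide
  the sign of the Laplacian at a maximum. In this form the Laplacian of a barrier or of a reflected
  function is a matter of one-variable calculus.\<close>

definition axis_second_derivative :: "(real^'n \<Rightarrow> real) \<Rightarrow> real^'n \<Rightarrow> 'n \<Rightarrow> real \<Rightarrow> bool" where
  "axis_second_derivative u x i D \<longleftrightarrow>
     (\<exists>f'. (\<forall>\<^sub>F t in nhds 0. ((\<lambda>s. u (x + s *\<^sub>R axis i 1)) has_real_derivative f' t) (at t)) \<and>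
           (f' has_real_derivative D) (at 0))"

definition has_laplacian :: "(real^'n \<Rightarrow> real) \<Rightarrow> real^'n \<Rightarrow> real \<Rightarrow> bool" where
  "has_laplacian u x l \<longleftrightarrow> (\<exists>D. (\<forall>i. axis_second_derivative u x i (D i)) \<and> l = (\<Sum>i\<in>UNIV. D i))"

lemma axis_second_derivative_add:
  assumes "axis_second_derivative u x i D" "axis_second_derivative v x i E"
  shows "axis_second_derivative (\<lambda>y. u y + v y) x i (D + E)"
proof -
  obtain f' where f: "\<forall>\<^sub>F t in nhds 0. ((\<lambda>s. u (x + s *\<^sub>R axis i 1)) has_real_derivative f' t) (at t)"
    "(f' has_real_derivative D) (at 0)" using assms(1) unfolding axis_second_derivative_def by blast
  obtain g' where g: "\<forall>\<^sub>F t in nhds 0. ((\<lambda>s. v (x + s *\<^sub>R axis i 1)) has_real_derivative g' t) (at t)"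
    "(g' has_real_derivative E) (at 0)" using assms(2) unfolding axis_second_derivative_def by blast
  show ?thesis unfolding axis_second_derivative_def
    by (rule exI[of _ "\<lambda>t. f' t + g' t"], intro conjI eventually_mono[OF eventually_conj[OF f(1) g(1)]] DERIV_add f(2) g(2))
       (auto intro: DERIV_add)
qed

lemma axis_second_derivative_cmult:
  assumes "axis_second_derivative u x i D"
  shows "axis_second_derivative (\<lambda>y. c * u y) x i (c * D)"
proof -
  obtain f' where f: "\<forall>\<^sub>F t in nhds 0. ((\<lambda>s. u (x + s *\<^sub>R axis i 1)) has_real_derivative f' t) (at t)"
    "(f' has_real_derivative D) (at 0)" using assms(1) unfolding axis_second_derivative_def by blast
  show ?thesis unfolding axis_second_derivative_def
    by (rule exI[of _ "\<lambda>t. c * f' t"], intro conjI eventually_mono[OF f(1)] DERIV_cmult f(2))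
qed

lemma has_laplacian_add:
  assumes "has_laplacian u x k" "has_laplacian v x l"
  shows "has_laplacian (\<lambda>y. u y + v y) x (k + l)"
proof -
  obtain D E where "\<And>i. axis_second_derivative u x i (D i)" "k = sum D UNIV"
    "\<And>i. axis_second_derivative v x i (E i)" "l = sum E UNIV"
    using assms unfolding has_laplacian_def by blast
  then show ?thesis unfolding has_laplacian_def
    by (intro exI[of _ "\<lambda>i. D i + E i"]) (auto simp: sum.distrib intro: axis_second_derivative_add)
qed

lemma has_laplacian_cmult:
  assumes "has_laplacian u x k"
  shows "has_laplacian (\<lambda>y. c * u y) x (c * k)"
proof -
  obtain D where "\<And>i. axis_second_derivative u x i (D i)" "k = sum D UNIV"
    using assms unfolding has_laplacian_def by blast
  then show ?thesis unfolding has_laplacian_def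
    by (intro exI[of _ "\<lambda>i. c * D i"]) (auto simp: sum_distrib_left intro: axis_second_derivative_cmult)
qed

lemma has_laplacian_diff:
  assumes "has_laplacian u x k" "has_laplacian v x l"
  shows "has_laplacian (\<lambda>y. u y - v y) x (k - l)"
  using has_laplacian_add[OF assms(1) has_laplacian_cmult[OF assms(2), of "-1"]] by simp

lemma has_laplacian_const: "has_laplacian (\<lambda>y. c) x 0"
  unfolding has_laplacian_def axis_second_derivative_def
  by (intro exI[of _ "\<lambda>_. 0"]) (auto intro!: exI[of _ "\<lambda>_. 0"])

text \<open>Along an axis the squared distance to \<open>z\<close> is a quadratic polynomial with leading coefficient 1,
  so the chain rule gives the second derivative \<open>4 F'' (x\<^sub>i - z\<^sub>i)\<^sup>2 + 2 F'\<close> in direction \<open>i\<close>.\<close>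

lemma has_laplacian_radial:
  fixes x z :: "real^'n" and F F' :: "real \<Rightarrow> real"
  assumes "\<forall>\<^sub>F \<tau> in nhds ((norm (x - z))\<^sup>2). (F has_real_derivative F' \<tau>) (at \<tau>)"
    and "(F' has_real_derivative F'') (at ((norm (x - z))\<^sup>2))"
  shows "has_laplacian (\<lambda>y. F ((norm (y - z))\<^sup>2)) x
           (4 * F'' * (norm (x - z))\<^sup>2 + 2 * real CARD('n) * F' ((norm (x - z))\<^sup>2))"
proof -
  define \<rho> where "\<rho> = (norm (x - z))\<^sup>2"
  have "axis_second_derivative (\<lambda>y. F ((norm (y - z))\<^sup>2)) x i (4 * F'' * ((x - z)$i)\<^sup>2 + 2 * F' \<rho>)" for i
  proof -
    define a where "a = (x - z)$i"
    define q where "q t = \<rho> + 2 * a * t + t\<^sup>2" for t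
    have q: "(norm (x + t *\<^sub>R axis i 1 - z))\<^sup>2 = q t" for t
    proof -
      have "(norm (x + t *\<^sub>R axis i 1 - z))\<^sup>2 = (norm ((x - z) + t *\<^sub>R axis i 1))\<^sup>2"
        by (simp add: algebra_simps)
      also have "\<dots> = \<rho> + 2 * a * t + t\<^sup>2"
        unfolding \<rho>_def a_def power2_norm_eq_inner
        by (simp add: inner_add_left inner_add_right inner_axis inner_axis' power2_eq_square algebra_simps)
      finally show ?thesis by (simp add: q_def)
    qed
    have q0: "q 0 = \<rho>" by (simp add: q_def)
    have dq: "(q has_real_derivative 2 * a + 2 * t) (at t)" for t
      unfolding q_def by (auto intro!: derivative_eq_intros)
    have "filterlim q (nhds (q 0)) (nhds 0)"
      unfolding q_def by (intro tendsto_intros filterlim_ident)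
    then have ev: "\<forall>\<^sub>F t in nhds 0. (F has_real_derivative F' (q t)) (at (q t))"
      by (rule eventually_compose_filterlim[rotated]) (use assms(1) in \<open>simp only: q0 \<rho>_def\<close>)
    have 1: "\<forall>\<^sub>F t in nhds 0. ((\<lambda>s. F (q s)) has_real_derivative F' (q t) * (2 * a + 2 * t)) (at t)"
      using ev by eventually_elim (rule DERIV_chain2[OF _ dq])
    have F': "(F' has_real_derivative F'') (at (q 0))" using assms(2) by (simp only: q0 \<rho>_def)
    have "((\<lambda>t. F' (q t)) has_real_derivative F'' * (2 * a + 2 * 0)) (at 0)"
      by (rule DERIV_chain2[OF F' dq])
    moreover have "((\<lambda>t. 2 * a + 2 * t) has_real_derivative 2) (at 0)"
      by (auto intro!: derivative_eq_intros)
    ultimately have "((\<lambda>t. F' (q t) * (2 * a + 2 * t)) has_real_derivative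
           F'' * (2 * a + 2 * 0) * (2 * a + 2 * 0) + 2 * F' (q 0)) (at 0)"
      by (rule DERIV_mult)
    then have 2: "((\<lambda>t. F' (q t) * (2 * a + 2 * t)) has_real_derivative (4 * F'' * a\<^sup>2 + 2 * F' \<rho>)) (at 0)"
      by (simp add: power2_eq_square q0 algebra_simps)
    show ?thesis
      unfolding axis_second_derivative_def q using 1 2 by (auto simp: a_def)
  qed
  moreover have "(\<Sum>i\<in>UNIV. 4 * F'' * ((x - z)$i)\<^sup>2 + 2 * F' \<rho>) = 4 * F'' * \<rho> + 2 * real CARD('n) * F' \<rho>"
  proof -
    have "\<rho> = (\<Sum>i\<in>UNIV. ((x - z)$i)\<^sup>2)"
      unfolding \<rho>_def power2_norm_eq_inner inner_vec_def by (simp add: power2_eq_square)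
    then show ?thesis by (simp add: sum.distrib sum_distrib_left)
  qed
  ultimately show ?thesis unfolding has_laplacian_def \<rho>_def[symmetric]
    by (intro exI[of _ "\<lambda>i. 4 * F'' * ((x - z)$i)\<^sup>2 + 2 * F' \<rho>"]) simp
qed

lemma has_laplacian_norm_square: "has_laplacian (\<lambda>y. (norm (y - z))\<^sup>2) (x::real^'n) (2 * real CARD('n))"
  using has_laplacian_radial[where F = "\<lambda>t. t" and F' = "\<lambda>_. 1" and F'' = 0 and x = x and z = z] by simp

lemma has_laplacian_coordinate:
  fixes x :: "real^'n" and F F' F'' :: "real \<Rightarrow> real"
  assumes "\<And>t. (F has_real_derivative F' t) (at t)" "\<And>t. (F' has_real_derivative F'' t) (at t)"
  shows "has_laplacian (\<lambda>y. F (y $ i)) x (F'' (x $ i))"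
proof -
  have "axis_second_derivative (\<lambda>y. F (y $ i)) x j (if j = i then F'' (x $ i) else 0)" for j
  proof (cases "j = i")
    case True
    have "((\<lambda>s. F (x $ i + s)) has_real_derivative F' (x $ i + t)) (at t)" for t
      using DERIV_chain2[where f = F and g = "\<lambda>s. x $ i + s" and x = t and s = UNIV, OF assms(1), of 1]
      by (simp add: DERIV_add[OF DERIV_const DERIV_ident, simplified])
    moreover have "((\<lambda>s. F' (x $ i + s)) has_real_derivative F'' (x $ i)) (at 0)"
      using DERIV_chain2[where f = F' and g = "\<lambda>s. x $ i + s" and x = 0 and s = UNIV, OF assms(2), of 1]
      by (simp add: DERIV_add[OF DERIV_const DERIV_ident, simplified])
    ultimately show ?thesis
      using True unfolding axis_second_derivative_def by (auto intro!: exI[of _ "\<lambda>t. F' (x $ i + t)"])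
  next
    case False
    then show ?thesis
      unfolding axis_second_derivative_def by (auto simp: axis_def intro!: exI[of _ "\<lambda>t. 0"])
  qed
  then show ?thesis unfolding has_laplacian_def
    by (intro exI[of _ "\<lambda>j. if j = i then F'' (x $ i) else 0"]) auto
qed

lemma DERIV_along_axis:
  assumes "u differentiable at (x + t *\<^sub>R axis i 1)"
  shows "((\<lambda>s. u (x + s *\<^sub>R axis i 1)) has_real_derivative partial i u (x + t *\<^sub>R axis i 1)) (at t)"
proof -
  let ?D = "frechet_derivative u (at (x + t *\<^sub>R axis i 1))"
  have D: "(u has_derivative ?D) (at (x + t *\<^sub>R axis i 1))"
    using assms by (rule differentiable_has_derivative)
  have 1: "((\<lambda>s. x + s *\<^sub>R axis i 1) has_derivative (\<lambda>s. s *\<^sub>R axis i 1)) (at t)"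
    by (auto intro!: derivative_eq_intros)
  have "((\<lambda>s. u (x + s *\<^sub>R axis i 1)) has_derivative (\<lambda>s. ?D (s *\<^sub>R axis i 1))) (at t)"
    using diff_chain_at[OF 1 D] by (simp add: o_def)
  moreover have "(\<lambda>s. ?D (s *\<^sub>R axis i 1)) = (*) (partial i u (x + t *\<^sub>R axis i 1))"
    using linear_frechet_derivative[OF assms] by (auto simp: fun_eq_iff partial_def linear_cmul)
  ultimately show ?thesis by (simp add: has_field_derivative_def)
qed

lemma eventually_axis_in_open:
  fixes x :: "real^'n"
  assumes "open S" "x \<in> S"
  shows "\<forall>\<^sub>F t in nhds 0. x + t *\<^sub>R axis i 1 \<in> S"
proof -
  have "filterlim (\<lambda>t. x + t *\<^sub>R axis i 1) (nhds (x + 0 *\<^sub>R axis i 1)) (nhds 0)"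
    by (intro tendsto_intros filterlim_ident)
  moreover have "\<forall>\<^sub>F y in nhds (x + 0 *\<^sub>R axis i 1). y \<in> S"
    using assms eventually_nhds_in_open[of S x] by simp
  ultimately show ?thesis by (rule eventually_compose_filterlim[rotated])
qed

lemma Ck_on_2_has_laplacian:
  assumes "open S" "Ck_on 2 S u" "x \<in> S"
  shows "has_laplacian u x (laplacian u x)"
  unfolding has_laplacian_def laplacian_def
proof (intro exI[of _ "\<lambda>i. partial i (partial i u) x"] conjI allI refl)
  fix i
  show "axis_second_derivative u x i (partial i (partial i u) x)"
    unfolding axis_second_derivative_def
  proof (intro exI[of _ "\<lambda>t. partial i u (x + t *\<^sub>R axis i 1)"] conjI)
    show "\<forall>\<^sub>F t in nhds 0. ((\<lambda>s. u (x + s *\<^sub>R axis i 1)) has_real_derivative partial i u (x + t *\<^sub>R axis i 1)) (at t)"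
      using eventually_axis_in_open[OF assms(1,3)]
      by eventually_elim (rule DERIV_along_axis[OF Ck_on_2D(1)[OF assms(2)]])
    show "((\<lambda>t. partial i u (x + t *\<^sub>R axis i 1)) has_real_derivative partial i (partial i u) x) (at 0)"
      using DERIV_along_axis[of "partial i u" x 0 i] Ck_on_2D(2)[OF assms(2,3)] by simp
  qed
qed

text \<open>The second-derivative test: were \<open>D\<close> positive, the first derivative, which vanishes at the
  maximum, would be positive just to the right of it.\<close>

lemma axis_second_derivative_local_max:
  assumes "axis_second_derivative u x i D" "\<forall>\<^sub>F y in nhds x. u y \<le> u x"
  shows "D \<le> 0"
proof (rule ccontr)
  assume "\<not> D \<le> 0"
  define f where "f s = u (x + s *\<^sub>R axis i 1)" for s
  obtain f' where f': "\<forall>\<^sub>F t in nhds 0. (f has_real_derivative f' t) (at t)"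
    and D: "(f' has_real_derivative D) (at 0)"
    using assms(1) unfolding axis_second_derivative_def f_def by blast
  have "filterlim (\<lambda>t. x + t *\<^sub>R axis i 1) (nhds (x + 0 *\<^sub>R axis i 1)) (nhds 0)"
    by (intro tendsto_intros filterlim_ident)
  then have "\<forall>\<^sub>F t in nhds 0. f t \<le> f 0"
    using eventually_compose_filterlim[OF assms(2)] unfolding f_def by simp
  with f' have "\<forall>\<^sub>F t in nhds 0. (f has_real_derivative f' t) (at t) \<and> f t \<le> f 0"
    by eventually_elim auto
  then obtain d where d: "d > 0" "\<And>t. \<bar>t\<bar> < d \<Longrightarrow> (f has_real_derivative f' t) (at t)"
    "\<And>t. \<bar>t\<bar> < d \<Longrightarrow> f t \<le> f 0"
    unfolding eventually_nhds_metric dist_real_def by auto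
  have "f' 0 = 0"
    by (rule DERIV_local_max[of f _ 0 d]) (use d in auto)
  obtain e where e: "e > 0" "\<And>h. 0 < h \<Longrightarrow> h < e \<Longrightarrow> f' 0 < f' (0 + h)"
    using DERIV_pos_inc_right[OF D] \<open>\<not> D \<le> 0\<close> by auto
  define r where "r = min d e / 2"
  have r: "0 < r" "r < d" "r < e" using d(1) e(1) by (auto simp: r_def)
  have "f 0 < f r"
  proof (rule DERIV_pos_imp_increasing_open[OF r(1)])
    show "\<exists>y. (f has_real_derivative y) (at t) \<and> 0 < y" if "0 < t" "t < r" for t
      using d(2)[of t] e(2)[of t] that r \<open>f' 0 = 0\<close> by auto
    show "continuous_on {0..r} f"
      by (intro continuous_at_imp_continuous_on ballI DERIV_isCont) (use d(2) r in force)
  qed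
  then show False using d(3)[of r] r by auto
qed

text \<open>At an interior maximum of a function with positive Laplacian the second-derivative test fails in
  some axis direction. A small multiple of \<open>\<bar>x\<bar>\<^sup>2\<close> reduces the general case to this one.\<close>

lemma maximum_principle:
  fixes v :: "real^'n \<Rightarrow> real"
  assumes "open S" "bounded S" "continuous_on (closure S) v"
    and lap: "\<And>x. x \<in> S \<Longrightarrow> \<exists>l\<ge>0. has_laplacian v x l"
    and bd: "\<And>x. x \<in> frontier S \<Longrightarrow> v x \<le> M"
    and "x \<in> closure S"
  shows "v x \<le> M"
proof (rule ccontr)
  assume "\<not> v x \<le> M"
  obtain B where B: "B > 0" "\<And>y. y \<in> closure S \<Longrightarrow> norm y \<le> B"
    using bounded_closure[OF assms(2)] unfolding bounded_pos by auto
  \<comment> \<open>Small enough that the perturbation \<open>\<epsilon> \<bar>y\<bar>\<^sup>2\<close> cannot lift a boundary value above \<open>v x\<close>.\<close>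
  define \<epsilon> where "\<epsilon> = (v x - M) / (2 * B\<^sup>2)"
  have "\<epsilon> > 0" using \<open>\<not> v x \<le> M\<close> B by (simp add: \<epsilon>_def)
  have eB: "\<epsilon> * B\<^sup>2 < v x - M" using \<open>\<not> v x \<le> M\<close> B by (simp add: \<epsilon>_def field_simps)
  define w where "w y = v y + \<epsilon> * (norm (y - 0))\<^sup>2" for y
  have "compact (closure S)" using assms(2) by simp
  moreover have "continuous_on (closure S) w" unfolding w_def
    by (intro continuous_intros assms)
  moreover have "closure S \<noteq> {}" using \<open>x \<in> closure S\<close> by (metis empty_iff)
  ultimately have "\<exists>y\<in>closure S. \<forall>z\<in>closure S. w z \<le> w y"
    by (metis continuous_attains_sup)
  then obtain y where y: "y \<in> closure S" "\<And>z. z \<in> closure S \<Longrightarrow> w z \<le> w y" by blast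
  have "v x \<le> w x" using \<open>\<epsilon> > 0\<close> by (simp add: w_def)
  also have "\<dots> \<le> w y" using y \<open>x \<in> closure S\<close> by auto
  finally have "v x \<le> w y" .
  show False
  proof (cases "y \<in> S")
    case False
    then have "y \<in> frontier S" using y assms(1) by (simp add: frontier_def interior_open)
    moreover have "(norm y)\<^sup>2 \<le> B\<^sup>2" using B y by (intro power_mono) auto
    ultimately have "w y \<le> M + \<epsilon> * B\<^sup>2"
      unfolding w_def using bd[of y] \<open>\<epsilon> > 0\<close> by (intro add_mono mult_left_mono) auto
    then show False using \<open>v x \<le> w y\<close> eB by simp
  next
    case True
    obtain l where l: "l \<ge> 0" "has_laplacian v y l" using lap True by blast
    have "has_laplacian w y (l + \<epsilon> * (2 * real CARD('n)))"
      unfolding w_def by (intro has_laplacian_add l has_laplacian_cmult has_laplacian_norm_square)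
    then obtain D where D: "\<And>i. axis_second_derivative w y i (D i)" "l + \<epsilon> * (2 * real CARD('n)) = sum D UNIV"
      unfolding has_laplacian_def by blast
    have "\<forall>\<^sub>F z in nhds y. w z \<le> w y"
      unfolding eventually_nhds using True assms(1) y(2) closure_subset by blast
    then have "D i \<le> 0" for i using axis_second_derivative_local_max[OF D(1)] by blast
    then have "sum D UNIV \<le> 0" by (simp add: sum_nonpos)
    moreover have "\<epsilon> * (2 * real CARD('n)) > 0" using \<open>\<epsilon> > 0\<close> by simp
    ultimately show False using D(2) l by linarith
  qed
qed

section \<open>Interior derivative estimates for harmonic functions\<close>

definition reflect :: "'n \<Rightarrow> real^'n \<Rightarrow> real^'n \<Rightarrow> real^'n" where
  "reflect i x y = y - (2 * (y $ i - x $ i)) *\<^sub>R axis i 1"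

lemma norm_reflect: "norm (reflect i x y - x) = norm (y - x)"
proof -
  define a where "a = (y - x) $ i"
  have r: "reflect i x y - x = (y - x) - (2 * a) *\<^sub>R axis i 1"
    by (simp add: reflect_def a_def algebra_simps)
  have "(y - x) \<bullet> axis i 1 = a" by (simp add: a_def inner_axis)
  then have "(reflect i x y - x) \<bullet> (reflect i x y - x) = (y - x) \<bullet> (y - x)"
    unfolding r by (simp add: inner_diff_left inner_diff_right inner_commute inner_axis_axis)
  then show ?thesis by (simp add: norm_eq_sqrt_inner)
qed

text \<open>Reflecting in a coordinate hyperplane maps axis-parallel lines to axis-parallel lines and
  reverses only those in direction \<open>i\<close>, which does not affect second derivatives.\<close>

lemma has_laplacian_reflect:
  assumes "has_laplacian u (reflect i x y) l"
  shows "has_laplacian (\<lambda>z. u (reflect i x z)) y l"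
proof -
  have "axis_second_derivative (\<lambda>z. u (reflect i x z)) y j D"
    if D: "axis_second_derivative u (reflect i x y) j D" for j D
  proof (cases "j = i")
    case False
    then have "reflect i x (y + s *\<^sub>R axis j 1) = reflect i x y + s *\<^sub>R axis j 1" for s
      by (simp add: reflect_def axis_def algebra_simps)
    then show ?thesis using D by (simp add: axis_second_derivative_def)
  next
    case True
    have r: "reflect i x (y + s *\<^sub>R axis j 1) = reflect i x y + (- s) *\<^sub>R axis j 1" for s
      using True by (simp add: reflect_def vec_eq_iff axis_def)
    obtain f' where f: "\<forall>\<^sub>F t in nhds 0. ((\<lambda>s. u (reflect i x y + s *\<^sub>R axis j 1)) has_real_derivative f' t) (at t)"
      "(f' has_real_derivative D) (at 0)" using D unfolding axis_second_derivative_def by blast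
    have "filterlim uminus (nhds (- 0)) (nhds (0::real))"
      by (intro tendsto_intros filterlim_ident)
    then have "\<forall>\<^sub>F t in nhds 0. ((\<lambda>s. u (reflect i x y + s *\<^sub>R axis j 1)) has_real_derivative f' (- t)) (at (- t))"
      using eventually_compose_filterlim[OF f(1), of uminus "nhds 0"] by simp
    then have "\<forall>\<^sub>F t in nhds 0. ((\<lambda>s. u (reflect i x (y + s *\<^sub>R axis j 1))) has_real_derivative - f' (- t)) (at t)"
      by eventually_elim (simp add: DERIV_mirror r)
    moreover have "((\<lambda>t. - f' (- t)) has_real_derivative D) (at 0)"
      using DERIV_minus[of "\<lambda>t. f' (- t)" "- D" 0 UNIV] f(2) DERIV_mirror[of f' D 0] by simp
    ultimately show ?thesis
      unfolding axis_second_derivative_def by (intro exI[of _ "\<lambda>t. - f' (- t)"] conjI)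
  qed
  then show ?thesis using assms unfolding has_laplacian_def by blast
qed

text \<open>The function \<open>v y = u y - u (reflect y)\<close> is harmonic, bounded by \<open>2 M\<close>, and vanishes on the
  hyperplane through \<open>x\<close> orthogonal to the axis \<open>i\<close>. On the half ball it lies below a harmonic
  quadratic polynomial that is nonnegative on the flat part of the boundary and at least \<open>2 M\<close> on
  the spherical part. Both functions vanish at \<open>x\<close>, so their slopes there in direction \<open>i\<close>, which
  are \<open>2 \<partial>\<^sub>i u x\<close> and \<open>2 n M / d\<close>, are ordered as well.\<close>

lemma harmonic_partial_le:
  fixes u :: "real^'n \<Rightarrow> real" and M d :: real
  assumes "open S" "Ck_on 2 S u" and harm: "\<And>y. y \<in> S \<Longrightarrow> laplacian u y = 0"
    and "cball x d \<subseteq> S" "d > 0" and M: "\<And>y. y \<in> cball x d \<Longrightarrow> \<bar>u y\<bar> \<le> M"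
  shows "partial i u x \<le> CARD('n) * M / d"
proof (rule ccontr)
  let ?n = "real CARD('n)"
  assume neg: "\<not> ?thesis"
  \<comment> \<open>The comparison function: its Laplacian is \<open>2 M / d\<^sup>2 (2 n - 2 n) = 0\<close>.\<close>
  define P where "P s = ?n * d * (s - x $ i) - ?n * (s - x $ i)\<^sup>2" for s
  define \<psi> where "\<psi> y = 2 * M / d\<^sup>2 * ((norm (y - x))\<^sup>2 + P (y $ i))" for y
  define v where "v y = u y - u (reflect i x y) - \<psi> y" for y
  define H where "H = {y \<in> ball x d. x $ i < y $ i}"
  have "M \<ge> 0" using M[of x] \<open>d > 0\<close> by simp
  have refl_cball: "reflect i x y \<in> cball x d \<longleftrightarrow> y \<in> cball x d" for y
    using norm_reflect[of i x y] by (simp add: dist_norm norm_minus_commute)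
  have "open H"
  proof -
    have "H = ball x d \<inter> {y. x $ i < y $ i}" by (auto simp: H_def)
    then show ?thesis by (auto intro!: open_Int open_Collect_less continuous_intros)
  qed
  have "closed {y \<in> cball x d. x $ i \<le> y $ i}"
  proof -
    have "{y \<in> cball x d. x $ i \<le> y $ i} = cball x d \<inter> {y. x $ i \<le> y $ i}" by auto
    then show ?thesis by (auto intro!: closed_Int closed_Collect_le continuous_intros)
  qed
  then have clH: "closure H \<subseteq> {y \<in> cball x d. x $ i \<le> y $ i}"
    by (rule closure_minimal[rotated]) (auto simp: H_def)
  have cont_refl: "continuous_on A (reflect i x)" for A
    unfolding reflect_def by (intro continuous_intros)
  have "v y \<le> 0" if "y \<in> closure H" for y
  proof (rule maximum_principle[OF \<open>open H\<close> _ _ _ _ that])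
    show "bounded H" by (rule bounded_subset[of "ball x d"]) (auto simp: H_def)
    have "continuous_on (cball x d) u"
      using Ck_on_2D(3)[OF assms(2)] assms(4) continuous_on_subset by blast
    moreover have "continuous_on (cball x d) (\<lambda>y. u (reflect i x y))"
      by (rule continuous_on_compose2[OF calculation cont_refl]) (use refl_cball in auto)
    ultimately have "continuous_on (cball x d) v"
      unfolding v_def \<psi>_def P_def by (intro continuous_intros)
    then show "continuous_on (closure H) v"
      by (rule continuous_on_subset) (use clH in auto)
    show "\<exists>l\<ge>0. has_laplacian v y l" if "y \<in> H" for y
    proof -
      have y: "y \<in> cball x d" using that by (auto simp: H_def)
      have 1: "has_laplacian u y 0"
        using Ck_on_2_has_laplacian[OF assms(1,2)] harm y assms(4) by (metis subsetD)
      have "has_laplacian u (reflect i x y) 0"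
        using Ck_on_2_has_laplacian[OF assms(1,2)] harm y refl_cball assms(4) by (metis subsetD)
      then have 2: "has_laplacian (\<lambda>y. u (reflect i x y)) y 0" by (rule has_laplacian_reflect)
      have 3: "has_laplacian (\<lambda>y. P (y $ i)) y (- 2 * ?n)"
      proof -
        have "(P has_real_derivative ?n * d - 2 * ?n * (t - x $ i)) (at t)" for t
          unfolding P_def by (auto intro!: derivative_eq_intros)
        moreover have "((\<lambda>t. ?n * d - 2 * ?n * (t - x $ i)) has_real_derivative - 2 * ?n) (at t)" for t
          by (auto intro!: derivative_eq_intros)
        ultimately show ?thesis by (rule has_laplacian_coordinate)
      qed
      have "has_laplacian \<psi> y (2 * M / d\<^sup>2 * (2 * ?n + - 2 * ?n))"
        unfolding \<psi>_def by (intro has_laplacian_cmult has_laplacian_add has_laplacian_norm_square 3)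
      then have "has_laplacian v y (0 - 0 - 2 * M / d\<^sup>2 * (2 * ?n + - 2 * ?n))"
        unfolding v_def by (intro has_laplacian_diff 1 2)
      then show ?thesis by auto
    qed
    show "v y \<le> 0" if "y \<in> frontier H" for y
    proof -
      have y: "y \<in> cball x d" "x $ i \<le> y $ i" "y \<notin> H"
        using that clH \<open>open H\<close> by (auto simp: frontier_def interior_open)
      have yd: "y $ i - x $ i \<le> d"
        using component_le_norm_cart[of "y - x" i] y(1) by (simp add: dist_norm norm_minus_commute)
      have P: "P (y $ i) \<ge> 0"
      proof -
        have "P (y $ i) = ?n * ((y $ i - x $ i) * (d - (y $ i - x $ i)))"
          by (simp add: P_def power2_eq_square algebra_simps)
        then show ?thesis using y(2) yd by simp
      qed
      show ?thesis
      proof (cases "y $ i = x $ i")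
        case True
        then have "reflect i x y = y" by (simp add: reflect_def)
        then show ?thesis using P \<open>M \<ge> 0\<close> by (simp add: v_def \<psi>_def)
      next
        case False
        then have "norm (y - x) = d"
          using y by (auto simp: H_def dist_norm norm_minus_commute)
        then have "\<psi> y \<ge> 2 * M / d\<^sup>2 * d\<^sup>2"
          unfolding \<psi>_def using P \<open>M \<ge> 0\<close> by (intro mult_left_mono) auto
        then have "\<psi> y \<ge> 2 * M" using \<open>d > 0\<close> by simp
        moreover have "\<bar>u y\<bar> \<le> M" "\<bar>u (reflect i x y)\<bar> \<le> M"
          using M y(1) refl_cball by blast+
        ultimately show ?thesis by (simp add: v_def)
      qed
    qed
  qed
  note v = this
  define G where "G t = v (x + t *\<^sub>R axis i 1)" for t
  have G: "G t = u (x + t *\<^sub>R axis i 1) - u (x + (- t) *\<^sub>R axis i 1) - 2 * M / d\<^sup>2 * (t\<^sup>2 + (?n * d * t - ?n * t\<^sup>2))" for t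
  proof -
    have "reflect i x (x + t *\<^sub>R axis i 1) = x + (- t) *\<^sub>R axis i 1"
      by (simp add: reflect_def vec_eq_iff axis_def)
    then show ?thesis by (simp add: G_def v_def \<psi>_def P_def)
  qed
  have "x \<in> S" using assms(4,5) by (metis centre_in_cball less_imp_le subsetD)
  then have dif: "u differentiable at (x + 0 *\<^sub>R axis i 1)"
    using Ck_on_2D(1)[OF assms(2)] by simp
  note d1 = DERIV_along_axis[OF dif]
  have "((\<lambda>t. u (x + (- t) *\<^sub>R axis i 1)) has_real_derivative - partial i u (x + 0 *\<^sub>R axis i 1)) (at 0)"
    using d1 DERIV_mirror[of "\<lambda>t. u (x + t *\<^sub>R axis i 1)" "partial i u x" 0] by simp
  moreover have "((\<lambda>t. 2 * M / d\<^sup>2 * (t\<^sup>2 + (?n * d * t - ?n * t\<^sup>2))) has_real_derivative 2 * M / d\<^sup>2 * (?n * d)) (at 0)"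
    by (rule DERIV_cmult) (auto intro!: derivative_eq_intros)
  ultimately have "(G has_real_derivative partial i u (x + 0 *\<^sub>R axis i 1) - (- partial i u (x + 0 *\<^sub>R axis i 1)) - 2 * M / d\<^sup>2 * (?n * d)) (at 0)"
    unfolding G[abs_def] by (intro DERIV_diff d1)
  moreover have "2 * M / d\<^sup>2 * (?n * d) = 2 * (?n * M / d)"
    using \<open>d > 0\<close> by (simp add: power2_eq_square)
  ultimately have "(G has_real_derivative 2 * (partial i u x - ?n * M / d)) (at 0)"
    by (simp add: algebra_simps)
  moreover have "0 < 2 * (partial i u x - ?n * M / d)" using neg by simp
  ultimately obtain e where e: "e > 0" "\<And>h. 0 < h \<Longrightarrow> h < e \<Longrightarrow> G 0 < G (0 + h)"
    using DERIV_pos_inc_right by blast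
  define t where "t = min d e / 2"
  have t: "0 < t" "t < d" "t < e" using e(1) \<open>d > 0\<close> by (auto simp: t_def)
  \<comment> \<open>The point on the axis stays in the half ball, where \<open>v \<le> 0\<close>, yet \<open>G\<close> is increasing at 0.\<close>
  have "x + t *\<^sub>R axis i 1 \<in> H"
    using t by (simp add: H_def dist_norm)
  then have "G t \<le> 0" unfolding G_def using v closure_subset by blast
  moreover have "G 0 = 0" by (simp add: G)
  ultimately show False using e(2)[OF t(1,3)] by simp
qed

lemma laplacian_const: "laplacian (\<lambda>y. c) (x::real^'n) = 0"
proof -
  have "partial i (\<lambda>x::real^'n. c) = (\<lambda>x. 0)" for i c by (rule ext) (rule partial_const)
  then show ?thesis by (simp add: laplacian_def)
qed

lemma laplacian_uminus:
  assumes "open S" "Ck_on 2 S u" "x \<in> S"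
  shows "laplacian (\<lambda>y. - u y) x = - laplacian u x"
  using laplacian_diff[OF assms(1) Ck_on_const assms(2,3), of 0] by (simp add: laplacian_const)

lemma partial_uminus: "u differentiable at x \<Longrightarrow> partial i (\<lambda>y. - u y) x = - partial i u x"
  using partial_cmult[of u x i "-1"] by simp

lemma Ck_on_uminus: "open S \<Longrightarrow> Ck_on k S u \<Longrightarrow> Ck_on k S (\<lambda>y. - u y)"
  using Ck_on_diff[OF _ Ck_on_const[of k S 0], of u] by simp

lemma harmonic_partial_bound:
  fixes u :: "real^'n \<Rightarrow> real" and M d :: real
  assumes "open S" "Ck_on 2 S u" and harm: "\<And>y. y \<in> S \<Longrightarrow> laplacian u y = 0"
    and "cball x d \<subseteq> S" "d > 0" and M: "\<And>y. y \<in> cball x d \<Longrightarrow> \<bar>u y\<bar> \<le> M"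
  shows "\<bar>partial i u x\<bar> \<le> CARD('n) * M / d"
proof -
  have "partial i u x \<le> CARD('n) * M / d"
    by (rule harmonic_partial_le[OF assms])
  moreover have "partial i (\<lambda>y. - u y) x \<le> CARD('n) * M / d"
    by (rule harmonic_partial_le[of S]) (use assms laplacian_uminus[OF assms(1,2)] in \<open>auto intro: Ck_on_uminus\<close>)
  moreover have "u differentiable at x"
    using Ck_on_2D(1)[OF assms(2)] assms(4,5) by (metis centre_in_cball less_imp_le subsetD)
  ultimately show ?thesis using partial_uminus[of u x i] by linarith
qed

lemma norm_gradient_le: 
  fixes x :: "real^'n" and B :: real
  assumes "\<And>i. \<bar>partial i u x\<bar> \<le> B"
  shows "norm (gradient u x) \<le> CARD('n) * B"
proof -
  have "norm (gradient u x) \<le> (\<Sum>i\<in>UNIV. \<bar>gradient u x $ i\<bar>)" by (rule norm_le_l1_cart)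
  also have "\<dots> \<le> (\<Sum>i\<in>(UNIV::'n set). B)" using assms by (intro sum_mono) (simp add: gradient_def)
  finally show ?thesis by simp
qed

lemma partial_translate:
  fixes u :: "real^'n \<Rightarrow> real"
  shows "partial i (\<lambda>y. u (y + a)) x = partial i u (x + a)"
proof -
  have 1: "((\<lambda>y. v (y + b)) has_derivative D) (at z)" if "(v has_derivative D) (at (z + b))"
    for v :: "real^'n \<Rightarrow> real" and b z D
  proof -
    have "((\<lambda>y. y + b) has_derivative (\<lambda>h. h)) (at z)"
      by (auto intro!: derivative_eq_intros)
    from has_derivative_compose[OF this that] show ?thesis .
  qed
  have "((\<lambda>y. u (y + a)) has_derivative D) (at x) \<longleftrightarrow> (u has_derivative D) (at (x + a))" for D
    using 1[of u D x a] 1[of "\<lambda>y. u (y + a)" D "x + a" "- a"] by auto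
  then show ?thesis by (simp add: partial_def frechet_derivative_def)
qed

lemma Ck_on_translate:
  "Ck_on k S u \<Longrightarrow> (\<And>y. y \<in> T \<Longrightarrow> y + a \<in> S) \<Longrightarrow> Ck_on k T (\<lambda>y. u (y + a))"
proof (induction k arbitrary: u)
  case 0
  then show ?case
    by (auto intro!: continuous_on_compose2[where g = u and f = "\<lambda>y. y + a"] continuous_intros)
next
  case (Suc k)
  have "(\<lambda>y. u (y + a)) differentiable at x" if "x \<in> T" for x
    using differentiable_compose[of u "\<lambda>y. y + a" x UNIV] Suc.prems that by auto
  moreover have "partial i (\<lambda>y. u (y + a)) = (\<lambda>y. partial i u (y + a))" for i
    by (rule ext) (rule partial_translate)
  ultimately show ?case using Suc by auto
qed

text \<open>Difference quotients of \<open>u\<close> are harmonic, \<open>C\<^sup>2\<close>, and bounded by the first-derivative estimate,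
  so the same estimate applies to them. This avoids third derivatives of \<open>u\<close>, which would be needed
  to regard \<open>\<partial>\<^sub>i u\<close> itself as a \<open>C\<^sup>2\<close> harmonic function.\<close>

lemma harmonic_second_partial_bound:
  fixes u :: "real^'n \<Rightarrow> real" and M d :: real
  assumes "open S" "Ck_on 2 S u" and harm: "\<And>y. y \<in> S \<Longrightarrow> laplacian u y = 0"
    and sub: "cball x (3 * d) \<subseteq> S" and "d > 0" and M: "\<And>y. y \<in> cball x (3 * d) \<Longrightarrow> \<bar>u y\<bar> \<le> M"
  shows "\<bar>partial j (partial i u) x\<bar> \<le> CARD('n) * (CARD('n) * M / d) / d"
proof -
  let ?B = "CARD('n) * M / d"
  have first: "\<bar>partial j u y\<bar> \<le> ?B" if "y \<in> cball x (2 * d)" for y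
  proof (rule harmonic_partial_bound[OF assms(1,2) harm])
    show "\<bar>u z\<bar> \<le> M" if "z \<in> cball y d" for z
      using M that \<open>y \<in> cball x (2 * d)\<close> dist_triangle[of x z y] by auto
    have "cball y d \<subseteq> cball x (3 * d)"
    proof
      fix z assume "z \<in> cball y d"
      then show "z \<in> cball x (3 * d)" using that dist_triangle[of x z y] by auto
    qed
    then show "cball y d \<subseteq> S" using sub by blast
  qed (use \<open>d > 0\<close> in auto)
  \<comment> \<open>The quotient is the partial derivative at \<open>x\<close> of the harmonic difference quotient \<open>w\<close>.\<close>
  have quot: "\<bar>(partial i u (x + h *\<^sub>R axis j 1) - partial i u x) / h\<bar> \<le> CARD('n) * ?B / d"
    if h: "0 < h" "h < d" for h
  proof -
    define a :: "real^'n" where "a = h *\<^sub>R axis j 1"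
    define T where "T = {y \<in> S. y + a \<in> S}"
    define w where "w y = (1/h) * (u (y + a) - u y)" for y
    have [simp]: "norm a = h" using h by (simp add: a_def)
    have "open T"
    proof -
      have "T = S \<inter> (\<lambda>y. y + a) -` S" by (auto simp: T_def)
      then show ?thesis using assms(1) by (auto intro!: open_Int open_vimage continuous_intros)
    qed
    have C1: "Ck_on 2 T u" by (rule Ck_on_subset[OF assms(2)]) (auto simp: T_def)
    have C2: "Ck_on 2 T (\<lambda>y. u (y + a))" by (rule Ck_on_translate[OF assms(2)]) (auto simp: T_def)
    have C3: "Ck_on 2 T (\<lambda>y. u (y + a) - u y)" by (intro Ck_on_diff C1 C2 \<open>open T\<close>)
    have C: "Ck_on 2 T w" unfolding w_def by (intro Ck_on_mult Ck_on_const C3 \<open>open T\<close>)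
    have lapT: "laplacian w y = 0" if "y \<in> T" for y
    proof -
      have tr: "partial i (\<lambda>y. u (y + a)) = (\<lambda>y. partial i u (y + a))" for u :: "real^'n \<Rightarrow> real" and i
        by (rule ext) (rule partial_translate)
      have "laplacian (\<lambda>y. u (y + a)) y = laplacian u (y + a)"
        by (simp add: laplacian_def tr)
      then have l: "laplacian (\<lambda>y. u (y + a) - u y) y = 0"
        using laplacian_diff[OF \<open>open T\<close> C2 C1 that] harm that by (simp add: T_def)
      have "partial i w z = (1/h) * partial i (\<lambda>y. u (y + a) - u y) z" if "z \<in> T" for i z
        unfolding w_def by (rule partial_cmult) (use Ck_on_2D(1)[OF C3 that] in simp)
      then have "partial i (partial i w) y = partial i (\<lambda>z. (1/h) * partial i (\<lambda>y. u (y + a) - u y) z) y" for i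
        by (rule partial_cong[OF \<open>open T\<close> that])
      also have "\<dots> i = (1/h) * partial i (partial i (\<lambda>y. u (y + a) - u y)) y" for i
        by (rule partial_cmult) (use Ck_on_2D(2)[OF C3 that] in simp)
      finally show ?thesis using l by (simp add: laplacian_def flip: sum_divide_distrib)
    qed
    have inT: "cball x d \<subseteq> T"
    proof
      fix y assume y: "y \<in> cball x d"
      then have "dist x (y + a) \<le> 2 * d"
        using dist_triangle[of x "y + a" y] h by (simp add: dist_norm)
      then show "y \<in> T" using y sub \<open>d > 0\<close> by (auto simp: T_def subset_iff)
    qed
    have "\<bar>w y\<bar> \<le> ?B" if y: "y \<in> cball x d" for y
    proof -
      have seg: "y + t *\<^sub>R axis j 1 \<in> cball x (2 * d)" if "0 \<le> t" "t \<le> h" for t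
        using dist_triangle[of x "y + t *\<^sub>R axis j 1" y] that y h by (simp add: dist_norm)
      then have inS: "y + t *\<^sub>R axis j 1 \<in> S" if "0 \<le> t" "t \<le> h" for t
        using that sub \<open>d > 0\<close> by (force simp: subset_iff)
      have "\<exists>z>0. z < h \<and> u (y + h *\<^sub>R axis j 1) - u (y + 0 *\<^sub>R axis j 1) = (h - 0) * partial j u (y + z *\<^sub>R axis j 1)"
        by (rule MVT2[OF h(1)]) (auto intro!: DERIV_along_axis Ck_on_2D(1)[OF assms(2)] inS)
      then obtain z where z: "0 < z" "z < h" "u (y + a) - u y = h * partial j u (y + z *\<^sub>R axis j 1)"
        by (auto simp: a_def)
      then have "w y = partial j u (y + z *\<^sub>R axis j 1)" using h by (simp add: w_def)
      then show ?thesis using first[OF seg[of z]] z by simp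
    qed
    then have "\<bar>partial i w x\<bar> \<le> CARD('n) * ?B / d"
      by (intro harmonic_partial_bound[OF \<open>open T\<close> C lapT inT \<open>d > 0\<close>])
    moreover have "partial i w x = (1/h) * (partial i u (x + a) - partial i u x)"
    proof -
      have "x \<in> T" using inT \<open>d > 0\<close> by auto
      then show ?thesis
        unfolding w_def
        using Ck_on_2D(1)[OF C1] Ck_on_2D(1)[OF C2] Ck_on_2D(1)[OF C3]
        by (subst partial_cmult) (simp_all add: partial_diff partial_translate)
    qed
    ultimately show ?thesis by (simp add: a_def)
  qed
  have "x \<in> S" using sub \<open>d > 0\<close> by auto
  then have "((\<lambda>s. partial i u (x + s *\<^sub>R axis j 1)) has_real_derivative partial j (partial i u) x) (at 0)"
    using DERIV_along_axis[of "partial i u" x 0 j] Ck_on_2D(2)[OF assms(2)] by simp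
  then have "((\<lambda>h. (partial i u (x + h *\<^sub>R axis j 1) - partial i u x) / h) \<longlongrightarrow> partial j (partial i u) x) (at 0)"
    by (simp add: DERIV_def)
  from tendsto_rabs[OF tendsto_within_subset[OF this subset_UNIV]]
  have "((\<lambda>h. \<bar>(partial i u (x + h *\<^sub>R axis j 1) - partial i u x) / h\<bar>) \<longlongrightarrow> \<bar>partial j (partial i u) x\<bar>) (at_right 0)" .
  then show ?thesis
  proof (rule tendsto_upperbound)
    show "\<forall>\<^sub>F h in at_right 0. \<bar>(partial i u (x + h *\<^sub>R axis j 1) - partial i u x) / h\<bar> \<le> CARD('n) * ?B / d"
      unfolding eventually_at_right_field using quot \<open>d > 0\<close> by blast
  qed auto
qed


section \<open>Uniform limits of harmonic functions\<close>

lemma C1_limit: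
  fixes u :: "nat \<Rightarrow> real^'n \<Rightarrow> real"
  assumes "open S" and dif: "\<And>k y. y \<in> S \<Longrightarrow> u k differentiable at y"
    and lim: "\<And>y. y \<in> S \<Longrightarrow> (\<lambda>k. u k y) \<longlonglongrightarrow> w y"
    and unif: "\<And>i. uniform_limit (ball x e) (\<lambda>k. partial i (u k)) (v i) sequentially"
    and "ball x e \<subseteq> S" "e > 0"
  shows "(w has_derivative (\<lambda>h. (\<chi> i. v i x) \<bullet> h)) (at x)"
proof -
  define V where "V y = (\<chi> i. v i y)" for y
  have "\<exists>g. \<forall>y\<in>ball x e. (\<lambda>k. u k y) \<longlonglongrightarrow> g y \<and> (g has_derivative (\<lambda>h. V y \<bullet> h)) (at y within ball x e)"
  proof (rule has_derivative_sequence)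
    show "convex (ball x e)" by simp
    show "(u k has_derivative (\<lambda>h. gradient (u k) y \<bullet> h)) (at y within ball x e)" if "y \<in> ball x e" for k y
      using has_derivative_gradient[OF dif] that assms(5) by (metis has_derivative_at_withinI subsetD)
    show "\<forall>\<^sub>F k in sequentially. \<forall>y\<in>ball x e. \<forall>h. norm (gradient (u k) y \<bullet> h - V y \<bullet> h) \<le> r * norm h"
      if "r > 0" for r
    proof -
      have "\<forall>\<^sub>F k in sequentially. \<forall>i. \<forall>y\<in>ball x e. dist (partial i (u k) y) (v i y) < r / CARD('n)"
        using unif that by (auto simp: uniform_limit_iff intro!: eventually_all_finite)
      then show ?thesis
      proof eventually_elim
        case (elim k)
        show ?case
        proof (intro ballI allI)
          fix y h assume y: "y \<in> ball x e"
          have "norm (gradient (u k) y - V y) \<le> (\<Sum>i\<in>UNIV. \<bar>(gradient (u k) y - V y) $ i\<bar>)"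
            by (rule norm_le_l1_cart)
          also have "\<dots> \<le> (\<Sum>i\<in>(UNIV::'n set). r / CARD('n))"
            using elim y by (intro sum_mono) (simp add: gradient_def V_def dist_real_def less_imp_le)
          finally have "norm (gradient (u k) y - V y) \<le> r" by simp
          moreover have "norm (gradient (u k) y \<bullet> h - V y \<bullet> h) \<le> norm (gradient (u k) y - V y) * norm h"
            using Cauchy_Schwarz_ineq2[of "gradient (u k) y - V y" h] by (simp add: inner_diff_left)
          ultimately show "norm (gradient (u k) y \<bullet> h - V y \<bullet> h) \<le> r * norm h"
            by (meson mult_right_mono norm_ge_zero order_trans)
        qed
      qed
    qed
    show "x \<in> ball x e" using \<open>e > 0\<close> by simp
    then show "(\<lambda>k. u k x) \<longlonglongrightarrow> w x" using lim assms(5) by blast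
  qed
  then obtain g where g: "\<And>y. y \<in> ball x e \<Longrightarrow> (\<lambda>k. u k y) \<longlonglongrightarrow> g y"
    "(g has_derivative (\<lambda>h. V x \<bullet> h)) (at x within ball x e)"
    using \<open>e > 0\<close> centre_in_ball by blast
  have "g y = w y" if "y \<in> ball x e" for y
    using LIMSEQ_unique[OF g(1) lim] that assms(5) by blast
  moreover have "(g has_derivative (\<lambda>h. V x \<bullet> h)) (at x)"
    using g(2) \<open>e > 0\<close> by (simp add: at_within_open[of x "ball x e"])
  ultimately have "(w has_derivative (\<lambda>h. V x \<bullet> h)) (at x)"
    using has_derivative_transform_within_open[of g _ x UNIV "ball x e" w] \<open>e > 0\<close> by simp
  then show ?thesis by (simp add: V_def)
qed

text \<open>The derivative estimates, applied to the differences \<open>u k - u l\<close>, show that the partial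
  derivatives of order one and two are locally uniformly Cauchy. Hence the limit may be
  differentiated twice term by term.\<close>

lemma harmonic_uniform_limit:
  fixes u :: "nat \<Rightarrow> real^'n \<Rightarrow> real"
  assumes "open S" and C2: "\<And>k. Ck_on 2 S (u k)" and harm: "\<And>k x. x \<in> S \<Longrightarrow> laplacian (u k) x = 0"
    and lim: "uniform_limit S u w sequentially"
  shows "Ck_on 2 S w"
    and "\<And>x. x \<in> S \<Longrightarrow> laplacian w x = 0"
    and "\<And>x i. x \<in> S \<Longrightarrow> (\<lambda>k. partial i (u k) x) \<longlonglongrightarrow> partial i w x"
proof -
  define v where "v i x = lim (\<lambda>k. partial i (u k) x)" for i x
  define vv where "vv i j x = lim (\<lambda>k. partial j (partial i (u k)) x)" for i j x
  have diffC: "Ck_on 2 S (\<lambda>x. u k x - u l x)" for k l by (intro Ck_on_diff C2 \<open>open S\<close>)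
  have lapC: "laplacian (\<lambda>x. u k x - u l x) x = 0" if "x \<in> S" for k l x
    using laplacian_diff[OF \<open>open S\<close> C2 C2 that] harm[OF that] by simp
  have bdiff: "\<exists>M. \<forall>k\<ge>M. \<forall>l\<ge>M. \<forall>z\<in>S. \<bar>u k z - u l z\<bar> \<le> e" if "e > 0" for e
  proof -
    have "\<forall>\<^sub>F k in sequentially. \<forall>z\<in>S. dist (u k z) (w z) < e / 2"
      using uniform_limitD[OF lim half_gt_zero[OF that]] .
    then obtain M where M: "\<And>k z. k \<ge> M \<Longrightarrow> z \<in> S \<Longrightarrow> \<bar>u k z - w z\<bar> < e / 2"
      unfolding eventually_sequentially dist_real_def by blast
    have "\<bar>u k z - u l z\<bar> \<le> e" if "k \<ge> M" "l \<ge> M" "z \<in> S" for k l z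
      using M[OF that(1,3)] M[OF that(2,3)] by linarith
    then show ?thesis by blast
  qed
  have unif: "\<exists>e>0. ball x e \<subseteq> S \<and> (\<forall>i. uniform_limit (ball x e) (\<lambda>k. partial i (u k)) (v i) sequentially)
      \<and> (\<forall>i j. uniform_limit (ball x e) (\<lambda>k. partial j (partial i (u k))) (vv i j) sequentially)"
    if xS: "x \<in> S" for x
  proof -
    let ?n = "real CARD('n)"
    obtain r where r: "r > 0" "cball x r \<subseteq> S" using \<open>open S\<close> xS by (meson open_contains_cball)
    \<comment> \<open>Balls of radius \<open>3 d\<close> around points of \<open>ball x d\<close> stay inside \<open>cball x r\<close>.\<close>
    define d where "d = r / 4"
    have "d > 0" using r by (simp add: d_def)
    have sub: "cball y (3 * d) \<subseteq> S" if "y \<in> ball x d" for y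
    proof -
      have "z \<in> cball x r" if "z \<in> cball y (3 * d)" for z
        using \<open>y \<in> ball x d\<close> that dist_triangle[of x z y] by (simp add: d_def)
      then show ?thesis using r by blast
    qed
    have subd: "cball y d \<subseteq> S" if "y \<in> ball x d" for y
      using sub[OF that] \<open>d > 0\<close> by (force simp: subset_iff)
    have 1: "uniformly_Cauchy_on (ball x d) (\<lambda>k. partial i (u k))" for i
    proof (rule uniformly_Cauchy_onI)
      fix e :: real assume "e > 0"
      define \<epsilon> where "\<epsilon> = e * d / (2 * ?n)"
      have "\<epsilon> > 0" using \<open>e > 0\<close> \<open>d > 0\<close> by (simp add: \<epsilon>_def)
      then obtain M where M: "\<And>k l z. k \<ge> M \<Longrightarrow> l \<ge> M \<Longrightarrow> z \<in> S \<Longrightarrow> \<bar>u k z - u l z\<bar> \<le> \<epsilon>"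
        using bdiff[of \<epsilon>] by blast
      have "dist (partial i (u k) y) (partial i (u l) y) < e" if y: "y \<in> ball x d" and kl: "k \<ge> M" "l \<ge> M" for y k l
      proof -
        have "\<bar>partial i (\<lambda>x. u k x - u l x) y\<bar> \<le> ?n * \<epsilon> / d"
          by (rule harmonic_partial_bound[OF \<open>open S\<close> diffC lapC subd[OF y] \<open>d > 0\<close> M[OF kl]])
             (use subd[OF y] in auto)
        also have "\<dots> < e" using \<open>d > 0\<close> \<open>e > 0\<close> by (simp add: \<epsilon>_def)
        moreover have "y \<in> S" using subd[OF y] \<open>d > 0\<close> by auto
        ultimately show ?thesis
          by (simp add: dist_real_def partial_diff Ck_on_2D(1)[OF C2])
      qed
      then show "\<exists>M. \<forall>y\<in>ball x d. \<forall>k\<ge>M. \<forall>l\<ge>M. dist (partial i (u k) y) (partial i (u l) y) < e" by blast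
    qed
    have 2: "uniformly_Cauchy_on (ball x d) (\<lambda>k. partial j (partial i (u k)))" for i j
    proof (rule uniformly_Cauchy_onI)
      fix e :: real assume "e > 0"
      define \<epsilon> where "\<epsilon> = e * d * d / (2 * ?n * ?n)"
      have "\<epsilon> > 0" using \<open>e > 0\<close> \<open>d > 0\<close> by (simp add: \<epsilon>_def)
      then obtain M where M: "\<And>k l z. k \<ge> M \<Longrightarrow> l \<ge> M \<Longrightarrow> z \<in> S \<Longrightarrow> \<bar>u k z - u l z\<bar> \<le> \<epsilon>"
        using bdiff[of \<epsilon>] by blast
      have "dist (partial j (partial i (u k)) y) (partial j (partial i (u l)) y) < e"
        if y: "y \<in> ball x d" and kl: "k \<ge> M" "l \<ge> M" for y k l
      proof -
        have "\<bar>partial j (partial i (\<lambda>x. u k x - u l x)) y\<bar> \<le> ?n * (?n * \<epsilon> / d) / d"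
          by (rule harmonic_second_partial_bound[OF \<open>open S\<close> diffC lapC sub[OF y] \<open>d > 0\<close> M[OF kl]])
             (use sub[OF y] in auto)
        also have "\<dots> < e" using \<open>d > 0\<close> \<open>e > 0\<close> by (simp add: \<epsilon>_def)
        finally have "\<bar>partial j (partial i (\<lambda>x. u k x - u l x)) y\<bar> < e" .
        moreover have "y \<in> S" using subd[OF y] \<open>d > 0\<close> by auto
        moreover have "partial j (partial i (\<lambda>x. u k x - u l x)) y = partial j (\<lambda>x. partial i (u k) x - partial i (u l) x) y"
          by (rule partial_cong[OF \<open>open S\<close> \<open>y \<in> S\<close>]) (simp add: partial_diff Ck_on_2D(1)[OF C2])
        ultimately show ?thesis
          by (simp add: dist_real_def partial_diff Ck_on_2D(2)[OF C2])
      qed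
      then show "\<exists>M. \<forall>y\<in>ball x d. \<forall>k\<ge>M. \<forall>l\<ge>M. dist (partial j (partial i (u k)) y) (partial j (partial i (u l)) y) < e"
        by blast
    qed
    have "ball x d \<subseteq> S" using r by (auto simp: d_def subset_iff)
    with \<open>d > 0\<close> 1 2 show ?thesis
      unfolding v_def vv_def
      by (auto simp flip: uniformly_convergent_uniform_limit_iff intro!: exI[of _ d] Cauchy_uniformly_convergent)
  qed
  have Dw: "(w has_derivative (\<lambda>h. (\<chi> i. v i x) \<bullet> h)) (at x)" if xS: "x \<in> S" for x
  proof -
    obtain e where e: "e > 0" "ball x e \<subseteq> S" "\<And>i. uniform_limit (ball x e) (\<lambda>k. partial i (u k)) (v i) sequentially"
      using unif[OF xS] by blast
    show ?thesis
      by (rule C1_limit[OF \<open>open S\<close> _ _ e(3) e(2,1)])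
         (use Ck_on_2D(1)[OF C2] lim tendsto_uniform_limitI in auto)
  qed
  have pw: "partial i w x = v i x" if "x \<in> S" for i x
    using partial_eqI[OF Dw[OF that]] by (simp add: inner_axis)
  have limv: "(\<lambda>k. partial i (u k) x) \<longlonglongrightarrow> v i x" and limvv: "(\<lambda>k. partial j (partial i (u k)) x) \<longlonglongrightarrow> vv i j x"
    if xS: "x \<in> S" for i j x
  proof -
    obtain e where "e > 0" "\<And>i. uniform_limit (ball x e) (\<lambda>k. partial i (u k)) (v i) sequentially"
      "\<And>i j. uniform_limit (ball x e) (\<lambda>k. partial j (partial i (u k))) (vv i j) sequentially"
      using unif[OF xS] by blast
    then show "(\<lambda>k. partial i (u k) x) \<longlonglongrightarrow> v i x" "(\<lambda>k. partial j (partial i (u k)) x) \<longlonglongrightarrow> vv i j x"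
      by (auto intro!: tendsto_uniform_limitI[where S = "ball x e"])
  qed
  have Dv: "(v i has_derivative (\<lambda>h. (\<chi> j. vv i j x) \<bullet> h)) (at x)" if xS: "x \<in> S" for x i
  proof -
    obtain e where e: "e > 0" "ball x e \<subseteq> S" "\<And>i j. uniform_limit (ball x e) (\<lambda>k. partial j (partial i (u k))) (vv i j) sequentially"
      using unif[OF xS] by blast
    show ?thesis
      by (rule C1_limit[OF \<open>open S\<close> _ _ e(3) e(2,1)])
         (use Ck_on_2D(2)[OF C2] limv in auto)
  qed
  have pv: "partial j (v i) x = vv i j x" if "x \<in> S" for i j x
    using partial_eqI[OF Dv[OF that]] by (simp add: inner_axis)
  have contvv: "continuous_on S (vv i j)" for i j
  proof (rule continuous_at_imp_continuous_on, rule ballI)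
    fix x assume "x \<in> S"
    then obtain e where e: "e > 0" "ball x e \<subseteq> S" "\<And>i j. uniform_limit (ball x e) (\<lambda>k. partial j (partial i (u k))) (vv i j) sequentially"
      using unif by blast
    have "continuous_on (ball x e) (partial j (partial i (u k)))" for k
      using Ck_on_2D(5)[OF C2] e(2) by (rule continuous_on_subset)
    then have "continuous_on (ball x e) (vv i j)"
      by (intro uniform_limit_theorem[OF _ e(3)] always_eventually) auto
    then show "isCont (vv i j) x"
      using e(1) by (simp add: continuous_on_eq_continuous_at)
  qed
  have C1v: "Ck_on 1 S (v i)" for i
  proof -
    have "Ck_on 0 S (partial j (v i))" for j
      using contvv[of i j] pv by (simp cong: continuous_on_cong)
    then show ?thesis using Dv by (auto simp: differentiable_def)
  qed
  have "Ck_on 1 S (partial i w)" for i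
    by (rule Ck_on_cong[OF \<open>open S\<close> _ C1v]) (simp add: pw)
  moreover have "\<forall>x\<in>S. w differentiable at x" using Dw unfolding differentiable_def by blast
  ultimately have "Ck_on (Suc 1) S w" by simp
  then show "Ck_on 2 S w" by (simp only: Suc_1)
  show "(\<lambda>k. partial i (u k) x) \<longlonglongrightarrow> partial i w x" if "x \<in> S" for x i
    using limv pw that by simp
  show "laplacian w x = 0" if "x \<in> S" for x
  proof -
    have "partial i (partial i w) x = vv i i x" for i
      using partial_cong[OF \<open>open S\<close> that, of "partial i w" "v i" i] pw pv that by simp
    then have "(\<lambda>k. laplacian (u k) x) \<longlonglongrightarrow> laplacian w x"
      unfolding laplacian_def using limvv that by (auto intro!: tendsto_sum)
    then show ?thesis by (simp add: harm[OF that] LIMSEQ_const_iff)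
  qed
qed

section \<open>Smooth bump functions\<close>

text \<open>The classical smooth function that vanishes on the negative half line, divided by a power of \<open>t\<close>.
  The powers make the family closed under differentiation up to linear combinations, so smoothness of
  all members follows by one induction; \<open>m\<close> controls how fast the function reaches 1.\<close>

definition flat :: "real \<Rightarrow> nat \<Rightarrow> real \<Rightarrow> real" where
  "flat m j t = (if t > 0 then exp (- 1 / (m * t)) / t ^ j else 0)"

text \<open>With \<open>x = 1 / (m t)\<close> this is the decay of \<open>x\<^sup>j / exp x\<close> at infinity.\<close>

lemma flat_tendsto_0:
  assumes "m > 0"
  shows "(flat m j \<longlongrightarrow> 0) (at 0)"
proof -
  have "((\<lambda>t. flat m j t) \<longlongrightarrow> 0) (at_right 0)"
  proof -
    have "filterlim (\<lambda>t. 1 / (m * t)) at_top (at_right 0)"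
      using assms by real_asymp
    from filterlim_compose[OF tendsto_power_div_exp_0 this, of j]
    have "((\<lambda>t. (1 / (m * t)) ^ j / exp (1 / (m * t))) \<longlongrightarrow> 0) (at_right 0)" .
    from tendsto_mult_right_zero[OF this, of "m ^ j"]
    have "((\<lambda>t. m ^ j * ((1 / (m * t)) ^ j / exp (1 / (m * t)))) \<longlongrightarrow> 0) (at_right 0)" .
    then show ?thesis
    proof (rule Lim_transform_eventually)
      show "\<forall>\<^sub>F t in at_right 0. m ^ j * ((1 / (m * t)) ^ j / exp (1 / (m * t))) = flat m j t"
        unfolding eventually_at_right_field
        by (rule exI[of _ 1]) (use assms in \<open>auto simp: flat_def power_divide power_mult_distrib exp_minus field_simps\<close>)
    qed
  qed
  moreover have "((\<lambda>t. flat m j t) \<longlongrightarrow> 0) (at_left 0)"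
    by (rule Lim_transform_eventually[OF tendsto_const])
       (auto simp: flat_def eventually_at_left_field intro!: exI[of _ "-1"])
  ultimately show ?thesis by (simp add: filterlim_split_at)
qed

lemma DERIV_flat:
  assumes "m > 0"
  shows "(flat m j has_real_derivative flat m (j + 2) t / m - real j * flat m (j + 1) t) (at t)"
proof -
  consider "t > 0" | "t < 0" | "t = 0" by linarith
  then show ?thesis
  proof cases
    case 1
    have "((\<lambda>t. exp (- 1 / (m * t)) / t ^ j) has_real_derivative
            exp (- 1 / (m * t)) * (1 / (m * t\<^sup>2)) / t ^ j - exp (- 1 / (m * t)) * real j / t ^ (j + 1)) (at t)"
    proof -
      have e: "((\<lambda>t. exp (- 1 / (m * t))) has_real_derivative exp (- 1 / (m * t)) * (1 / (m * t\<^sup>2))) (at t)"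
        using 1 assms by (auto intro!: derivative_eq_intros simp: power2_eq_square)
      have p: "((\<lambda>t. t ^ j) has_real_derivative real j * t ^ j / t) (at t)"
        using DERIV_pow[of j t] 1 by (cases j) auto
      have "t ^ j \<noteq> 0" using 1 by simp
      from DERIV_divide[OF e p this] show ?thesis
        by (rule DERIV_cong) (use 1 assms in \<open>simp add: field_simps\<close>)
    qed
    then have "((\<lambda>t. exp (- 1 / (m * t)) / t ^ j) has_real_derivative
            flat m (j + 2) t / m - real j * flat m (j + 1) t) (at t)"
      using 1 assms by (simp add: flat_def power2_eq_square power_add field_simps)
    then show ?thesis
      by (rule has_field_derivative_transform_within_open[of _ _ _ "{0<..}"]) (use 1 in \<open>auto simp: flat_def\<close>)
  next
    case 2
    have "((\<lambda>t. 0) has_real_derivative 0) (at t)" by simp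
    then have "(flat m j has_real_derivative 0) (at t)"
      by (rule has_field_derivative_transform_within_open[of _ _ _ "{..<0}"]) (use 2 in \<open>auto simp: flat_def\<close>)
    then show ?thesis using 2 by (simp add: flat_def)
  next
    case 3
    have "((\<lambda>h. (flat m j (0 + h) - flat m j 0) / h) \<longlongrightarrow> 0) (at 0)"
    proof (rule Lim_transform_eventually[OF flat_tendsto_0[OF assms, of "Suc j"]])
      show "\<forall>\<^sub>F h in at 0. flat m (Suc j) h = (flat m j (0 + h) - flat m j 0) / h"
        by (rule eventually_at_topological[THEN iffD2]) (auto simp: flat_def intro!: exI[of _ UNIV])
    qed
    then have "(flat m j has_real_derivative 0) (at 0)" by (simp add: DERIV_def)
    then show ?thesis using 3 by (simp add: flat_def)
  qed
qed

lemma Ck_on_flat_coordinate: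
  fixes i :: "'n::finite"
  assumes "m > 0"
  shows "Ck_on k (UNIV :: (real^'n) set) (\<lambda>x. flat m j (\<sigma> * x $ i + c))"
proof (induction k arbitrary: j)
  case 0
  have "continuous_on UNIV (flat m j)"
    by (intro continuous_at_imp_continuous_on ballI DERIV_isCont[OF DERIV_flat[OF assms]])
  then show ?case
    by (auto intro!: continuous_on_compose2[of UNIV "flat m j"] continuous_intros)
next
  case (Suc k)
  define g where "g x = flat m (j + 2) (\<sigma> * x $ i + c) / m - real j * flat m (j + 1) (\<sigma> * x $ i + c)" for x :: "real^'n"
  have D: "((\<lambda>x. flat m j (\<sigma> * x $ i + c)) has_derivative (\<lambda>h. (\<sigma> * h $ i) * g x)) (at x)" for x :: "real^'n"
  proof -
    have "((\<lambda>x. \<sigma> * x $ i + c) has_derivative (\<lambda>h. \<sigma> * h $ i)) (at x)"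
      by (auto intro!: derivative_eq_intros bounded_linear_imp_has_derivative bounded_linear_vec_nth)
    from has_derivative_compose[OF this DERIV_flat[OF assms, of j, unfolded has_field_derivative_def]]
    show ?thesis by (simp add: g_def mult.commute)
  qed
  have "partial i' (\<lambda>x. flat m j (\<sigma> * x $ i + c)) = (\<lambda>x. (\<sigma> * axis i' 1 $ i) * ((1/m) * flat m (j + 2) (\<sigma> * x $ i + c) + (- real j) * flat m (j + 1) (\<sigma> * x $ i + c)))" for i'
    by (rule ext) (simp add: partial_eqI[OF D] g_def)
  then have "Ck_on k UNIV (partial i' (\<lambda>x. flat m j (\<sigma> * x $ i + c)))" for i'
    by (simp only:) (intro Ck_on_mult Ck_on_add Ck_on_const open_UNIV Suc)
  moreover have "(\<lambda>x. flat m j (\<sigma> * x $ i + c)) differentiable at x" for x :: "real^'n"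
    using D by (auto simp: differentiable_def)
  ultimately show ?case by simp
qed

lemma Ck_on_prod:
  assumes "finite I" "open S" "\<And>i. i \<in> I \<Longrightarrow> Ck_on k S (f i)"
  shows "Ck_on k S (\<lambda>x. \<Prod>i\<in>I. f i x)"
  using assms by (induction I rule: finite_induct) (auto intro!: Ck_on_const Ck_on_mult)

text \<open>A product of one-dimensional profiles that is positive exactly on \<open>box a b\<close> and increases to its
  indicator function as \<open>m\<close> grows.\<close>

definition bump :: "real \<Rightarrow> real^'n \<Rightarrow> real^'n \<Rightarrow> real^'n \<Rightarrow> real" where
  "bump m a b x = (\<Prod>i\<in>UNIV. flat m 0 (x $ i - a $ i) * flat m 0 (b $ i - x $ i))"

lemma bump_eq_0: "x \<notin> box a b \<Longrightarrow> bump m a b x = 0"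
  by (force simp: bump_def mem_box_cart flat_def)

lemma bump_bounds:
  assumes "m > 0"
  shows "0 \<le> bump m a b x" "bump m a b x \<le> 1"
proof -
  have f: "0 \<le> flat m 0 t" "flat m 0 t \<le> 1" for t using assms by (auto simp: flat_def)
  show "0 \<le> bump m a b x" unfolding bump_def by (intro prod_nonneg ballI mult_nonneg_nonneg f)
  show "bump m a b x \<le> 1" unfolding bump_def by (intro prod_le_1) (simp add: f mult_le_one)
qed

lemma Ck_on_bump: 
  assumes "m > 0"
  shows "Ck_on k UNIV (bump m a b)"
proof -
  have "Ck_on k UNIV (\<lambda>x. flat m 0 (x $ i - a $ i) * flat m 0 (b $ i - x $ i))" for i
    using Ck_on_mult[OF open_UNIV Ck_on_flat_coordinate[OF assms, of k 0 1 i "- (a $ i)"]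
        Ck_on_flat_coordinate[OF assms, of k 0 "-1" i "b $ i"]] by simp
  then show ?thesis unfolding bump_def[abs_def] by (intro Ck_on_prod) auto
qed

lemma test_function_bump:
  assumes "m > 0" "cbox a b \<subseteq> \<Omega>"
  shows "test_function \<Omega> (bump m a b)"
proof -
  have "{x. bump m a b x \<noteq> 0} \<subseteq> box a b" using bump_eq_0 by blast
  then have *: "{x. bump m a b x \<noteq> 0} \<subseteq> cbox a b" using box_subset_cbox[of a b] by simp
  then have "closure {x. bump m a b x \<noteq> 0} \<subseteq> cbox a b" by (intro closure_minimal) auto
  moreover have "compact (closure {x. bump m a b x \<noteq> 0})"
    using bounded_subset[OF bounded_cbox *] by simp
  ultimately show ?thesis unfolding test_function_def using Ck_on_bump[OF assms(1)] assms(2) by blast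
qed

lemma bump_tendsto_indicator:
  fixes a b x :: "real^'n"
  shows "(\<lambda>k. bump (real (Suc k)) a b x) \<longlonglongrightarrow> indicator (box a b) x"
proof (cases "x \<in> box a b")
  case True
  have 1: "(\<lambda>k. flat (real (Suc k)) 0 t) \<longlonglongrightarrow> 1" if "t > 0" for t
  proof -
    have "(\<lambda>k. exp (- 1 / (real (Suc k) * t))) \<longlonglongrightarrow> 1" using that by real_asymp
    then show ?thesis using that by (simp add: flat_def)
  qed
  have "(\<lambda>k. bump (real (Suc k)) a b x) \<longlonglongrightarrow> (\<Prod>i\<in>(UNIV::'n set). 1 * 1)"
    unfolding bump_def using True by (intro tendsto_prod tendsto_mult 1) (auto simp: mem_box_cart)
  then show ?thesis using True by simp
qed (simp add: bump_eq_0)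


section \<open>Classical gradients are weak gradients\<close>

lemma integrable_compact_support:
  fixes f :: "'a::euclidean_space \<Rightarrow> 'b::{banach, second_countable_topology}"
  assumes "compact K" "continuous_on K f" "\<And>x. x \<notin> K \<Longrightarrow> f x = 0"
  shows "integrable lborel f"
proof -
  have "(\<lambda>x. indicator K x *\<^sub>R f x) = f" using assms(3) by (auto simp: indicator_def)
  then show ?thesis using borel_integrable_compact[OF assms(1,2)] by simp
qed

lemma integral_lborel_translate:
  fixes f :: "'a::euclidean_space \<Rightarrow> real"
  assumes "f \<in> borel_measurable borel"
  shows "integral\<^sup>L lborel (\<lambda>x. f (c + x)) = integral\<^sup>L lborel f"
proof -
  have "integral\<^sup>L lborel f = integral\<^sup>L (distr lborel borel ((+) c)) f"
    by (simp add: lborel_distr_plus)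
  also have "\<dots> = integral\<^sup>L lborel (\<lambda>x. f (c + x))"
    by (rule integral_distr) (use assms in auto)
  finally show ?thesis by simp
qed

text \<open>By translation invariance each difference quotient of \<open>w\<close> in direction \<open>i\<close> has integral zero. The
  quotients are bounded by the supremum of the partial derivative and supported in a common ball, so
  dominated convergence applies.\<close>

lemma integral_partial_eq_0:
  fixes w :: "real^'n \<Rightarrow> real"
  assumes dif: "\<And>x. w differentiable at x" and cont: "continuous_on UNIV (partial i w)"
    and "compact K" and supp: "\<And>x. x \<notin> K \<Longrightarrow> w x = 0"
  shows "integral\<^sup>L lborel (partial i w) = 0"
proof -
  have contw: "continuous_on UNIV w"
    by (intro continuous_at_imp_continuous_on ballI differentiable_imp_continuous_within dif)
  have p0: "partial i w x = 0" if "x \<notin> K" for x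
  proof -
    have "partial i w x = partial i (\<lambda>_. 0) x"
      by (rule partial_cong[of "- K"]) (use that supp \<open>compact K\<close> in \<open>auto simp: compact_imp_closed open_Compl\<close>)
    then show ?thesis by (simp add: partial_const)
  qed
  obtain B where B: "\<And>x. \<bar>partial i w x\<bar> \<le> B"
  proof -
    have "compact (partial i w ` K)"
      using cont \<open>compact K\<close> by (meson compact_continuous_image continuous_on_subset subset_UNIV)
    then obtain b where b: "b > 0" "\<And>x. x \<in> K \<Longrightarrow> \<bar>partial i w x\<bar> \<le> b"
      using compact_imp_bounded bounded_pos by (metis image_eqI real_norm_def)
    have "\<bar>partial i w x\<bar> \<le> b" for x using b p0[of x] by (cases "x \<in> K") auto
    then show ?thesis using that by blast
  qed
  obtain R where R: "\<And>x. x \<in> K \<Longrightarrow> norm x \<le> R"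
    using compact_imp_bounded[OF \<open>compact K\<close>] unfolding bounded_iff by blast
  define e :: "real^'n" where "e = axis i 1"
  \<comment> \<open>Step sizes at most 1, so that all quotients are supported in the ball of radius \<open>R + 1\<close>.\<close>
  define h where "h k = inverse (real (Suc k))" for k
  have h: "0 < h k" "h k \<le> 1" for k by (auto simp: h_def inverse_le_1_iff)
  have h0: "h \<longlonglongrightarrow> 0" unfolding h_def[abs_def] by (rule LIMSEQ_inverse_real_of_nat)
  define q where "q k x = (w (h k *\<^sub>R e + x) - w x) / h k" for k x
  have intw: "integrable lborel w"
    by (rule integrable_compact_support[OF \<open>compact K\<close> continuous_on_subset[OF contw subset_UNIV] supp])
  have wm: "w \<in> borel_measurable borel" using contw by (rule borel_measurable_continuous_onI)
  have "integral\<^sup>L lborel (q k) = 0" for k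
  proof -
    have "integrable lborel (\<lambda>x. w (h k *\<^sub>R e + x))"
    proof (rule integrable_compact_support)
      show "compact ((\<lambda>x. x - h k *\<^sub>R e) ` K)"
        by (intro compact_continuous_image \<open>compact K\<close> continuous_intros)
      show "continuous_on ((\<lambda>x. x - h k *\<^sub>R e) ` K) (\<lambda>x. w (h k *\<^sub>R e + x))"
        by (rule continuous_on_compose2[OF contw]) (auto intro!: continuous_intros)
      show "w (h k *\<^sub>R e + x) = 0" if "x \<notin> (\<lambda>x. x - h k *\<^sub>R e) ` K" for x
      proof (rule supp)
        show "h k *\<^sub>R e + x \<notin> K"
        proof
          assume "h k *\<^sub>R e + x \<in> K"
          then have "(h k *\<^sub>R e + x) - h k *\<^sub>R e \<in> (\<lambda>x. x - h k *\<^sub>R e) ` K" by (rule imageI)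
          then show False using that by simp
        qed
      qed
    qed
    then show ?thesis
      using intw integral_lborel_translate[OF wm, of "h k *\<^sub>R e"] by (simp add: q_def[abs_def])
  qed
  moreover have "(\<lambda>k. integral\<^sup>L lborel (q k)) \<longlonglongrightarrow> integral\<^sup>L lborel (partial i w)"
  proof (rule integral_dominated_convergence[where w = "\<lambda>x. indicator (cball 0 (R + 1)) x *\<^sub>R B"])
    show "integrable lborel (\<lambda>x. indicator (cball 0 (R + 1)) x *\<^sub>R B)"
      by (intro borel_integrable_compact) auto
    show "partial i w \<in> borel_measurable lborel" using borel_measurable_continuous_onI[OF cont] by simp
    have "continuous_on UNIV (q k)" for k
      unfolding q_def using h[of k] by (intro continuous_intros continuous_on_compose2[OF contw]) auto
    then show "q k \<in> borel_measurable lborel" for k using borel_measurable_continuous_onI by auto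
    have "(\<lambda>k. q k x) \<longlonglongrightarrow> partial i w x" for x
    proof -
      have "((\<lambda>s. w (x + s *\<^sub>R e)) has_real_derivative partial i w x) (at 0)"
        using DERIV_along_axis[of w x 0 i] dif by (simp add: e_def)
      then have "((\<lambda>s. (w (x + s *\<^sub>R e) - w x) / s) \<longlongrightarrow> partial i w x) (at 0)"
        by (simp add: DERIV_def)
      moreover have "filterlim h (at 0) sequentially"
        using h0 h by (auto simp: filterlim_at less_imp_neq[symmetric] intro!: always_eventually)
      ultimately show ?thesis unfolding q_def using filterlim_compose by (force simp: add.commute)
    qed
    then show "AE x in lborel. (\<lambda>k. q k x) \<longlonglongrightarrow> partial i w x" by simp
    have "norm (q k x) \<le> indicator (cball 0 (R + 1)) x *\<^sub>R B" for k x
    proof -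
      have "\<exists>z>0. z < h k \<and> w (x + h k *\<^sub>R e) - w (x + 0 *\<^sub>R e) = (h k - 0) * partial i w (x + z *\<^sub>R e)"
        unfolding e_def by (rule MVT2[OF h(1)]) (auto intro!: DERIV_along_axis dif)
      then obtain z where z: "0 < z" "z < h k" "w (x + h k *\<^sub>R e) - w x = h k * partial i w (x + z *\<^sub>R e)" by auto
      then have q: "q k x = partial i w (x + z *\<^sub>R e)" using h[of k] by (simp add: q_def add.commute)
      show ?thesis
      proof (cases "x \<in> cball 0 (R + 1)")
        case True then show ?thesis using B q by simp
      next
        case False
        have "x + z *\<^sub>R e \<notin> K"
        proof
          assume "x + z *\<^sub>R e \<in> K"
          then have "norm (x + z *\<^sub>R e) \<le> R" by (rule R)
          moreover have "norm x \<le> norm (x + z *\<^sub>R e) + norm (z *\<^sub>R e)"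
            by (metis add_diff_cancel_right' norm_triangle_ineq4)
          moreover have "norm (z *\<^sub>R e) \<le> 1" using z h[of k] by (simp add: e_def)
          ultimately show False using False by simp
        qed
        then show ?thesis using q p0 False by simp
      qed
    qed
    then show "AE x in lborel. norm (q k x) \<le> indicator (cball 0 (R + 1)) x *\<^sub>R B" for k by simp
  qed
  ultimately show ?thesis by (simp add: LIMSEQ_const_iff)
qed

lemma continuous_imp_locally_integrable_on:
  assumes "continuous_on \<Omega> u"
  shows "locally_integrable_on \<Omega> u"
  unfolding locally_integrable_on_def
proof (intro allI impI)
  fix K assume K: "compact K \<and> K \<subseteq> \<Omega>"
  then have i: "integrable lborel (\<lambda>x. indicator K x *\<^sub>R u x)"
    by (intro borel_integrable_compact continuous_on_subset[OF assms]) auto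
  have "integrable lebesgue (\<lambda>x. indicator K x *\<^sub>R u x)"
    using integrable_completion[OF borel_measurable_integrable[OF i]] i by simp
  moreover have "K \<in> sets lebesgue" using K by (auto intro: lmeasurable_compact fmeasurableD)
  ultimately show "integrable (lebesgue_on K) u" by (simp add: integrable_restrict_space)
qed

lemma integral_lebesgue_on_compact_support:
  fixes f :: "real^'n \<Rightarrow> real"
  assumes "K \<subseteq> \<Omega>" "open \<Omega>" "integrable lborel f" "\<And>x. x \<notin> K \<Longrightarrow> f x = 0"
  shows "integral\<^sup>L (lebesgue_on \<Omega>) f = integral\<^sup>L lborel f"
proof -
  have "(\<lambda>x. indicator \<Omega> x *\<^sub>R f x) = f" by (rule ext) (use assms in \<open>auto simp: indicator_def\<close>)
  moreover have "\<Omega> \<in> sets lebesgue" using assms(2) by (simp add: borel_open)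
  ultimately show ?thesis
    using integral_completion[OF borel_measurable_integrable[OF assms(3)]] by (simp add: integral_restrict_space)
qed

text \<open>For a test function \<open>\<phi>\<close> the product \<open>u \<phi>\<close>, being zero off the support of \<open>\<phi>\<close>, is differentiable
  on the whole space, so its partial derivatives have integral zero.\<close>

lemma is_weak_gradient_gradient:
  fixes u :: "real^'n \<Rightarrow> real"
  assumes "open \<Omega>" "Ck_on 2 \<Omega> u"
  shows "is_weak_gradient \<Omega> u (gradient u)"
  unfolding is_weak_gradient_def
proof (intro conjI allI impI)
  show "locally_integrable_on \<Omega> u"
    by (rule continuous_imp_locally_integrable_on[OF Ck_on_2D(3)[OF assms(2)]])
  show "locally_integrable_on \<Omega> (gradient u)"
    by (rule continuous_imp_locally_integrable_on[OF continuous_on_gradient[OF assms(2)]])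
  fix \<phi> i assume "test_function \<Omega> \<phi>"
  define K where "K = closure {x. \<phi> x \<noteq> 0}"
  have K: "compact K" "K \<subseteq> \<Omega>" and \<phi>2: "Ck_on 2 UNIV \<phi>"
    using \<open>test_function \<Omega> \<phi>\<close> by (simp_all only: test_function_def K_def)
  have \<phi>0: "\<phi> x = 0" if "x \<notin> K" for x
    using that closure_subset[of "{x. \<phi> x \<noteq> 0}"] unfolding K_def[symmetric] by auto
  have open_K: "open (- K)" using K(1) by (simp add: compact_imp_closed open_Compl)
  have \<phi>p: "partial i \<phi> x = 0" if "x \<notin> K" for x
    using partial_cong[OF open_K, of x \<phi> "\<lambda>_. 0" i] that \<phi>0 by (simp add: partial_const)
  define w where "w x = u x * \<phi> x" for x
  have w0: "w x = 0" if "x \<notin> K" for x using \<phi>0[OF that] by (simp add: w_def)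
  have w_diff: "w differentiable at x" for x
  proof (cases "x \<in> K")
    case True
    then show ?thesis unfolding w_def[abs_def]
      using Ck_on_2D(1)[OF assms(2)] Ck_on_2D(1)[OF \<phi>2] K by (intro differentiable_mult) auto
  next
    case False
    have "((\<lambda>_. 0) has_derivative (\<lambda>_. 0)) (at x)" by simp
    then have "(w has_derivative (\<lambda>_. 0)) (at x)"
      by (rule has_derivative_transform_within_open[OF _ open_K]) (use False w0 in auto)
    then show ?thesis by (auto simp: differentiable_def)
  qed
  have pw: "partial i w x = u x * partial i \<phi> x + partial i u x * \<phi> x" for x
  proof (cases "x \<in> K")
    case True
    then show ?thesis unfolding w_def[abs_def]
      using Ck_on_2D(1)[OF assms(2)] Ck_on_2D(1)[OF \<phi>2] K by (intro partial_mult) auto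
  next
    case False
    then show ?thesis
      using partial_cong[OF open_K, of x w "\<lambda>_. 0" i] w0 \<phi>0 \<phi>p by (simp add: partial_const)
  qed
  have cu: "continuous_on \<Omega> u" "continuous_on \<Omega> (partial i u)" using Ck_on_2D[OF assms(2)] by auto
  have c\<phi>: "continuous_on \<Omega> \<phi>" "continuous_on \<Omega> (partial i \<phi>)"
    using Ck_on_2D[OF \<phi>2] continuous_on_subset[OF _ subset_UNIV] by blast+
  have cont1: "continuous_on \<Omega> (\<lambda>x. u x * partial i \<phi> x)" and cont2: "continuous_on \<Omega> (\<lambda>x. partial i u x * \<phi> x)"
    by (intro continuous_intros cu c\<phi>)+
  have int1: "integrable lborel (\<lambda>x. u x * partial i \<phi> x)"
    by (rule integrable_compact_support[OF K(1) continuous_on_subset[OF cont1 K(2)]]) (simp add: \<phi>p)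
  have int2: "integrable lborel (\<lambda>x. partial i u x * \<phi> x)"
    by (rule integrable_compact_support[OF K(1) continuous_on_subset[OF cont2 K(2)]]) (simp add: \<phi>0)
  have "continuous_on UNIV (partial i w)"
  proof -
    have "continuous_on \<Omega> (partial i w)"
      unfolding pw[abs_def] by (intro continuous_on_add cont1 cont2)
    moreover have "continuous_on (- K) (partial i w)"
      by (rule continuous_on_eq[of _ "\<lambda>_. 0"]) (auto simp: pw \<phi>0 \<phi>p)
    moreover have "\<Omega> \<union> - K = UNIV" using K(2) by blast
    ultimately show ?thesis using continuous_on_open_Un[OF assms(1) open_K] by metis
  qed
  then have "integral\<^sup>L lborel (partial i w) = 0"
    by (rule integral_partial_eq_0[OF w_diff _ K(1) w0])
  then have "integral\<^sup>L lborel (\<lambda>x. u x * partial i \<phi> x) + integral\<^sup>L lborel (\<lambda>x. partial i u x * \<phi> x) = 0"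
    using int1 int2 by (simp add: pw[abs_def])
  moreover have "integral\<^sup>L (lebesgue_on \<Omega>) (\<lambda>x. u x * partial i \<phi> x) = integral\<^sup>L lborel (\<lambda>x. u x * partial i \<phi> x)"
    by (rule integral_lebesgue_on_compact_support[OF K(2) assms(1) int1]) (simp add: \<phi>p)
  moreover have "integral\<^sup>L (lebesgue_on \<Omega>) (\<lambda>x. partial i u x * \<phi> x) = integral\<^sup>L lborel (\<lambda>x. partial i u x * \<phi> x)"
    by (rule integral_lebesgue_on_compact_support[OF K(2) assms(1) int2]) (simp add: \<phi>0)
  ultimately show "integral\<^sup>L (lebesgue_on \<Omega>) (\<lambda>x. u x * partial i \<phi> x)
      = - integral\<^sup>L (lebesgue_on \<Omega>) (\<lambda>x. gradient u x $ i * \<phi> x)"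
    by (simp add: gradient_def)
qed

section \<open>Uniqueness of weak gradients\<close>

text \<open>The sets over which \<open>f\<close> has integral zero are closed under complements and countable disjoint
  unions. As they include the boxes, which generate the Borel sets and are stable under intersection,
  they include all Borel sets.\<close>

lemma AE_zero_if_box_integrals_zero:
  fixes f :: "real^'n \<Rightarrow> real"
  assumes f: "integrable lborel f" and "integral\<^sup>L lborel f = 0"
    and box0: "\<And>a b. integral\<^sup>L lborel (\<lambda>x. indicator (box a b) x * f x) = 0"
  shows "AE x in lborel. f x = 0"
proof (rule sigma_finite_measure.density_zero[OF sigma_finite_lborel f])
  fix A :: "(real^'n) set" assume "A \<in> sets lborel"
  then have A: "A \<in> sigma_sets UNIV (range (\<lambda>(a, b). box a b))"
    by (simp add: borel_eq_box)
  have "Int_stable (range (\<lambda>(a, b). box a b :: (real^'n) set))"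
    by (auto simp: Int_stable_def box_Int_box)
  moreover have "range (\<lambda>(a, b). box a b :: (real^'n) set) \<subseteq> Pow UNIV" by simp
  ultimately show "set_lebesgue_integral lborel A f = 0" using A
  proof (induction rule: sigma_sets_induct_disjoint)
    case (compl A)
    then have A: "A \<in> sets lborel" by (simp add: borel_eq_box)
    have "(LINT x:UNIV - A|lborel. f x) = (LINT x|lborel. f x - indicator A x *\<^sub>R f x)"
      unfolding set_lebesgue_integral_def by (rule Bochner_Integration.integral_cong) (auto simp: indicator_def)
    also have "\<dots> = (LINT x|lborel. f x) - (LINT x:A|lborel. f x)"
      unfolding set_lebesgue_integral_def
      by (rule Bochner_Integration.integral_diff[OF f integrable_mult_indicator[OF A f]])
    finally show ?case using compl assms(2) by simp
  next
    case (union A)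
    then have A: "A i \<in> sets lborel" for i by (auto simp: borel_eq_box)
    have "set_integrable lborel (\<Union>i. A i) f"
      unfolding set_integrable_def using A f by (intro integrable_mult_indicator) auto
    then have "(LINT x:(\<Union>i. A i)|lborel. f x) = (\<Sum>i. (LINT x:A i|lborel. f x))"
      using A union(1) by (intro lebesgue_integral_countable_add) (auto simp: disjoint_family_on_def)
    then show ?case using union by simp
  qed (auto simp: set_lebesgue_integral_def box0)
qed

lemma locally_integrable_on_indicator:
  assumes "locally_integrable_on \<Omega> f" "compact K" "K \<subseteq> \<Omega>"
  shows "integrable lebesgue (\<lambda>x. indicator K x *\<^sub>R f x)"
proof -
  have "integrable (lebesgue_on K) f" using assms unfolding locally_integrable_on_def by blast
  moreover have "K \<in> sets lebesgue" using assms(2) by (auto intro: lmeasurable_compact fmeasurableD)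
  ultimately show ?thesis by (simp add: integrable_restrict_space)
qed

text \<open>The fundamental lemma of the calculus of variations. Bump functions approximate the indicator
  functions of boxes, so the integrals of \<open>f\<close> over boxes inside \<open>\<Omega>\<close> vanish; finally \<open>\<Omega>\<close> is a
  countable union of boxes.\<close>

lemma AE_zero_if_bump_integrals_zero:
  fixes f :: "real^'n \<Rightarrow> real"
  assumes "open \<Omega>" and loc: "locally_integrable_on \<Omega> f"
    and test: "\<And>\<phi>. test_function \<Omega> \<phi> \<Longrightarrow> integral\<^sup>L (lebesgue_on \<Omega>) (\<lambda>x. f x * \<phi> x) = 0"
  shows "AE x in lebesgue_on \<Omega>. f x = 0"
proof -
  have box_null: "AE x in lebesgue. x \<in> cbox c d \<longrightarrow> f x = 0" if sub: "cbox c d \<subseteq> \<Omega>" for c d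
  proof -
    \<comment> \<open>Local integrability only controls \<open>f\<close> on compact subsets, so it is cut off to the box.\<close>
    define G where "G x = indicator (cbox c d) x * f x" for x
    have G: "integrable lebesgue G"
      using locally_integrable_on_indicator[OF loc compact_cbox sub] by (simp add: G_def[abs_def])
    have boxpq: "integral\<^sup>L lebesgue (\<lambda>x. indicator (box p q) x * G x) = 0" if pq: "box p q \<subseteq> box c d" for p q
    proof (cases "box p q = {}")
      case False
      have "closure (box p q) \<subseteq> closure (box c d)" using pq by (rule closure_mono)
      also have "closure (box c d) \<subseteq> cbox c d" by (intro closure_minimal box_subset_cbox closed_cbox)
      finally have cpq: "cbox p q \<subseteq> cbox c d" using False by simp
      have "integral\<^sup>L lebesgue (\<lambda>x. bump (real (Suc k)) p q x * G x) = 0" for k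
      proof -
        have "test_function \<Omega> (bump (real (Suc k)) p q)"
          by (rule test_function_bump) (use cpq sub in auto)
        from test[OF this] have "integral\<^sup>L lebesgue (\<lambda>x. indicator \<Omega> x *\<^sub>R (f x * bump (real (Suc k)) p q x)) = 0"
          using \<open>open \<Omega>\<close> by (simp add: integral_restrict_space borel_open)
        moreover have "indicator \<Omega> x *\<^sub>R (f x * bump (real (Suc k)) p q x) = bump (real (Suc k)) p q x * G x" for x
          using bump_eq_0[of x p q "real (Suc k)"] box_subset_cbox[of p q] cpq sub
          by (cases "x \<in> box p q") (auto simp: G_def indicator_def)
        ultimately show ?thesis by (simp only:)
      qed
      moreover have "(\<lambda>k. integral\<^sup>L lebesgue (\<lambda>x. bump (real (Suc k)) p q x * G x)) \<longlonglongrightarrow>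
          integral\<^sup>L lebesgue (\<lambda>x. indicator (box p q) x * G x)"
      proof (rule integral_dominated_convergence[where w = "\<lambda>x. norm (G x)"])
        have Gm: "G \<in> borel_measurable lebesgue" using G by (rule borel_measurable_integrable)
        show "(\<lambda>x. indicator (box p q) x * G x) \<in> borel_measurable lebesgue"
          by (intro borel_measurable_times Gm borel_measurable_indicator) simp
        have "bump (real (Suc k)) p q \<in> borel_measurable lebesgue" for k
          using borel_measurable_continuous_onI[of "bump (real (Suc k)) p q"] Ck_on_bump[of "real (Suc k)" 0 p q]
          by (simp add: measurable_completion)
        then show "(\<lambda>x. bump (real (Suc k)) p q x * G x) \<in> borel_measurable lebesgue" for k
          by (intro borel_measurable_times Gm)
        show "integrable lebesgue (\<lambda>x. norm (G x))" using G by simp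
        show "AE x in lebesgue. (\<lambda>k. bump (real (Suc k)) p q x * G x) \<longlonglongrightarrow> indicator (box p q) x * G x"
          by (intro always_eventually allI tendsto_mult bump_tendsto_indicator tendsto_const)
        show "AE x in lebesgue. norm (bump (real (Suc k)) p q x * G x) \<le> norm (G x)" for k
          using bump_bounds[of "real (Suc k)" p q] by (auto simp: abs_mult intro!: mult_left_le_one_le)
      qed
      ultimately show ?thesis by (simp add: LIMSEQ_const_iff)
    qed simp
    define F where "F x = indicator (box c d) x * G x" for x
    have F: "integrable lebesgue F"
      unfolding F_def[abs_def] using integrable_mult_indicator[OF _ G, of "box c d"] by simp
    have boxF: "integral\<^sup>L lebesgue (\<lambda>x. indicator (box a b) x * F x) = 0" for a b
    proof -
      have "indicator (box a b) x * F x = indicator (box a b \<inter> box c d) x * G x" for x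
        by (simp add: F_def indicator_inter_arith)
      moreover obtain p q where "box a b \<inter> box c d = box p q" using box_Int_box by blast
      ultimately show ?thesis using boxpq[of p q] by auto
    qed
    \<comment> \<open>The \<open>\<pi>\<close>-system argument runs over Borel sets, so \<open>F\<close> is replaced by a Borel function.\<close>
    obtain F' where F': "F' \<in> borel_measurable lborel" "AE x in lborel. F x = F' x"
      using completion_ex_borel_measurable_real[OF borel_measurable_integrable[OF F]] by blast
    have eq: "AE x in lebesgue. F x = F' x" using F'(2) by (rule AE_completion)
    have F'm: "F' \<in> borel_measurable lebesgue" using F'(1) by (rule measurable_completion)
    have "integrable lebesgue F'"
      using integrable_cong_AE_imp[OF F F'm] eq by (auto simp: eq_commute)
    then have intF': "integrable lborel F'" using integrable_completion[OF F'(1)] by simp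
    have "AE x in lborel. F' x = 0"
    proof (rule AE_zero_if_box_integrals_zero[OF intF'])
      have "integral\<^sup>L lborel F' = integral\<^sup>L lebesgue F'" using integral_completion[OF F'(1)] by simp
      also have "\<dots> = integral\<^sup>L lebesgue F"
        by (rule integral_cong_AE[OF F'm borel_measurable_integrable[OF F]]) (use eq in \<open>auto simp: eq_commute\<close>)
      also have "\<dots> = 0" using boxpq[of c d] by (simp add: F_def[abs_def])
      finally show "integral\<^sup>L lborel F' = 0" .
      fix a b
      have m: "(\<lambda>x. indicator (box a b) x * F' x) \<in> borel_measurable lborel"
        using F'(1) by (intro borel_measurable_times borel_measurable_indicator) auto
      have "integral\<^sup>L lborel (\<lambda>x. indicator (box a b) x * F' x) = integral\<^sup>L lebesgue (\<lambda>x. indicator (box a b) x * F' x)"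
        using integral_completion[OF m] by simp
      also have "\<dots> = integral\<^sup>L lebesgue (\<lambda>x. indicator (box a b) x * F x)"
      proof (rule integral_cong_AE)
        show "(\<lambda>x. indicator (box a b) x * F' x) \<in> borel_measurable lebesgue"
          using m by (rule measurable_completion)
        show "(\<lambda>x. indicator (box a b) x * F x) \<in> borel_measurable lebesgue"
          by (intro borel_measurable_times borel_measurable_indicator borel_measurable_integrable[OF F]) simp
        show "AE x in lebesgue. indicator (box a b) x * F' x = indicator (box a b) x * F x"
          using eq by eventually_elim simp
      qed
      finally show "integral\<^sup>L lborel (\<lambda>x. indicator (box a b) x * F' x) = 0" using boxF by simp
    qed
    then have "AE x in lebesgue. F' x = 0" by (rule AE_completion)
    moreover have "AE x in lebesgue. x \<notin> cbox c d - box c d"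
      using negligible_frontier_interval[of c d] unfolding negligible_iff_null_sets by (rule AE_not_in)
    ultimately show ?thesis using eq
    proof eventually_elim
      case (elim x)
      then show ?case by (auto simp: F_def G_def indicator_def split: if_splits)
    qed
  qed
  obtain \<D> where \<D>: "countable \<D>" "\<D> \<subseteq> Pow \<Omega>" "\<And>X. X \<in> \<D> \<Longrightarrow> \<exists>a b. X = cbox a b" "\<Union>\<D> = \<Omega>"
    using open_countable_Union_open_cbox[OF \<open>open \<Omega>\<close>] by metis
  have "AE x in lebesgue. \<forall>X\<in>\<D>. x \<in> X \<longrightarrow> f x = 0"
    unfolding AE_ball_countable[OF \<D>(1)]
  proof
    fix X assume "X \<in> \<D>"
    then obtain a b where "X = cbox a b" using \<D>(3) by blast
    then show "AE x in lebesgue. x \<in> X \<longrightarrow> f x = 0" using box_null[of a b] \<D>(2) \<open>X \<in> \<D>\<close> by blast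
  qed
  then have "AE x in lebesgue. x \<in> \<Omega> \<longrightarrow> f x = 0"
    by eventually_elim (use \<D>(4) in blast)
  then show ?thesis using \<open>open \<Omega>\<close> by (simp add: AE_restrict_space_iff borel_open)
qed

lemma integrable_mult_test_function:
  fixes f :: "real^'n \<Rightarrow> real"
  assumes "open \<Omega>" "locally_integrable_on \<Omega> f" "test_function \<Omega> \<phi>"
  shows "integrable (lebesgue_on \<Omega>) (\<lambda>x. f x * \<phi> x)"
proof -
  define K where "K = closure {x. \<phi> x \<noteq> 0}"
  have K: "compact K" "K \<subseteq> \<Omega>" and \<phi>: "Ck_on 0 UNIV \<phi>"
    using assms(3) by (simp_all only: test_function_def K_def)
  have \<phi>0: "\<phi> x = 0" if "x \<notin> K" for x
    using that closure_subset[of "{x. \<phi> x \<noteq> 0}"] unfolding K_def[symmetric] by auto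
  have "compact (\<phi> ` K)"
    using \<phi> K by (auto intro!: compact_continuous_image intro: continuous_on_subset)
  then obtain B where "\<forall>y\<in>\<phi> ` K. norm y \<le> B"
    using compact_imp_bounded bounded_iff by blast
  then have B: "\<bar>\<phi> x\<bar> \<le> B" if "x \<in> K" for x using that by simp
  define G where "G x = indicator K x * f x" for x
  have G: "integrable lebesgue G"
    using locally_integrable_on_indicator[OF assms(2) K] by (simp add: G_def[abs_def])
  have "\<phi> \<in> borel_measurable lebesgue"
    using \<phi> borel_measurable_continuous_onI[of \<phi>] by (simp add: measurable_completion)
  then have m: "(\<lambda>x. G x * \<phi> x) \<in> borel_measurable lebesgue"
    by (rule borel_measurable_times[OF borel_measurable_integrable[OF G]])
  have "integrable lebesgue (\<lambda>x. G x * \<phi> x)"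
  proof (rule Bochner_Integration.integrable_bound[OF _ m])
    show "integrable lebesgue (\<lambda>x. B * G x)" using G by simp
    have "norm (G x * \<phi> x) \<le> norm (B * G x)" for x
    proof (cases "x \<in> K")
      case True
      have "\<bar>\<phi> x\<bar> \<le> \<bar>B\<bar>" using B[OF True] by linarith
      then show ?thesis
        using mult_right_mono[of "\<bar>\<phi> x\<bar>" "\<bar>B\<bar>" "\<bar>G x\<bar>"] by (simp add: abs_mult mult.commute)
    qed (simp add: \<phi>0)
    then show "AE x in lebesgue. norm (G x * \<phi> x) \<le> norm (B * G x)" by simp
  qed
  moreover have "G x * \<phi> x = indicator \<Omega> x *\<^sub>R (f x * \<phi> x)" for x
    using K \<phi>0[of x] by (cases "x \<in> K") (auto simp: G_def indicator_def)
  ultimately show ?thesis using assms(1) by (simp add: integrable_restrict_space borel_open)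
qed

lemma is_weak_gradient_unique:
  assumes "open \<Omega>" "is_weak_gradient \<Omega> u v" "is_weak_gradient \<Omega> u v'"
  shows "AE x in lebesgue_on \<Omega>. v x = v' x"
proof -
  have comp: "locally_integrable_on \<Omega> (\<lambda>x. v x $ i)" if "is_weak_gradient \<Omega> u v" for v i
  proof -
    have "locally_integrable_on \<Omega> v" using that unfolding is_weak_gradient_def by simp
    then show ?thesis unfolding locally_integrable_on_def
      using integrable_bounded_linear[OF bounded_linear_vec_nth] by blast
  qed
  have "AE x in lebesgue_on \<Omega>. v x $ i - v' x $ i = 0" for i
  proof (rule AE_zero_if_bump_integrals_zero[OF assms(1)])
    show "locally_integrable_on \<Omega> (\<lambda>x. v x $ i - v' x $ i)"
      using comp[OF assms(2), of i] comp[OF assms(3), of i] unfolding locally_integrable_on_def by auto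
    fix \<phi> assume \<phi>: "test_function \<Omega> \<phi>"
    have p: "integral\<^sup>L (lebesgue_on \<Omega>) (\<lambda>x. u x * partial i \<phi> x) = - integral\<^sup>L (lebesgue_on \<Omega>) (\<lambda>x. w x $ i * \<phi> x)"
      if "is_weak_gradient \<Omega> u w" for w
      using that \<phi> unfolding is_weak_gradient_def by simp
    have "integral\<^sup>L (lebesgue_on \<Omega>) (\<lambda>x. v x $ i * \<phi> x) = integral\<^sup>L (lebesgue_on \<Omega>) (\<lambda>x. v' x $ i * \<phi> x)"
      using p[OF assms(2)] p[OF assms(3)] by linarith
    then show "integral\<^sup>L (lebesgue_on \<Omega>) (\<lambda>x. (v x $ i - v' x $ i) * \<phi> x) = 0"
      using integrable_mult_test_function[OF assms(1) comp[OF assms(2)] \<phi>]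
        integrable_mult_test_function[OF assms(1) comp[OF assms(3)] \<phi>]
      by (simp add: left_diff_distrib)
  qed
  then have "AE x in lebesgue_on \<Omega>. \<forall>i. v x $ i - v' x $ i = 0"
    by (intro eventually_all_finite)
  then show ?thesis by eventually_elim (simp add: vec_eq_iff)
qed

lemma weak_gradient_eq_gradient:
  assumes "open \<Omega>" "Ck_on 2 \<Omega> u"
  shows "AE x in lebesgue_on \<Omega>. weak_gradient \<Omega> u x = gradient u x"
proof -
  have "is_weak_gradient \<Omega> u (weak_gradient \<Omega> u)"
    unfolding weak_gradient_def using someI[of "is_weak_gradient \<Omega> u", OF is_weak_gradient_gradient[OF assms]] .
  then show ?thesis by (rule is_weak_gradient_unique[OF assms(1) _ is_weak_gradient_gradient[OF assms]])
qed

section \<open>A logarithmic barrier at a boundary point\<close>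

text \<open>The function \<open>s - s ln s\<close>. It is increasing on \<open>[0,1]\<close> with second derivative \<open>- 1 / s\<close>: composed
  with a function comparable to the distance \<open>s\<close> from the boundary, it produces a Laplacian of order
  \<open>- 1 / s\<close>, enough to compensate the Laplacian \<open>(n - 1) / r\<close> of the norm.\<close>

definition slog :: "real \<Rightarrow> real" where
  "slog s = s * (1 - ln s)"

lemma slog_nonneg: "0 \<le> s \<Longrightarrow> s \<le> 1 \<Longrightarrow> 0 \<le> slog s"
  by (cases "s = 0") (auto simp: slog_def ln_le_zero_iff intro!: mult_nonneg_nonneg order_trans[of "ln s" 0 1])

lemma slog_le:
  assumes "0 \<le> s" "s \<le> a" "0 < a"
  shows "slog s \<le> a * (1 + \<bar>ln a\<bar>)"
proof (cases "s = 0")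
  case False
  then have "s > 0" using assms by simp
  have "ln (a / s) \<le> a / s - 1" using \<open>s > 0\<close> \<open>0 < a\<close> by (intro ln_le_minus_one) simp
  then have "s * ln (a / s) \<le> s * (a / s - 1)" using \<open>s > 0\<close> by (intro mult_left_mono) auto
  then have "s * (ln a - ln s) \<le> a - s" using \<open>s > 0\<close> \<open>0 < a\<close> by (simp add: ln_div right_diff_distrib)
  moreover have "- (s * ln a) \<le> a * \<bar>ln a\<bar>"
  proof -
    have "- (s * ln a) \<le> s * \<bar>ln a\<bar>"
      using mult_left_mono[of "- ln a" "\<bar>ln a\<bar>" s] \<open>s > 0\<close> by simp
    also have "\<dots> \<le> a * \<bar>ln a\<bar>" using assms by (intro mult_right_mono) auto
    finally show ?thesis .
  qed
  ultimately show ?thesis by (simp add: slog_def algebra_simps)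
qed (use assms in \<open>simp add: slog_def\<close>)

lemma continuous_on_slog: "continuous_on {0..} slog"
  unfolding continuous_on_eq_continuous_within
proof
  fix s :: real assume "s \<in> {0..}"
  show "continuous (at s within {0..}) slog"
  proof (cases "s = 0")
    case True
    have "((\<lambda>s. s * (1 - ln s)) \<longlongrightarrow> 0) (at_right (0::real))" by real_asymp
    then show ?thesis using True
      by (simp add: continuous_within slog_def[abs_def] at_within_Ici_at_right)
  next
    case False
    then have "isCont slog s" using \<open>s \<in> {0..}\<close>
      unfolding slog_def by (intro continuous_intros) auto
    then show ?thesis by (rule continuous_at_imp_continuous_at_within)
  qed
qed

lemma DERIV_slog: "s > 0 \<Longrightarrow> (slog has_real_derivative - ln s) (at s)"
  unfolding slog_def by (auto intro!: derivative_eq_intros)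

lemma has_laplacian_norm:
  fixes x z :: "real^'n"
  assumes "x \<noteq> z"
  shows "has_laplacian (\<lambda>y. norm (y - z)) x ((real CARD('n) - 1) / norm (x - z))"
proof -
  define r where "r = norm (x - z)"
  have r: "r > 0" using assms by (simp add: r_def)
  have "\<forall>\<^sub>F \<tau> in nhds (r\<^sup>2). \<tau> \<in> {0<..}" using r by (intro eventually_nhds_in_open) auto
  then have 1: "\<forall>\<^sub>F \<tau> in nhds (r\<^sup>2). (sqrt has_real_derivative inverse (sqrt \<tau>) / 2) (at \<tau>)"
    by eventually_elim (use DERIV_real_sqrt in auto)
  have 2: "((\<lambda>\<tau>. inverse (sqrt \<tau>) / 2) has_real_derivative - 1 / (4 * r ^ 3)) (at (r\<^sup>2))"
    using r by (auto intro!: derivative_eq_intros simp: power2_eq_square power3_eq_cube real_sqrt_mult field_simps)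
  have "has_laplacian (\<lambda>y. sqrt ((norm (y - z))\<^sup>2)) x
      (4 * (- 1 / (4 * r ^ 3)) * r\<^sup>2 + 2 * real CARD('n) * (inverse (sqrt (r\<^sup>2)) / 2))"
    unfolding r_def by (rule has_laplacian_radial) (use 1 2 in \<open>simp_all only: r_def\<close>)
  moreover have "4 * (- 1 / (4 * r ^ 3)) * r\<^sup>2 + 2 * real CARD('n) * (inverse (sqrt (r\<^sup>2)) / 2) = (real CARD('n) - 1) / r"
    using r by (simp add: power2_eq_square power3_eq_cube field_simps)
  ultimately show ?thesis by (simp add: r_def)
qed

text \<open>Write \<open>S q = 1 - q\<^sup>-\<^sup>n\<close>, so that the function in question is \<open>slog (S Q)\<close>. The exponent
  \<open>n\<close> makes \<open>S (m \<bar>y - z\<bar>\<^sup>2)\<close> superharmonic, and \<open>slog\<close> is increasing where \<open>S < 1\<close>, so its first-order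
  contribution has the favourable sign. What remains is the strictly negative term coming from the
  second derivative of \<open>slog\<close>.\<close>

lemma has_laplacian_log_barrier:
  fixes x z :: "real^'n"
  assumes "m > 0" and Q: "Q = m * (norm (x - z))\<^sup>2" "Q > 1"
  defines "n \<equiv> CARD('n)"
  shows "\<exists>l. has_laplacian (\<lambda>y. slog (1 - 1 / (m * (norm (y - z))\<^sup>2) ^ n)) x l \<and>
             l \<le> - (4 * m * n\<^sup>2 / (Q ^ (2 * n + 1) * (1 - 1 / Q ^ n)))"
proof -
  define S where "S q = 1 - 1 / q ^ n" for q :: real
  define S1 where "S1 q = real n / q ^ (n + 1)" for q :: real
  define S2 where "S2 q = - (real n * (real n + 1) / q ^ (n + 2))" for q :: real
  have n: "n > 0" by (simp add: n_def)
  have Spos: "0 < S q" "S q < 1" if "q > 1" for q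
    using that n by (auto simp: S_def one_less_power)
  have dS: "(S has_real_derivative S1 q) (at q)" if "q > 0" for q
  proof -
    have "((\<lambda>q. 1 / q ^ n) has_real_derivative - (real n / q ^ (n + 1))) (at q)"
    proof -
      have p: "((\<lambda>q. q ^ n) has_real_derivative real n * q ^ n / q) (at q)"
        using DERIV_pow[of n q] n that by (cases n) auto
      have "q ^ n \<noteq> 0" using that by simp
      from DERIV_divide[OF DERIV_const p this, of 1] show ?thesis
        by (rule DERIV_cong) (use that in \<open>simp add: field_simps\<close>)
    qed
    from DERIV_diff[OF DERIV_const this, of 1] show ?thesis unfolding S_def S1_def by simp
  qed
  have dS1: "(S1 has_real_derivative S2 q) (at q)" if "q > 0" for q
  proof -
    have p: "((\<lambda>q. q ^ (n + 1)) has_real_derivative real (n + 1) * q ^ n) (at q)"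
      using DERIV_pow[of "n + 1" q] by simp
    have "q ^ (n + 1) \<noteq> 0" using that by simp
    from DERIV_divide[OF DERIV_const p this, of "real n"] show ?thesis
      unfolding S1_def S2_def by (rule DERIV_cong) (use that in \<open>simp add: field_simps power_add\<close>)
  qed
  define F where "F \<tau> = slog (S (m * \<tau>))" for \<tau>
  define F1 where "F1 \<tau> = - ln (S (m * \<tau>)) * (S1 (m * \<tau>) * m)" for \<tau>
  define F2 where "F2 = - (S1 Q * m / S Q) * (S1 Q * m) + - ln (S Q) * (S2 Q * m * m)"
  have dm: "((\<lambda>\<tau>. m * \<tau>) has_real_derivative m) (at \<tau>)" for \<tau>
    by (auto intro!: derivative_eq_intros)
  have dSm: "((\<lambda>\<tau>. S (m * \<tau>)) has_real_derivative S1 (m * \<tau>) * m) (at \<tau>)" if "m * \<tau> > 1" for \<tau>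
    by (rule DERIV_chain2[OF dS dm]) (use that in simp)
  have dF: "(F has_real_derivative F1 \<tau>) (at \<tau>)" if "m * \<tau> > 1" for \<tau>
    unfolding F_def F1_def by (rule DERIV_chain2[OF DERIV_slog dSm]) (use that Spos in auto)
  define \<rho> where "\<rho> = (norm (x - z))\<^sup>2"
  have \<rho>: "m * \<rho> = Q" using Q by (simp add: \<rho>_def)
  have dF1: "(F1 has_real_derivative F2) (at \<rho>)"
  proof -
    have Q1: "m * \<rho> > 1" unfolding \<rho> by (rule Q(2))
    have 1: "((\<lambda>\<tau>. - ln (S (m * \<tau>))) has_real_derivative - (S1 Q * m / S Q)) (at \<rho>)"
      using DERIV_minus[OF DERIV_chain2[OF DERIV_ln_divide dSm[OF Q1]]] Spos[OF Q1] by (simp add: \<rho>)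
    have 2: "((\<lambda>\<tau>. S1 (m * \<tau>) * m) has_real_derivative S2 Q * m * m) (at \<rho>)"
      using DERIV_cmult_right[OF DERIV_chain2[OF dS1 dm], of \<rho> m] Q1 by (simp add: \<rho>)
    from DERIV_mult[OF 1 2] show ?thesis unfolding F1_def F2_def \<rho>
      by (rule DERIV_cong) (simp add: \<rho> algebra_simps)
  qed
  have "\<forall>\<^sub>F \<tau> in nhds \<rho>. \<tau> \<in> {1 / m <..}"
    using Q(2) \<open>m > 0\<close> by (intro eventually_nhds_in_open) (auto simp: field_simps simp flip: \<rho>)
  then have ev: "\<forall>\<^sub>F \<tau> in nhds \<rho>. (F has_real_derivative F1 \<tau>) (at \<tau>)"
    by eventually_elim (rule dF, use \<open>m > 0\<close> in \<open>simp add: field_simps\<close>)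
  have lap: "has_laplacian (\<lambda>y. F ((norm (y - z))\<^sup>2)) x (4 * F2 * \<rho> + 2 * real n * F1 \<rho>)"
    unfolding \<rho>_def n_def by (rule has_laplacian_radial) (use ev dF1 in \<open>simp_all only: \<rho>_def\<close>)
  have "4 * F2 * \<rho> + 2 * real n * F1 \<rho>
      = - (4 * m * Q * (S1 Q)\<^sup>2 / S Q) + m * (- ln (S Q)) * (4 * Q * S2 Q + 2 * real n * S1 Q)"
  proof -
    have "4 * F2 * \<rho> = 4 * (- (S1 Q / S Q) * (S1 Q * m) + - ln (S Q) * (S2 Q * m)) * (m * \<rho>)"
      by (simp add: F2_def algebra_simps)
    then show ?thesis unfolding \<rho> F1_def by (simp add: algebra_simps power2_eq_square)
  qed
  also have "\<dots> \<le> - (4 * m * Q * (S1 Q)\<^sup>2 / S Q)"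
  proof -
    have "4 * Q * S2 Q + 2 * real n * S1 Q = real n / Q ^ (n + 1) * (- 4 * (real n + 1) + 2 * real n)"
      using Q(2) by (simp add: S1_def S2_def field_simps power_add power2_eq_square)
    also have "\<dots> \<le> 0" using Q(2) by (intro mult_nonneg_nonpos) auto
    finally have "4 * Q * S2 Q + 2 * real n * S1 Q \<le> 0" .
    moreover have "0 \<le> m * (- ln (S Q))" using Spos[OF Q(2)] \<open>m > 0\<close> by (intro mult_nonneg_nonneg) (simp_all add: ln_le_zero_iff)
    ultimately have "m * (- ln (S Q)) * (4 * Q * S2 Q + 2 * real n * S1 Q) \<le> 0"
      by (rule mult_nonneg_nonpos[rotated])
    then show ?thesis by simp
  qed
  also have "4 * m * Q * (S1 Q)\<^sup>2 / S Q = 4 * m * n\<^sup>2 / (Q ^ (2 * n + 1) * S Q)"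
  proof -
    have "Q * (S1 Q)\<^sup>2 = n\<^sup>2 / Q ^ (2 * n + 1)"
      using Q(2) by (simp add: S1_def power_divide power2_eq_square mult_2 power_add power_mult field_simps)
    then have "4 * m * (Q * (S1 Q)\<^sup>2) / S Q = 4 * m * (n\<^sup>2 / Q ^ (2 * n + 1)) / S Q" by (simp only:)
    then show ?thesis by (simp add: mult.assoc)
  qed
  finally have "4 * F2 * \<rho> + 2 * real n * F1 \<rho> \<le> - (4 * m * n\<^sup>2 / (Q ^ (2 * n + 1) * (1 - 1 / Q ^ n)))"
    by (simp add: S_def)
  then show ?thesis using lap unfolding F_def S_def by blast
qed

text \<open>If \<open>e\<close> is a unit vector and \<open>M > 0\<close>, this is positive exactly outside the closed ball of radius
  \<open>1 / (2 M)\<close> around \<open>y - e / (2 M)\<close>, whose boundary passes through \<open>y\<close>. It encodes the exterior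
  ball at \<open>y\<close> by a polynomial that is bounded by a multiple of \<open>\<bar>x - y\<bar>\<close> on bounded sets.\<close>

abbreviation exterior_quadric :: "real \<Rightarrow> real^'n \<Rightarrow> real^'n \<Rightarrow> real^'n \<Rightarrow> real" where
  "exterior_quadric M e y x \<equiv> e \<bullet> (x - y) + M * (norm (x - y))\<^sup>2"

text \<open>An upper barrier at \<open>y\<close> for boundary values with Lipschitz constant 1, for domains of diameter at
  most \<open>D\<close> that lie outside the exterior ball at \<open>y\<close>.\<close>

definition is_log_barrier ::
    "real \<Rightarrow> real \<Rightarrow> real \<Rightarrow> real^'n \<Rightarrow> real^'n \<Rightarrow> (real^'n \<Rightarrow> real) \<Rightarrow> bool" where
  "is_log_barrier M D K e y W \<longleftrightarrow>
     continuous_on {x. 0 \<le> exterior_quadric M e y x} W \<and>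
     (\<forall>x. 0 \<le> exterior_quadric M e y x \<longrightarrow> norm (x - y) \<le> W x) \<and>
     (\<forall>x. 0 < exterior_quadric M e y x \<and> norm (x - y) \<le> D \<longrightarrow> (\<exists>l\<le>0. has_laplacian W x l)) \<and>
     (\<forall>x d. 0 \<le> exterior_quadric M e y x \<and> norm (x - y) \<le> D \<and> 0 < d \<and> norm (x - y) \<le> 2 * d
        \<longrightarrow> W x \<le> K * d * (1 + \<bar>ln d\<bar>))"

text \<open>The barrier is \<open>\<bar>x - y\<bar> + k slog (S x)\<close>, where \<open>S\<close> vanishes on the exterior sphere and is at
  most \<open>C1 \<bar>x - y\<bar>\<close>. The Laplacian of the norm is \<open>(n - 1) / \<bar>x - y\<bar>\<close>, that of \<open>slog S\<close> at most
  \<open>- c0 / \<bar>x - y\<bar>\<close>, and \<open>k\<close> is chosen to make the sum negative. The constants depend on \<open>M\<close>, \<open>D\<close> and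
  the dimension only.\<close>

lemma log_barrier_exists:
  assumes "M > 0" "D > 0"
  obtains K where "K > 0" "\<forall>(y::real^'n) e. norm e = 1 \<longrightarrow> (\<exists>W. is_log_barrier M D K e y W)"
proof -
  define n where "n = CARD('n)"
  have n: "n > 0" by (simp add: n_def)
  define m where "m = 4 * M\<^sup>2"
  have m: "m > 0" using \<open>M > 0\<close> by (simp add: m_def)
  \<comment> \<open>An upper bound for \<open>1 + 4 M q\<close> at distance at most \<open>D\<close> from the boundary point.\<close>
  define Qm where "Qm = 1 + 4 * M * (D + M * D\<^sup>2)"
  have Qm: "Qm \<ge> 1" using assms by (simp add: Qm_def)
  define C1 where "C1 = 4 * M * n * (1 + M * D)"
  have C1: "C1 > 0" using assms n by (simp add: C1_def add_pos_pos)
  define c0 where "c0 = 4 * m * n\<^sup>2 / (Qm ^ (2 * n + 1) * C1)"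
  have c0: "c0 > 0" using m n Qm C1 by (simp add: c0_def)
  define k where "k = n / c0"
  have k: "k > 0" using n c0 by (simp add: k_def)
  define K where "K = 2 + 2 * C1 * k * (1 + \<bar>ln (2 * C1)\<bar>)"
  have K: "K > 0" unfolding K_def using C1 k by (intro add_pos_nonneg mult_nonneg_nonneg) auto
  have "\<exists>W. is_log_barrier M D K e x\<^sub>0 W" if e: "norm e = 1" for x\<^sub>0 e :: "real^'n"
  proof -
    define q where "q x = e \<bullet> (x - x\<^sub>0) + M * (norm (x - x\<^sub>0))\<^sup>2" for x
    \<comment> \<open>The centre of the exterior ball; \<open>m\<close> normalises its squared radius to 1, and \<open>1 + 4 M q\<close> becomes \<open>m \<bar>x - z\<bar>\<^sup>2\<close>.\<close>
    define z where "z = x\<^sub>0 - (1 / (2 * M)) *\<^sub>R e"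
    define S where "S x = 1 - 1 / (m * (norm (x - z))\<^sup>2) ^ n" for x
    define W where "W x = norm (x - x\<^sub>0) + k * slog (S x)" for x
    have Q: "m * (norm (x - z))\<^sup>2 = 1 + 4 * M * q x" for x
    proof -
      define w where "w = x - x\<^sub>0"
      have "x - z = w + (1 / (2 * M)) *\<^sub>R e" by (simp add: z_def w_def)
      then have "(norm (x - z))\<^sup>2 = (norm (w + (1 / (2 * M)) *\<^sub>R e))\<^sup>2" by (simp only:)
      also have "\<dots> = w \<bullet> w + (1 / M) * (e \<bullet> w) + (1 / (2 * M))\<^sup>2 * (e \<bullet> e)"
        unfolding power2_norm_eq_inner
        using \<open>M > 0\<close> by (simp add: inner_add_left inner_add_right inner_commute power2_eq_square field_simps)
      also have "e \<bullet> e = 1" using e by (simp add: norm_eq_1)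
      finally have "(norm (x - z))\<^sup>2 = w \<bullet> w + (1 / M) * (e \<bullet> w) + (1 / (2 * M))\<^sup>2" by simp
      then have "m * (norm (x - z))\<^sup>2 = m * (w \<bullet> w + (1 / M) * (e \<bullet> w) + (1 / (2 * M))\<^sup>2)" by (simp only:)
      also have "\<dots> = 1 + 4 * M * (e \<bullet> w + M * (w \<bullet> w))"
        using \<open>M > 0\<close> by (simp add: m_def power2_eq_square field_simps)
      finally show ?thesis by (simp add: q_def w_def power2_norm_eq_inner)
    qed
    have q_le: "q x \<le> norm (x - x\<^sub>0) * (1 + M * norm (x - x\<^sub>0))" for x
    proof -
      have "e \<bullet> (x - x\<^sub>0) \<le> norm (x - x\<^sub>0)" using norm_cauchy_schwarz[of e "x - x\<^sub>0"] e by simp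
      then show ?thesis by (simp add: q_def power2_eq_square algebra_simps)
    qed
    have S01: "0 \<le> S x" "S x \<le> 1" if "0 \<le> q x" for x
    proof -
      have "1 \<le> (1 + 4 * M * q x) ^ n" using that \<open>M > 0\<close> by (intro one_le_power) simp
      then show "0 \<le> S x" "S x \<le> 1" unfolding S_def Q by (auto simp: divide_le_eq)
    qed
    have S_le: "S x \<le> C1 * norm (x - x\<^sub>0)" if "0 \<le> q x" "norm (x - x\<^sub>0) \<le> D" for x
    proof -
      define y where "y = 1 / (1 + 4 * M * q x)"
      have pos: "1 + 4 * M * q x > 0" using that \<open>M > 0\<close> by (simp add: add_pos_nonneg)
      \<comment> \<open>Bernoulli: \<open>1 - y\<^sup>n \<le> n (1 - y)\<close> bounds \<open>S\<close> by a multiple of \<open>q\<close>.\<close>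
      have "1 + real n * (y - 1) \<le> (1 + (y - 1)) ^ n"
        by (rule Bernoulli_inequality) (use pos in \<open>simp add: y_def\<close>)
      then have "1 - y ^ n \<le> real n * (1 - y)" by (simp add: algebra_simps)
      moreover have "S x = 1 - y ^ n" unfolding S_def Q y_def by (simp add: power_one_over)
      moreover have "1 - y \<le> 4 * M * q x"
      proof -
        have "1 - y = 4 * M * q x / (1 + 4 * M * q x)" using pos by (simp add: y_def field_simps)
        also have "\<dots> \<le> 4 * M * q x" using that \<open>M > 0\<close> pos by (simp add: divide_le_eq algebra_simps)
        finally show ?thesis .
      qed
      moreover have "q x \<le> norm (x - x\<^sub>0) * (1 + M * D)"
      proof -
        have "norm (x - x\<^sub>0) * (1 + M * norm (x - x\<^sub>0)) \<le> norm (x - x\<^sub>0) * (1 + M * D)"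
          using that \<open>M > 0\<close> by (intro mult_left_mono add_left_mono) auto
        then show ?thesis using q_le[of x] by linarith
      qed
      then have "4 * M * q x \<le> 4 * M * (norm (x - x\<^sub>0) * (1 + M * D))"
        using \<open>M > 0\<close> by (intro mult_left_mono) auto
      ultimately have "1 - y \<le> 4 * M * (norm (x - x\<^sub>0) * (1 + M * D))" and S: "S x \<le> real n * (1 - y)"
        by linarith+
      then have "real n * (1 - y) \<le> real n * (4 * M * (norm (x - x\<^sub>0) * (1 + M * D)))"
        by (intro mult_left_mono) auto
      with S have "S x \<le> real n * (4 * M * (norm (x - x\<^sub>0) * (1 + M * D)))" by linarith
      then show ?thesis by (simp add: C1_def algebra_simps)
    qed
    show ?thesis
      unfolding is_log_barrier_def q_def[symmetric]
    proof (intro exI[of _ W] conjI allI impI)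
      have "continuous_on {x. 0 \<le> q x} S"
      proof -
        have "(1 + 4 * M * q x) ^ n \<noteq> 0" if "0 \<le> q x" for x
          using that \<open>M > 0\<close> by (metis add_pos_nonneg mult_nonneg_nonneg order_less_irrefl power_not_zero zero_less_one less_imp_le zero_less_numeral)
        then show ?thesis unfolding S_def by (intro continuous_intros) (simp add: Q)
      qed
      then have "continuous_on {x. 0 \<le> q x} (\<lambda>x. slog (S x))"
        by (rule continuous_on_compose2[OF continuous_on_slog]) (use S01 in auto)
      then show "continuous_on {x. 0 \<le> q x} W" unfolding W_def by (intro continuous_intros)
    next
      fix x assume "0 \<le> q x"
      then show "norm (x - x\<^sub>0) \<le> W x" unfolding W_def using k S01 slog_nonneg by simp
    next
      fix x assume x: "0 < q x \<and> norm (x - x\<^sub>0) \<le> D"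
      define r where "r = norm (x - x\<^sub>0)"
      have "x \<noteq> x\<^sub>0" using x by (auto simp: q_def)
      then have r: "r > 0" by (simp add: r_def)
      define Q where "Q = 1 + 4 * M * q x"
      have Q1: "Q > 1" using x \<open>M > 0\<close> by (simp add: Q_def)
      have "Q \<le> Qm"
      proof -
        have "r * (1 + M * r) \<le> D * (1 + M * D)"
          using x r \<open>M > 0\<close> \<open>D > 0\<close> by (intro mult_mono add_left_mono mult_left_mono) (auto simp: r_def)
        then have "q x \<le> D + M * D\<^sup>2" using q_le[of x] by (simp add: r_def power2_eq_square algebra_simps)
        then show ?thesis using \<open>M > 0\<close> by (simp add: Q_def Qm_def)
      qed
      obtain l where l: "has_laplacian (\<lambda>y. slog (S y)) x l"
        "l \<le> - (4 * m * n\<^sup>2 / (Q ^ (2 * n + 1) * (1 - 1 / Q ^ n)))"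
        using has_laplacian_log_barrier[OF m, of Q x z] Q1 \<open>\<And>x. m * (norm (x - z))\<^sup>2 = 1 + 4 * M * q x\<close>
        unfolding S_def n_def[symmetric] by (auto simp: Q_def)
      have S: "1 - 1 / Q ^ n = S x" by (simp add: S_def Q_def \<open>\<And>x. m * (norm (x - z))\<^sup>2 = 1 + 4 * M * q x\<close>)
      have Spos: "S x > 0" using Q1 n by (simp add: one_less_power flip: S)
      have "c0 / r \<le> 4 * m * n\<^sup>2 / (Q ^ (2 * n + 1) * S x)"
      proof -
        have "Q ^ (2 * n + 1) * S x \<le> Qm ^ (2 * n + 1) * (C1 * r)"
          unfolding r_def using \<open>Q \<le> Qm\<close> Q1 Spos S_le[of x] x by (intro mult_mono power_mono) auto
        moreover have "0 < Q ^ (2 * n + 1) * S x" using Q1 Spos by simp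
        ultimately have "4 * m * n\<^sup>2 / (Qm ^ (2 * n + 1) * (C1 * r)) \<le> 4 * m * n\<^sup>2 / (Q ^ (2 * n + 1) * S x)"
          using m by (intro divide_left_mono) (auto intro: less_le_trans)
        then show ?thesis by (simp add: c0_def mult.assoc)
      qed
      then have "l \<le> - (c0 / r)" using l(2) S by simp
      then have "k * l \<le> k * - (c0 / r)" using k by (intro mult_left_mono) auto
      also have "\<dots> = - (n / r)" using c0 by (simp add: k_def)
      finally have kl: "k * l \<le> - (n / r)" .
      have "has_laplacian W x ((real n - 1) / r + k * l)"
        unfolding W_def r_def n_def
        by (intro has_laplacian_add has_laplacian_cmult l(1) has_laplacian_norm \<open>x \<noteq> x\<^sub>0\<close>)
      moreover have "(real n - 1) / r + k * l \<le> 0"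
      proof -
        have "(real n - 1) / r \<le> n / r" using r by (intro divide_right_mono) auto
        then show ?thesis using kl by linarith
      qed
      ultimately show "\<exists>l\<le>0. has_laplacian W x l" by blast
    next
      fix x d assume x: "0 \<le> q x \<and> norm (x - x\<^sub>0) \<le> D \<and> 0 < d \<and> norm (x - x\<^sub>0) \<le> 2 * d"
      define a where "a = 2 * C1 * d"
      have a: "a > 0" using C1 x by (simp add: a_def)
      have "S x \<le> a"
      proof -
        have "C1 * norm (x - x\<^sub>0) \<le> C1 * (2 * d)" using x C1 by (intro mult_left_mono) auto
        then show ?thesis using S_le[of x] x by (simp add: a_def)
      qed
      then have "slog (S x) \<le> a * (1 + \<bar>ln a\<bar>)"
        using S01 x a by (intro slog_le) auto
      also have "\<bar>ln a\<bar> \<le> \<bar>ln (2 * C1)\<bar> + \<bar>ln d\<bar>"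
        using C1 x ln_mult[of "2 * C1" d] by (simp add: a_def)
      then have "a * (1 + \<bar>ln a\<bar>) \<le> a * (1 + (\<bar>ln (2 * C1)\<bar> + \<bar>ln d\<bar>))"
        using a by (intro mult_left_mono add_left_mono) auto
      also have "\<dots> \<le> a * ((1 + \<bar>ln (2 * C1)\<bar>) * (1 + \<bar>ln d\<bar>))"
        using a by (intro mult_left_mono) (auto simp: algebra_simps)
      finally have "k * slog (S x) \<le> k * (a * ((1 + \<bar>ln (2 * C1)\<bar>) * (1 + \<bar>ln d\<bar>)))"
        using k by (intro mult_left_mono) auto
      moreover have "norm (x - x\<^sub>0) \<le> 2 * d * (1 + \<bar>ln d\<bar>)"
      proof -
        have "2 * d * 1 \<le> 2 * d * (1 + \<bar>ln d\<bar>)" using x by (intro mult_left_mono) auto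
        then show ?thesis using x by linarith
      qed
      ultimately have "W x \<le> 2 * d * (1 + \<bar>ln d\<bar>) + k * (a * ((1 + \<bar>ln (2 * C1)\<bar>) * (1 + \<bar>ln d\<bar>)))"
        unfolding W_def by linarith
      also have "\<dots> = K * d * (1 + \<bar>ln d\<bar>)" by (simp add: K_def a_def algebra_simps)
      finally show "W x \<le> K * d * (1 + \<bar>ln d\<bar>)" .
    qed
  qed
  then show ?thesis using K that by blast
qed

section \<open>Geometry of a \<open>C\<^sup>2\<close> boundary\<close>

lemma Ck_on_1_Lipschitz_on_cball:
  fixes w :: "real^'n \<Rightarrow> real"
  assumes "Ck_on 1 UNIV w"
  obtains L where "L \<ge> 0" "\<And>x y. x \<in> cball a r \<Longrightarrow> y \<in> cball a r \<Longrightarrow> \<bar>w x - w y\<bar> \<le> L * norm (x - y)"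
proof -
  have dif: "w differentiable at x" for x using assms by simp
  have "continuous_on (cball a r) (gradient w)"
    unfolding gradient_def using assms
    by (intro continuous_on_vec_lambda) (auto intro: continuous_on_subset)
  then have "bounded (gradient w ` cball a r)"
    by (intro compact_imp_bounded compact_continuous_image) auto
  then obtain L where L: "L > 0" "\<And>x. x \<in> cball a r \<Longrightarrow> norm (gradient w x) \<le> L"
    unfolding bounded_pos by auto
  have "norm (w x - w y) \<le> L * norm (x - y)" if xy: "x \<in> cball a r" "y \<in> cball a r" for x y
  proof (rule differentiable_bound[OF convex_cball _ _ xy])
    show "(w has_derivative (\<lambda>h. gradient w z \<bullet> h)) (at z within cball a r)" for z
      using has_derivative_gradient[OF dif] by (rule has_derivative_at_withinI)
    show "onorm (\<lambda>h. gradient w z \<bullet> h) \<le> L" if "z \<in> cball a r" for z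
    proof (rule onorm_le)
      fix h
      have "norm (gradient w z \<bullet> h) \<le> norm (gradient w z) * norm h" by (simp add: Cauchy_Schwarz_ineq2)
      also have "\<dots> \<le> L * norm h" using L(2)[OF that] by (rule mult_right_mono) simp
      finally show "norm (gradient w z \<bullet> h) \<le> L * norm h" .
    qed
  qed
  then show ?thesis using that[of L] L(1) by simp
qed

text \<open>The mean value theorem on the segment from \<open>y\<close> to \<open>x\<close>, together with the Lipschitz continuity of
  the gradient.\<close>

lemma Ck_on_2_Taylor_on_cball:
  fixes w :: "real^'n \<Rightarrow> real"
  assumes "Ck_on 2 UNIV w"
  obtains M where "M \<ge> 0"
    "\<And>x y. x \<in> cball a r \<Longrightarrow> y \<in> cball a r \<Longrightarrow> \<bar>w x - w y - gradient w y \<bullet> (x - y)\<bar> \<le> M * (norm (x - y))\<^sup>2"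
proof -
  have dif: "w differentiable at x" for x using Ck_on_2D(1)[OF assms] by simp
  have "\<exists>L\<ge>0. \<forall>x\<in>cball a r. \<forall>y\<in>cball a r. \<bar>partial i w x - partial i w y\<bar> \<le> L * norm (x - y)" for i
  proof -
    have "Ck_on 1 UNIV (partial i w)" using assms by (simp add: numeral_2_eq_2)
    from Ck_on_1_Lipschitz_on_cball[OF this] show ?thesis by metis
  qed
  then obtain L where L: "\<And>i. L i \<ge> 0"
    "\<And>i x y. x \<in> cball a r \<Longrightarrow> y \<in> cball a r \<Longrightarrow> \<bar>partial i w x - partial i w y\<bar> \<le> L i * norm (x - y)"
    by metis
  define M where "M = (\<Sum>i\<in>UNIV. L i)"
  have "M \<ge> 0" unfolding M_def using L(1) by (simp add: sum_nonneg)
  have grad: "norm (gradient w x - gradient w y) \<le> M * norm (x - y)" if "x \<in> cball a r" "y \<in> cball a r" for x y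
  proof -
    have "norm (gradient w x - gradient w y) \<le> (\<Sum>i\<in>UNIV. \<bar>(gradient w x - gradient w y) $ i\<bar>)"
      by (rule norm_le_l1_cart)
    also have "\<dots> \<le> (\<Sum>i\<in>UNIV. L i * norm (x - y))"
      using L(2)[OF that] by (intro sum_mono) (simp add: gradient_def)
    finally show ?thesis by (simp add: M_def sum_distrib_right)
  qed
  have "\<bar>w x - w y - gradient w y \<bullet> (x - y)\<bar> \<le> M * (norm (x - y))\<^sup>2" if xy: "x \<in> cball a r" "y \<in> cball a r" for x y
  proof -
    define p where "p t = y + t *\<^sub>R (x - y)" for t :: real
    have dp: "((\<lambda>t. w (p t)) has_derivative (\<lambda>s. gradient w (p t) \<bullet> (s *\<^sub>R (x - y)))) (at t)" for t
    proof -
      have "(p has_derivative (\<lambda>s. s *\<^sub>R (x - y))) (at t)"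
        unfolding p_def by (auto intro!: derivative_eq_intros)
      from has_derivative_compose[OF this has_derivative_gradient[OF dif]] show ?thesis .
    qed
    have "\<exists>t\<in>{0<..<1}. w (p 1) - w (p 0) = gradient w (p t) \<bullet> ((1 - 0) *\<^sub>R (x - y))"
      by (rule mvt_simple) (simp, rule has_derivative_at_withinI[OF dp])
    then obtain t where t: "0 < t" "t < 1" "w x - w y = gradient w (p t) \<bullet> (x - y)"
      by (auto simp: p_def)
    have pt: "p t \<in> cball a r"
    proof -
      have "p t = (1 - t) *\<^sub>R y + t *\<^sub>R x" by (simp add: p_def algebra_simps)
      then show ?thesis using convexD[OF convex_cball xy(2,1), of "1 - t" t] t by simp
    qed
    have "\<bar>w x - w y - gradient w y \<bullet> (x - y)\<bar> = \<bar>(gradient w (p t) - gradient w y) \<bullet> (x - y)\<bar>"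
      using t by (simp add: inner_diff_left)
    also have "\<dots> \<le> norm (gradient w (p t) - gradient w y) * norm (x - y)" by (rule Cauchy_Schwarz_ineq2)
    also have "\<dots> \<le> (M * norm (p t - y)) * norm (x - y)"
      using grad[OF pt xy(2)] by (rule mult_right_mono) simp
    also have "\<dots> \<le> (M * norm (x - y)) * norm (x - y)"
    proof -
      have "norm (p t - y) \<le> norm (x - y)" using t by (simp add: p_def mult_left_le_one_le)
      then show ?thesis using \<open>M \<ge> 0\<close> by (intro mult_right_mono mult_left_mono) auto
    qed
    finally show ?thesis by (simp add: power2_eq_square mult.assoc)
  qed
  then show ?thesis using that \<open>M \<ge> 0\<close> by blast
qed

lemma gradient_orthogonal_to_constant_direction:
  fixes \<gamma> :: "real^'n \<Rightarrow> real"
  assumes "\<gamma> differentiable at x" "\<And>x t. \<gamma> (x + t *\<^sub>R \<nu>) = \<gamma> x"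
  shows "gradient \<gamma> x \<bullet> \<nu> = 0"
proof -
  have p: "((\<lambda>t. x + t *\<^sub>R \<nu>) has_derivative (\<lambda>s. s *\<^sub>R \<nu>)) (at 0)"
    by (auto intro!: derivative_eq_intros)
  have g: "(\<gamma> has_derivative (\<lambda>h. gradient \<gamma> x \<bullet> h)) (at (x + 0 *\<^sub>R \<nu>))"
    using has_derivative_gradient[OF assms(1)] by simp
  have "((\<lambda>t. \<gamma> x) has_derivative (\<lambda>s. gradient \<gamma> x \<bullet> (s *\<^sub>R \<nu>))) (at (0::real))"
    using has_derivative_compose[OF p g] assms(2) by simp
  moreover have "((\<lambda>t. \<gamma> x) has_derivative (\<lambda>s. 0)) (at (0::real))" by simp
  ultimately have "(\<lambda>s. gradient \<gamma> x \<bullet> (s *\<^sub>R \<nu>)) = (\<lambda>s. 0)" by (rule has_derivative_unique)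
  from fun_cong[OF this, of 1] show ?thesis by simp
qed

text \<open>In a chart the domain is \<open>{F > 0}\<close> with \<open>F x = x \<bullet> \<nu> - \<gamma> x\<close>. As \<open>\<gamma>\<close> is constant in
  direction \<open>\<nu>\<close>, the function \<open>F\<close> has slope exactly 1 in that direction. In particular its gradient has
  norm at least 1, and dividing the second-order Taylor bound for \<open>F\<close> at a boundary point by this norm
  yields the exterior quadric.\<close>

lemma C2_boundary_chart:
  fixes \<Omega> :: "(real^'n) set"
  assumes "open \<Omega>" "C2_boundary \<Omega>" "x\<^sub>0 \<in> frontier \<Omega>"
  obtains r \<nu> F \<Lambda> M where "r > 0" "norm \<nu> = 1" "\<Lambda> > 0" "M > 0" "continuous_on UNIV F"
    "\<forall>x t. F (x + t *\<^sub>R \<nu>) = F x + t"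
    "\<forall>x\<in>ball x\<^sub>0 r. \<forall>y\<in>ball x\<^sub>0 r. \<bar>F x - F y\<bar> \<le> \<Lambda> * norm (x - y)"
    "\<forall>x\<in>\<Omega> \<inter> ball x\<^sub>0 r. F x > 0"
    "\<forall>x\<in>frontier \<Omega> \<inter> ball x\<^sub>0 r. F x = 0"
    "\<forall>y\<in>frontier \<Omega> \<inter> ball x\<^sub>0 r.
       \<exists>e. norm e = 1 \<and> (\<forall>x\<in>\<Omega> \<inter> ball x\<^sub>0 r. 0 < exterior_quadric M e y x)"
proof -
  obtain r \<nu> \<gamma> where r: "r > 0" and \<nu>: "norm \<nu> = 1" and \<gamma>: "Ck_on 2 UNIV \<gamma>" "\<And>x t. \<gamma> (x + t *\<^sub>R \<nu>) = \<gamma> x"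
    and \<Omega>: "\<Omega> \<inter> ball x\<^sub>0 r = {x \<in> ball x\<^sub>0 r. \<gamma> x < x \<bullet> \<nu>}"
    using bspec[OF assms(2)[unfolded C2_boundary_def] assms(3)] by (elim exE conjE) (rule that, assumption+, blast+)
  define F where "F x = x \<bullet> \<nu> - \<gamma> x" for x
  have dif: "\<gamma> differentiable at x" for x using Ck_on_2D(1)[OF \<gamma>(1)] by simp
  have \<nu>\<nu>: "\<nu> \<bullet> \<nu> = 1" using \<nu> by (simp add: norm_eq_1)
  have contF: "continuous_on UNIV F"
    unfolding F_def using Ck_on_2D(3)[OF \<gamma>(1)] by (intro continuous_intros) auto
  have Fpos: "x \<in> \<Omega> \<longleftrightarrow> F x > 0" if "x \<in> ball x\<^sub>0 r" for x
  proof -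
    have "x \<in> \<Omega> \<inter> ball x\<^sub>0 r \<longleftrightarrow> x \<in> {x \<in> ball x\<^sub>0 r. \<gamma> x < x \<bullet> \<nu>}" by (simp only: \<Omega>)
    then show ?thesis using that by (simp add: F_def)
  qed
  have F0: "F x = 0" if "x \<in> frontier \<Omega>" "x \<in> ball x\<^sub>0 r" for x
  proof (rule antisym)
    have "x \<notin> \<Omega>" using that(1) assms(1) by (simp add: frontier_def interior_open)
    then show "F x \<le> 0" using Fpos[OF that(2)] by simp
    show "0 \<le> F x"
    proof (rule ccontr)
      assume "\<not> 0 \<le> F x"
      define U where "U = ball x\<^sub>0 r \<inter> {z. F z < 0}"
      have "open U" unfolding U_def using contF by (auto intro!: open_Int open_Collect_less)
      moreover have "x \<in> U" using \<open>\<not> 0 \<le> F x\<close> that(2) by (simp add: U_def)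
      moreover have "x \<in> closure \<Omega>" using that(1) by (simp add: frontier_def)
      ultimately have "U \<inter> \<Omega> \<noteq> {}" by (metis disjoint_iff closure_iff_nhds_not_empty order_refl)
      then show False using Fpos unfolding U_def by force
    qed
  qed
  have "Ck_on 1 UNIV \<gamma>" using \<gamma>(1) Ck_on_SucD[of 1 UNIV \<gamma>] by (simp add: numeral_2_eq_2)
  then obtain L where L: "L \<ge> 0" "\<And>x y. x \<in> cball x\<^sub>0 r \<Longrightarrow> y \<in> cball x\<^sub>0 r \<Longrightarrow> \<bar>\<gamma> x - \<gamma> y\<bar> \<le> L * norm (x - y)"
    using Ck_on_1_Lipschitz_on_cball by blast
  obtain M where M: "M \<ge> 0"
    "\<And>x y. x \<in> cball x\<^sub>0 r \<Longrightarrow> y \<in> cball x\<^sub>0 r \<Longrightarrow> \<bar>\<gamma> x - \<gamma> y - gradient \<gamma> y \<bullet> (x - y)\<bar> \<le> M * (norm (x - y))\<^sup>2"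
    using Ck_on_2_Taylor_on_cball[OF \<gamma>(1)] by blast
  show ?thesis
  proof (rule that[of r \<nu> "L + 1" "M + 1" F])
    show "\<forall>x t. F (x + t *\<^sub>R \<nu>) = F x + t"
      using \<gamma>(2) \<nu>\<nu> by (simp add: F_def inner_add_left)
    show "\<forall>x\<in>ball x\<^sub>0 r. \<forall>y\<in>ball x\<^sub>0 r. \<bar>F x - F y\<bar> \<le> (L + 1) * norm (x - y)"
    proof (intro ballI)
      fix x y assume that: "x \<in> ball x\<^sub>0 r" "y \<in> ball x\<^sub>0 r"
      have "\<bar>(x - y) \<bullet> \<nu>\<bar> \<le> norm (x - y)" using Cauchy_Schwarz_ineq2[of "x - y" \<nu>] \<nu> by simp
      moreover have "\<bar>\<gamma> x - \<gamma> y\<bar> \<le> L * norm (x - y)" using that by (intro L(2)) auto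
      ultimately show "\<bar>F x - F y\<bar> \<le> (L + 1) * norm (x - y)"
        by (simp add: F_def inner_diff_left algebra_simps)
    qed
    show "\<forall>x\<in>\<Omega> \<inter> ball x\<^sub>0 r. F x > 0" using Fpos by blast
    show "\<forall>x\<in>frontier \<Omega> \<inter> ball x\<^sub>0 r. F x = 0" using F0 by blast
    show "\<forall>y\<in>frontier \<Omega> \<inter> ball x\<^sub>0 r.
       \<exists>e. norm e = 1 \<and> (\<forall>x\<in>\<Omega> \<inter> ball x\<^sub>0 r. 0 < exterior_quadric (M + 1) e y x)"
    proof
      fix y assume "y \<in> frontier \<Omega> \<inter> ball x\<^sub>0 r"
      then have y: "y \<in> frontier \<Omega>" "y \<in> ball x\<^sub>0 r" by auto
      define g where "g = \<nu> - gradient \<gamma> y"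
      have "g \<bullet> \<nu> = 1"
        using gradient_orthogonal_to_constant_direction[OF dif \<gamma>(2)] \<nu>\<nu> by (simp add: g_def inner_diff_left)
      then have g: "norm g \<ge> 1" using norm_cauchy_schwarz[of g \<nu>] \<nu> by simp
      show "\<exists>e. norm e = 1 \<and> (\<forall>x\<in>\<Omega> \<inter> ball x\<^sub>0 r. 0 < exterior_quadric (M + 1) e y x)"
      proof (intro exI[of _ "(1 / norm g) *\<^sub>R g"] conjI ballI)
        show "norm ((1 / norm g) *\<^sub>R g) = 1" using g by (auto simp: field_simps)
        fix x assume x: "x \<in> \<Omega> \<inter> ball x\<^sub>0 r"
        have "0 < F x - F y" using Fpos[of x] x F0[OF y] by simp
        also have "\<dots> = g \<bullet> (x - y) - (\<gamma> x - \<gamma> y - gradient \<gamma> y \<bullet> (x - y))"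
          by (simp add: F_def g_def inner_diff_left inner_diff_right inner_commute)
        also have "\<dots> \<le> g \<bullet> (x - y) + M * (norm (x - y))\<^sup>2"
          using M(2)[of x y] x y by auto
        finally have "0 < (g \<bullet> (x - y) + M * (norm (x - y))\<^sup>2) / norm g" using g by (intro divide_pos_pos) auto
        also have "\<dots> = (1 / norm g) *\<^sub>R g \<bullet> (x - y) + M * (norm (x - y))\<^sup>2 / norm g"
          by (simp add: add_divide_distrib)
        also have "M * (norm (x - y))\<^sup>2 / norm g \<le> (M + 1) * (norm (x - y))\<^sup>2"
        proof -
          have "M * (norm (x - y))\<^sup>2 / norm g \<le> M * (norm (x - y))\<^sup>2"
            using g \<open>M \<ge> 0\<close> divide_left_mono[of 1 "norm g" "M * (norm (x - y))\<^sup>2"] by fastforce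
          moreover have "(M + 1) * (norm (x - y))\<^sup>2 = M * (norm (x - y))\<^sup>2 + (norm (x - y))\<^sup>2"
            by (simp add: algebra_simps)
          ultimately show ?thesis using zero_le_power2[of "norm (x - y)"] by linarith
        qed
        finally show "0 < (1 / norm g) *\<^sub>R g \<bullet> (x - y) + (M + 1) * (norm (x - y))\<^sup>2" by simp
      qed
    qed
  qed (use r \<nu> L(1) M(1) contF in auto)
qed

text \<open>Charts provide the exterior quadric near the boundary point, with constants that are locally
  uniform; far from the point a large quadratic coefficient dominates the linear term. Compactness of
  the boundary makes the constant uniform.\<close>

lemma uniform_exterior_quadric:
  fixes \<Omega> :: "(real^'n) set"
  assumes "open \<Omega>" "bounded \<Omega>" "C2_boundary \<Omega>"
  obtains M where "M > 0"
    "\<And>y. y \<in> frontier \<Omega> \<Longrightarrow> \<exists>e. norm e = 1 \<and> (\<forall>x\<in>\<Omega>. 0 < exterior_quadric M e y x)"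
proof -
  define P where "P M y \<longleftrightarrow> (\<exists>e. norm e = 1 \<and> (\<forall>x\<in>\<Omega>. 0 < exterior_quadric M e y x))" for M and y :: "real^'n"
  have mono: "P M' y" if "P M y" "M \<le> M'" for M M' y
  proof -
    have "M * (norm (x - y))\<^sup>2 \<le> M' * (norm (x - y))\<^sup>2" for x using that(2) by (rule mult_right_mono) simp
    then show ?thesis using that(1) unfolding P_def by (meson add_left_mono less_le_trans)
  qed
  have "\<exists>r>0. \<exists>M. \<forall>y\<in>frontier \<Omega> \<inter> ball x\<^sub>0 r. P M y" if x0: "x\<^sub>0 \<in> frontier \<Omega>" for x\<^sub>0
  proof -
    obtain r M where r: "r > 0" and M: "M > 0" and ex: "\<forall>y\<in>frontier \<Omega> \<inter> ball x\<^sub>0 r.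
       \<exists>e. norm e = 1 \<and> (\<forall>x\<in>\<Omega> \<inter> ball x\<^sub>0 r. 0 < exterior_quadric M e y x)"
      by (rule C2_boundary_chart[OF assms(1,3) x0])
    \<comment> \<open>Points outside the chart have distance at least \<open>r / 2\<close> from \<open>y\<close>, where \<open>4 / r\<close> times the square exceeds the linear term.\<close>
    have "P (M + 4 / r) y" if y: "y \<in> frontier \<Omega> \<inter> ball x\<^sub>0 (r / 2)" for y
    proof -
      have "y \<in> ball x\<^sub>0 r" using y r by auto
      then obtain e where e: "norm e = 1" "\<And>x. x \<in> \<Omega> \<inter> ball x\<^sub>0 r \<Longrightarrow> 0 < exterior_quadric M e y x"
        using ex y by blast
      have "0 < exterior_quadric (M + 4 / r) e y x" if "x \<in> \<Omega>" for x
      proof (cases "x \<in> ball x\<^sub>0 r")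
        case True
        have "0 \<le> 4 / r * (norm (x - y))\<^sup>2" using r by simp
        then show ?thesis using e(2)[of x] that True by (simp add: distrib_right)
      next
        case False
        define s where "s = norm (x - y)"
        have s: "s \<ge> r / 2" using False y dist_triangle[of x\<^sub>0 x y] by (simp add: s_def dist_norm norm_minus_commute)
        then have "s > 0" using r by simp
        have "- s \<le> e \<bullet> (x - y)" using Cauchy_Schwarz_ineq2[of e "x - y"] e(1) by (simp add: s_def)
        moreover have "4 / r * s\<^sup>2 \<ge> 2 * s"
          using mult_left_mono[OF s, of "4 / r * s"] r \<open>s > 0\<close> by (simp add: power2_eq_square field_simps)
        moreover have "M * s\<^sup>2 \<ge> 0" using M by simp
        ultimately show ?thesis using \<open>s > 0\<close> by (simp add: distrib_right flip: s_def)
      qed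
      then show ?thesis using e(1) unfolding P_def by blast
    qed
    then show ?thesis using half_gt_zero[OF r] by blast
  qed
  then obtain r M where r: "\<And>x. x \<in> frontier \<Omega> \<Longrightarrow> r x > 0"
    and M: "\<And>x y. x \<in> frontier \<Omega> \<Longrightarrow> y \<in> frontier \<Omega> \<inter> ball x (r x) \<Longrightarrow> P (M x) y"
    by metis
  have "compact (frontier \<Omega>)" using assms(2) by (simp add: compact_frontier_bounded)
  then obtain C where C: "C \<subseteq> frontier \<Omega>" "finite C" "frontier \<Omega> \<subseteq> (\<Union>x\<in>C. ball x (r x))"
    by (rule compactE_image[of _ "frontier \<Omega>" "\<lambda>x. ball x (r x)"]) (use r in auto)
  have "P ((\<Sum>x\<in>C. \<bar>M x\<bar>) + 1) y" if y: "y \<in> frontier \<Omega>" for y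
  proof -
    obtain x where x: "x \<in> C" "y \<in> ball x (r x)" using C(3) y by blast
    have "\<bar>M x\<bar> \<le> (\<Sum>x\<in>C. \<bar>M x\<bar>)" using C(2) x(1) by (intro member_le_sum) auto
    then show ?thesis using mono[OF M[of x y], of "(\<Sum>x\<in>C. \<bar>M x\<bar>) + 1"] x C(1) y by auto
  qed
  moreover have "(\<Sum>x\<in>C. \<bar>M x\<bar>) + 1 > 0" by (simp add: sum_nonneg add_nonneg_pos)
  ultimately show ?thesis using that unfolding P_def by blast
qed

section \<open>Boundary layers and powers of the logarithmic distance\<close>

text \<open>The layer \<open>0 < F \<le> t\<close> and its translates by multiples of \<open>t \<nu>\<close> are disjoint, since they lie
  over disjoint ranges of values of \<open>F\<close>. About \<open>1 / t\<close> of them fit into a slightly larger ball.\<close>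

lemma measure_layer_le:
  fixes F :: "real^'n \<Rightarrow> real"
  assumes cont: "continuous_on UNIV F" and F: "\<And>x t. F (x + t *\<^sub>R \<nu>) = F x + t" and \<nu>: "norm \<nu> = 1"
    and t: "0 < t" "t \<le> 1"
  shows "{x \<in> ball x\<^sub>0 r. 0 < F x \<and> F x \<le> t} \<in> lmeasurable" (is "?S \<in> _")
    and "measure lebesgue {x \<in> ball x\<^sub>0 r. 0 < F x \<and> F x \<le> t} \<le> 2 * measure lebesgue (ball x\<^sub>0 (r + 1)) * t"
proof -
  have "?S = ball x\<^sub>0 r \<inter> ({x. 0 < F x} \<inter> {x. F x \<le> t})" by auto
  moreover have "{x. 0 < F x} \<inter> {x. F x \<le> t} \<in> sets borel"
    by (intro sets.Int borel_open borel_closed open_Collect_less closed_Collect_le continuous_intros cont)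
  then have "{x. 0 < F x} \<inter> {x. F x \<le> t} \<in> sets lebesgue" by (simp add: sets_completionI_sets)
  ultimately show S: "?S \<in> lmeasurable" by (metis fmeasurable_Int_fmeasurable lmeasurable_ball)
  \<comment> \<open>\<open>N\<close> translates shift by at most 1 in total, and \<open>N\<close> is at least \<open>1 / (2 t)\<close> as \<open>t \<le> 1\<close>.\<close>
  define N where "N = nat \<lfloor>1 / t\<rfloor>"
  have Nle: "real N \<le> 1 / t" using t by (simp add: N_def)
  have N1: "1 \<le> real N" and "1 / t < real N + 1" using t by (simp_all add: N_def le_nat_iff le_floor_iff)
  then have N2: "1 / t \<le> 2 * real N" by linarith
  define T where "T m = (+) ((real m * t) *\<^sub>R \<nu>) ` ?S" for m :: nat
  have T: "T m \<in> lmeasurable" "measure lebesgue (T m) = measure lebesgue ?S" for m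
    unfolding T_def by (intro measurable_translation S measure_translation)+
  have FT: "real m * t < F x \<and> F x \<le> (real m + 1) * t" if xT: "x \<in> T m" for m x
  proof -
    obtain y where y: "y \<in> ?S" "x = (real m * t) *\<^sub>R \<nu> + y" using xT unfolding T_def by blast
    then have "F x = F y + real m * t" using F[of y "real m * t"] by (simp add: add.commute)
    then show ?thesis using y by (simp add: algebra_simps)
  qed
  have disj: "disjoint_family_on T {..<N}"
    unfolding disjoint_family_on_def
  proof (intro ballI impI)
    fix k m assume "k \<in> {..<N}" "m \<in> {..<N}" "k \<noteq> m"
    have aux: "T k \<inter> T m = {}" if "k < m" for k m
    proof -
      have "(real k + 1) * t \<le> real m * t" using that t by (intro mult_right_mono) auto
      then show ?thesis using FT[of _ k] FT[of _ m] by fastforce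
    qed
    show "T k \<inter> T m = {}" using aux[of k m] aux[of m k] \<open>k \<noteq> m\<close> by (cases "k < m") auto
  qed
  have "real N * measure lebesgue ?S = (\<Sum>m<N. measure lebesgue (T m))" by (simp add: T)
  also have "\<dots> = measure lebesgue (\<Union>m<N. T m)"
  proof (rule measure_finite_Union[symmetric])
    show "T ` {..<N} \<subseteq> sets lebesgue" using fmeasurableD[OF T(1)] by blast
    show "emeasure lebesgue (T m) \<noteq> \<infinity>" for m using fmeasurableD2[OF T(1)] by simp
  qed (use disj in simp_all)
  also have "\<dots> \<le> measure lebesgue (ball x\<^sub>0 (r + 1))"
  proof (rule measure_mono_fmeasurable)
    show "(\<Union>m<N. T m) \<in> sets lebesgue" using T(1) by (intro sets.finite_UN) (auto simp: fmeasurableD)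
    have "x \<in> ball x\<^sub>0 (r + 1)" if xT: "x \<in> T m" and mN: "m < N" for m x
    proof -
      obtain y where y: "y \<in> ?S" "x = (real m * t) *\<^sub>R \<nu> + y" using xT unfolding T_def by blast
      have "real m * t \<le> real N * t" using mN t by (intro mult_right_mono) auto
      also have "\<dots> \<le> 1" using Nle t by (simp add: field_simps)
      finally have "dist y x \<le> 1" using y t \<nu> by (simp add: dist_norm)
      then show ?thesis using y dist_triangle[of x\<^sub>0 x y] by simp
    qed
    then show "(\<Union>m<N. T m) \<subseteq> ball x\<^sub>0 (r + 1)" by blast
  qed simp
  finally have V: "real N * measure lebesgue ?S \<le> measure lebesgue (ball x\<^sub>0 (r + 1))" .
  have "1 \<le> 2 * real N * t" using N2 t by (simp add: field_simps)
  then have "1 * measure lebesgue ?S \<le> (2 * real N * t) * measure lebesgue ?S"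
    by (rule mult_right_mono) simp
  also have "\<dots> = 2 * t * (real N * measure lebesgue ?S)" by simp
  also have "\<dots> \<le> 2 * t * measure lebesgue (ball x\<^sub>0 (r + 1))" using V t by (intro mult_left_mono) auto
  finally show "measure lebesgue ?S \<le> 2 * measure lebesgue (ball x\<^sub>0 (r + 1)) * t" by (simp add: mult_ac)
qed

lemma boundary_layer_lmeasurable:
  fixes \<Omega> :: "(real^'n) set"
  assumes "open \<Omega>" "bounded \<Omega>"
  shows "{x \<in> \<Omega>. infdist x (frontier \<Omega>) < t} \<in> lmeasurable"
proof -
  have "{x \<in> \<Omega>. infdist x (frontier \<Omega>) < t} = \<Omega> \<inter> {x. infdist x (frontier \<Omega>) < t}" by blast
  moreover have "open {x. infdist x (frontier \<Omega>) < t}"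
    by (intro open_Collect_less continuous_intros)
  ultimately show ?thesis
    using assms by (simp add: lmeasurable_open open_Int bounded_Int)
qed

text \<open>In a chart, \<open>F\<close> vanishes on the boundary and is Lipschitz, so points at distance less than \<open>t\<close> from
  the boundary lie in a layer \<open>0 < F \<le> \<Lambda> t\<close>. Finitely many charts cover the boundary.\<close>

lemma boundary_layer_volume:
  fixes \<Omega> :: "(real^'n) set"
  assumes "open \<Omega>" "bounded \<Omega>" "C2_boundary \<Omega>" "frontier \<Omega> \<noteq> {}"
  obtains C where "C \<ge> 0" "\<And>t. t > 0 \<Longrightarrow> measure lebesgue {x \<in> \<Omega>. infdist x (frontier \<Omega>) < t} \<le> C * t"
proof -
  define thin where "thin x\<^sub>0 r V t \<longleftrightarrow> (\<exists>S\<in>lmeasurable. measure lebesgue S \<le> V * t \<and>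
           {x \<in> \<Omega>. \<exists>y\<in>frontier \<Omega> \<inter> ball x\<^sub>0 r. dist x y < t} \<subseteq> S)" for x\<^sub>0 r V t
  have "\<exists>r V t0. r > 0 \<and> t0 > 0 \<and> (\<forall>t. 0 < t \<and> t \<le> t0 \<longrightarrow> thin x\<^sub>0 r V t)" if x0: "x\<^sub>0 \<in> frontier \<Omega>" for x\<^sub>0
  proof -
    obtain r \<nu> F \<Lambda> where r: "r > 0" and \<nu>: "norm \<nu> = 1" and \<Lambda>: "\<Lambda> > 0" and cont: "continuous_on UNIV F"
      and F: "\<forall>x t. F (x + t *\<^sub>R \<nu>) = F x + t"
      and Lip: "\<forall>x\<in>ball x\<^sub>0 r. \<forall>y\<in>ball x\<^sub>0 r. \<bar>F x - F y\<bar> \<le> \<Lambda> * norm (x - y)"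
      and pos: "\<forall>x\<in>\<Omega> \<inter> ball x\<^sub>0 r. F x > 0" and zero: "\<forall>x\<in>frontier \<Omega> \<inter> ball x\<^sub>0 r. F x = 0"
      by (rule C2_boundary_chart[OF assms(1,3) x0])
    define V where "V = 2 * measure lebesgue (ball x\<^sub>0 (r + 1)) * \<Lambda>"
    \<comment> \<open>The first bound keeps the points inside the chart, the second one makes \<open>\<Lambda> t \<le> 1\<close>.\<close>
    define t0 where "t0 = min (r / 2) (1 / \<Lambda>)"
    have "thin x\<^sub>0 (r / 2) V t" if t: "0 < t" "t \<le> t0" for t
      unfolding thin_def
    proof (intro bexI conjI)
      let ?S = "{x \<in> ball x\<^sub>0 r. 0 < F x \<and> F x \<le> \<Lambda> * t}"
      have "\<Lambda> * t \<le> \<Lambda> * (1 / \<Lambda>)" using t \<Lambda> by (intro mult_left_mono) (auto simp: t0_def)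
      then have t': "0 < \<Lambda> * t" "\<Lambda> * t \<le> 1" using t \<Lambda> by auto
      show "?S \<in> lmeasurable" by (rule measure_layer_le(1)[OF cont F[rule_format] \<nu> t'])
      show "measure lebesgue ?S \<le> V * t"
        using measure_layer_le(2)[OF cont F[rule_format] \<nu> t', of x\<^sub>0 r] by (simp add: V_def mult.assoc)
      show "{x \<in> \<Omega>. \<exists>y\<in>frontier \<Omega> \<inter> ball x\<^sub>0 (r / 2). dist x y < t} \<subseteq> ?S"
      proof
        fix x assume "x \<in> {x \<in> \<Omega>. \<exists>y\<in>frontier \<Omega> \<inter> ball x\<^sub>0 (r / 2). dist x y < t}"
        then obtain y where x: "x \<in> \<Omega>" and y: "y \<in> frontier \<Omega>" "dist x\<^sub>0 y < r / 2" "dist x y < t" by auto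
        have yb: "y \<in> ball x\<^sub>0 r" using y(2) r by simp
        have xb: "x \<in> ball x\<^sub>0 r"
          using y(2,3) t dist_triangle[of x\<^sub>0 x y] by (simp add: t0_def dist_commute)
        have "\<bar>F x - F y\<bar> \<le> \<Lambda> * norm (x - y)" using Lip xb yb by blast
        also have "\<dots> \<le> \<Lambda> * t" using y(3) \<Lambda> by (intro mult_left_mono) (auto simp: dist_norm)
        finally have "F x \<le> \<Lambda> * t" using zero y(1) yb by auto
        then show "x \<in> ?S" using pos x xb by auto
      qed
    qed
    moreover have "r / 2 > 0" "t0 > 0" using r \<Lambda> by (simp_all add: t0_def)
    ultimately show ?thesis by blast
  qed
  then obtain r V t0 where r: "\<And>x. x \<in> frontier \<Omega> \<Longrightarrow> r x > 0" and t0: "\<And>x. x \<in> frontier \<Omega> \<Longrightarrow> t0 x > 0"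
    and S: "\<And>x t. x \<in> frontier \<Omega> \<Longrightarrow> 0 < t \<Longrightarrow> t \<le> t0 x \<Longrightarrow> thin x (r x) (V x) t"
    by metis
  have "compact (frontier \<Omega>)" using assms(2) by (simp add: compact_frontier_bounded)
  then obtain K where K: "K \<subseteq> frontier \<Omega>" "finite K" "frontier \<Omega> \<subseteq> (\<Union>x\<in>K. ball x (r x))"
    by (rule compactE_image[of _ "frontier \<Omega>" "\<lambda>x. ball x (r x)"]) (use r in auto)
  have "K \<noteq> {}" using K(3) assms(4) by auto
  define \<tau> where "\<tau> = Min (t0 ` K)"
  have \<tau>: "\<tau> > 0" "\<And>x. x \<in> K \<Longrightarrow> \<tau> \<le> t0 x"
    using K t0 \<open>K \<noteq> {}\<close> by (auto simp: \<tau>_def)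
  define A where "A t = {x \<in> \<Omega>. infdist x (frontier \<Omega>) < t}" for t
  have A: "A t \<in> lmeasurable" for t unfolding A_def by (rule boundary_layer_lmeasurable[OF assms(1,2)])
  have \<Omega>: "\<Omega> \<in> lmeasurable" using assms(1,2) by (simp add: lmeasurable_open)
  define C where "C = (\<Sum>x\<in>K. \<bar>V x\<bar>) + measure lebesgue \<Omega> / \<tau>"
  have small: "measure lebesgue (A t) \<le> (\<Sum>x\<in>K. \<bar>V x\<bar>) * t" if t: "0 < t" "t \<le> \<tau>" for t
  proof -
    have "thin x (r x) (V x) t" if "x \<in> K" for x
      using S[of x t] t \<tau>(2)[OF that] K(1) that by auto
    then have "\<forall>x\<in>K. \<exists>S. S \<in> lmeasurable \<and> measure lebesgue S \<le> V x * t \<and>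
           {z \<in> \<Omega>. \<exists>y\<in>frontier \<Omega> \<inter> ball x (r x). dist z y < t} \<subseteq> S"
      unfolding thin_def Bex_def by (intro ballI)
    from bchoice[OF this] obtain B where "\<forall>x\<in>K. B x \<in> lmeasurable \<and> measure lebesgue (B x) \<le> V x * t \<and>
           {z \<in> \<Omega>. \<exists>y\<in>frontier \<Omega> \<inter> ball x (r x). dist z y < t} \<subseteq> B x"
      by (elim exE)
    then have B: "B x \<in> lmeasurable" "measure lebesgue (B x) \<le> V x * t"
       "{z \<in> \<Omega>. \<exists>y\<in>frontier \<Omega> \<inter> ball x (r x). dist z y < t} \<subseteq> B x" if "x \<in> K" for x
      using that by (simp_all only:)
    have "A t \<subseteq> (\<Union>x\<in>K. B x)"
    proof
      fix z assume z: "z \<in> A t"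
      obtain y where y: "y \<in> frontier \<Omega>" "infdist z (frontier \<Omega>) = dist z y"
        using infdist_attains_inf[OF frontier_closed assms(4)] by blast
      obtain x where x: "x \<in> K" "y \<in> ball x (r x)" using K(3) y(1) by blast
      have "z \<in> {z \<in> \<Omega>. \<exists>y\<in>frontier \<Omega> \<inter> ball x (r x). dist z y < t}"
        using z y x(2) by (auto simp: A_def)
      then show "z \<in> (\<Union>x\<in>K. B x)" using B(3)[OF x(1)] x(1) by blast
    qed
    then have "measure lebesgue (A t) \<le> measure lebesgue (\<Union>x\<in>K. B x)"
      using A B(1) K(2) by (intro measure_mono_fmeasurable fmeasurable.finite_UN) (auto simp: fmeasurableD)
    also have "\<dots> \<le> (\<Sum>x\<in>K. measure lebesgue (B x))"
      using B(1) K(2) by (intro measure_UNION_le) (auto simp: fmeasurableD)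
    also have "\<dots> \<le> (\<Sum>x\<in>K. \<bar>V x\<bar> * t)"
    proof (rule sum_mono)
      fix x assume "x \<in> K"
      have "V x * t \<le> \<bar>V x\<bar> * t" using t by (intro mult_right_mono) auto
      then show "measure lebesgue (B x) \<le> \<bar>V x\<bar> * t" using B(2)[OF \<open>x \<in> K\<close>] by linarith
    qed
    finally show ?thesis by (simp add: sum_distrib_right)
  qed
  show ?thesis
  proof (rule that[of C])
    show "C \<ge> 0" using \<tau> by (auto simp: C_def intro!: add_nonneg_nonneg sum_nonneg)
    fix t :: real assume "t > 0"
    show "measure lebesgue {x \<in> \<Omega>. infdist x (frontier \<Omega>) < t} \<le> C * t"
    proof (cases "t \<le> \<tau>")
      case True
      have "0 \<le> measure lebesgue \<Omega> / \<tau> * t" using \<tau> \<open>t > 0\<close> by simp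
      then show ?thesis using small[OF \<open>t > 0\<close> True] by (simp add: A_def C_def distrib_right)
    next
      case False
      have "measure lebesgue (A t) \<le> measure lebesgue \<Omega>"
        using A \<Omega> by (intro measure_mono_fmeasurable) (auto simp: A_def fmeasurableD)
      also have "\<dots> \<le> measure lebesgue \<Omega> / \<tau> * t"
        using False \<tau>(1) mult_right_mono[of \<tau> t "measure lebesgue \<Omega>"] by (simp add: field_simps)
      also have "0 \<le> (\<Sum>x\<in>K. \<bar>V x\<bar>) * t" using \<open>t > 0\<close> by (simp add: sum_nonneg)
      ultimately show ?thesis by (simp add: A_def C_def distrib_right)
    qed
  qed
qed

text \<open>On the dyadic shell where the distance lies between \<open>2\<^sup>-\<^sup>(\<^sup>j\<^sup>+\<^sup>1\<^sup>)\<close> and \<open>2\<^sup>-\<^sup>j\<close> the \<open>p\<close>-th power of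
  \<open>1 + \<bar>ln d\<bar>\<close> is at most \<open>(j + 2)\<^sup>p\<close>, while the volume of the shell is of order \<open>2\<^sup>-\<^sup>j\<close>; the resulting series
  converges.\<close>

lemma Lp_on_log_infdist:
  fixes \<Omega> :: "(real^'n) set"
  assumes "open \<Omega>" "bounded \<Omega>" "C2_boundary \<Omega>" "frontier \<Omega> \<noteq> {}" "p \<ge> 1" "c \<ge> 0"
  shows "Lp_on \<Omega> p (\<lambda>x. c * (1 + \<bar>ln (infdist x (frontier \<Omega>))\<bar>))"
proof -
  define d where "d x = infdist x (frontier \<Omega>)" for x
  define g where "g x = 1 + \<bar>ln (d x)\<bar>" for x
  have d_pos: "d x > 0" if "x \<in> \<Omega>" for x
  proof -
    have "x \<notin> frontier \<Omega>" using that assms(1) by (simp add: frontier_def interior_open)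
    then show ?thesis using assms(4) infdist_pos_not_in_closed[OF frontier_closed] by (simp add: d_def)
  qed
  have \<Omega>_meas: "\<Omega> \<in> sets lebesgue" using assms(1) by (simp add: borel_open)
  have "continuous_on \<Omega> d" unfolding d_def by (intro continuous_intros)
  then have cont: "continuous_on \<Omega> g" unfolding g_def
  proof (intro continuous_intros ballI)
    show "d x \<noteq> 0" if "x \<in> \<Omega>" for x using d_pos[OF that] by simp
  qed
  have "continuous_on \<Omega> (\<lambda>x. g x powr p)" using cont by (intro continuous_intros) (auto simp: g_def)
  then have meas: "(\<lambda>x. g x powr p) \<in> borel_measurable (lebesgue_on \<Omega>)"
    using \<Omega>_meas by (rule continuous_imp_measurable_on_sets_lebesgue)
  obtain C where C: "C \<ge> 0" "\<And>t. t > 0 \<Longrightarrow> measure lebesgue {x \<in> \<Omega>. d x < t} \<le> C * t"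
    using boundary_layer_volume[OF assms(1-4)] unfolding d_def by blast
  define A where "A k = {x \<in> \<Omega>. d x < (1/2) ^ k}" for k
  have A_lm: "A k \<in> lmeasurable" for k
    unfolding A_def d_def by (rule boundary_layer_lmeasurable[OF assms(1,2)])
  then have A_sets: "A k \<in> sets (lebesgue_on \<Omega>)" for k
    using \<Omega>_meas by (auto simp: sets_restrict_space_iff A_def fmeasurableD)
  note A_sets[measurable]
  have emA: "emeasure (lebesgue_on \<Omega>) (A k) \<le> ennreal (C * (1/2) ^ k)" for k
  proof -
    have "emeasure (lebesgue_on \<Omega>) (A k) = emeasure lebesgue (A k)"
      using \<Omega>_meas by (intro emeasure_restrict_space) (auto simp: A_def)
    also have "\<dots> = ennreal (measure lebesgue (A k))" using A_lm by (simp add: emeasure_eq_measure2)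
    also have "\<dots> \<le> ennreal (C * (1/2) ^ k)" using C(2)[of "(1/2) ^ k"] by (intro ennreal_leI) (simp add: A_def)
    finally show ?thesis .
  qed
  obtain D where D: "\<And>x. x \<in> \<Omega> \<Longrightarrow> d x \<le> D"
  proof -
    obtain y0 where y0: "y0 \<in> frontier \<Omega>" using assms(4) by blast
    obtain B where B: "\<And>x. x \<in> \<Omega> \<Longrightarrow> norm x \<le> B" using assms(2) unfolding bounded_iff by blast
    have "d x \<le> B + norm y0" if "x \<in> \<Omega>" for x
    proof -
      have "d x \<le> dist x y0" unfolding d_def using y0 by (rule infdist_le)
      also have "\<dots> \<le> norm x + norm y0" by (simp add: dist_norm norm_triangle_ineq4)
      finally show ?thesis using B[OF that] by simp
    qed
    then show ?thesis using that by blast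
  qed
  define E where "E = (1 + \<bar>ln (max D 1)\<bar>) powr p"
  define a where "a k = (real k + 2) powr p" for k
  have bound: "ennreal (g x powr p) \<le> ennreal E + (\<Sum>k. ennreal (a k) * indicator (A k) x)" if x: "x \<in> \<Omega>" for x
  proof (cases "d x \<ge> 1")
    case True
    have "ln (d x) \<le> ln (max D 1)" using True D[OF x] by (intro ln_mono) auto
    then have "g x \<le> 1 + \<bar>ln (max D 1)\<bar>" using True by (simp add: g_def)
    then have "g x powr p \<le> E" unfolding E_def using assms(5) by (intro powr_mono2) (auto simp: g_def)
    then have "ennreal (g x powr p) \<le> ennreal E" by (rule ennreal_leI)
    then show ?thesis by (simp add: add_increasing2)
  next
    case False
    have "\<exists>k. (1/2) ^ k \<le> d x"
      using real_arch_pow_inv[OF d_pos[OF x], of "1/2"] by (auto intro: less_imp_le)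
    \<comment> \<open>The distance of \<open>x\<close> lies in the shell with index \<open>j = k - 1\<close>.\<close>
    define k where "k = (LEAST k. (1/2) ^ k \<le> d x)"
    have k1: "(1/2) ^ k \<le> d x" unfolding k_def using \<open>\<exists>k. (1/2) ^ k \<le> d x\<close> by (rule LeastI_ex)
    then have "k \<noteq> 0" using False by (cases k) auto
    then obtain j where j: "k = Suc j" by (cases k) auto
    have "\<not> (1/2) ^ j \<le> d x" using not_less_Least[of j "\<lambda>k. (1/2) ^ k \<le> d x"] j by (simp add: k_def)
    then have xA: "x \<in> A j" using x by (simp add: A_def)
    have "- ln (d x) \<le> real k"
    proof -
      have "ln ((1/2) ^ k) \<le> ln (d x)" using k1 d_pos[OF x] by (intro ln_mono) auto
      then have "- ln (d x) \<le> real k * ln 2" by (simp add: ln_realpow ln_div)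
      also have "\<dots> \<le> real k * 1" using ln_2_less_1 by (intro mult_left_mono) auto
      finally show ?thesis by simp
    qed
    moreover have "ln (d x) \<le> 0" using False d_pos[OF x] by simp
    ultimately have "g x \<le> real j + 2" by (simp add: g_def j)
    then have "g x powr p \<le> a j" unfolding a_def using assms(5) by (intro powr_mono2) (auto simp: g_def)
    then have "ennreal (g x powr p) \<le> ennreal (a j) * indicator (A j) x" using xA by (simp add: ennreal_leI)
    also have "\<dots> \<le> (\<Sum>k. ennreal (a k) * indicator (A k) x)"
    proof -
      define T where "T k = ennreal (a k) * indicator (A k) x" for k
      have "sum T {j} \<le> suminf T" by (rule sum_le_suminf) auto
      then show ?thesis by (simp only: T_def[abs_def] sum.insert sum.empty finite.emptyI add_0_right empty_iff not_False_eq_True)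
    qed
    finally show ?thesis by (simp add: add_increasing)
  qed
  have "(\<integral>\<^sup>+x. ennreal (g x powr p) \<partial>lebesgue_on \<Omega>) < \<infinity>"
  proof -
    have "(\<integral>\<^sup>+x. ennreal (g x powr p) \<partial>lebesgue_on \<Omega>) \<le>
        (\<integral>\<^sup>+x. ennreal E + (\<Sum>k. ennreal (a k) * indicator (A k) x) \<partial>lebesgue_on \<Omega>)"
      using bound by (intro nn_integral_mono) simp
    also have "\<dots> = (\<integral>\<^sup>+x. ennreal E \<partial>lebesgue_on \<Omega>) + (\<integral>\<^sup>+x. (\<Sum>k. ennreal (a k) * indicator (A k) x) \<partial>lebesgue_on \<Omega>)"
      by (intro nn_integral_add) measurable
    also have "(\<integral>\<^sup>+x. (\<Sum>k. ennreal (a k) * indicator (A k) x) \<partial>lebesgue_on \<Omega>) =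
        (\<Sum>k. \<integral>\<^sup>+x. ennreal (a k) * indicator (A k) x \<partial>lebesgue_on \<Omega>)"
      by (intro nn_integral_suminf) measurable
    also have "(\<Sum>k. \<integral>\<^sup>+x. ennreal (a k) * indicator (A k) x \<partial>lebesgue_on \<Omega>) \<le> (\<Sum>k. ennreal (a k * (C * (1/2) ^ k)))"
    proof (rule suminf_le)
      show "(\<integral>\<^sup>+x. ennreal (a k) * indicator (A k) x \<partial>lebesgue_on \<Omega>) \<le> ennreal (a k * (C * (1/2) ^ k))" for k
        using mult_left_mono[OF emA[of k], of "ennreal (a k)"] C(1)
        by (simp add: nn_integral_cmult_indicator A_sets ennreal_mult a_def)
    qed auto
    finally have le: "(\<integral>\<^sup>+x. ennreal (g x powr p) \<partial>lebesgue_on \<Omega>) \<le>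
        (\<integral>\<^sup>+x. ennreal E \<partial>lebesgue_on \<Omega>) + (\<Sum>k. ennreal (a k * (C * (1/2) ^ k)))"
      by (simp add: add_left_mono)
    have "summable (\<lambda>k. a k * (1/2) ^ k)"
    proof (rule summable_comparison_test_bigo)
      show "summable (\<lambda>k. norm ((3/4 :: real) ^ k))" by (simp add: summable_geometric)
      show "(\<lambda>k. a k * (1/2) ^ k) \<in> O(\<lambda>k. (3/4) ^ k)" unfolding a_def by real_asymp
    qed
    then have "summable (\<lambda>k. C * (a k * (1/2) ^ k))" by (rule summable_mult)
    then have "summable (\<lambda>k. a k * (C * (1/2) ^ k))" by (simp add: mult.left_commute)
    then have "(\<Sum>k. ennreal (a k * (C * (1/2) ^ k))) \<noteq> top"
      by (rule ennreal_suminf_neq_top) (use C(1) in \<open>simp add: a_def\<close>)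
    moreover have "(\<integral>\<^sup>+x. ennreal E \<partial>lebesgue_on \<Omega>) < top"
    proof -
      have "\<Omega> \<in> lmeasurable" using assms(1,2) by (simp add: lmeasurable_open)
      then have fin: "emeasure lebesgue \<Omega> < top" unfolding fmeasurable_def infinity_ennreal_def by blast
      have "emeasure (lebesgue_on \<Omega>) \<Omega> = emeasure lebesgue \<Omega>"
        using \<Omega>_meas by (intro emeasure_restrict_space) auto
      with fin have "emeasure (lebesgue_on \<Omega>) \<Omega> < top" by (simp only:)
      then show ?thesis by (simp add: ennreal_mult_less_top space_restrict_space)
    qed
    ultimately have "(\<integral>\<^sup>+x. ennreal E \<partial>lebesgue_on \<Omega>) + (\<Sum>k. ennreal (a k * (C * (1/2) ^ k))) < top"
      by (simp add: less_top[symmetric])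
    then show ?thesis unfolding infinity_ennreal_def by (rule le_less_trans[OF le])
  qed
  then have int: "integrable (lebesgue_on \<Omega>) (\<lambda>x. g x powr p)"
    by (intro integrableI_nonneg meas) auto
  have eq: "norm (c * (1 + \<bar>ln (infdist x (frontier \<Omega>))\<bar>)) powr p = c powr p * g x powr p" for x
    using assms(6) by (simp add: g_def d_def abs_mult powr_mult)
  show ?thesis unfolding Lp_on_def eq
  proof
    have "continuous_on \<Omega> (\<lambda>x. c * g x)" using cont by (intro continuous_intros)
    then show "(\<lambda>x. c * (1 + \<bar>ln (infdist x (frontier \<Omega>))\<bar>)) \<in> borel_measurable (lebesgue_on \<Omega>)"
      using continuous_imp_measurable_on_sets_lebesgue[OF _ \<Omega>_meas] by (simp add: g_def d_def)
    show "integrable (lebesgue_on \<Omega>) (\<lambda>x. c powr p * g x powr p)" using int by simp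
  qed
qed

section \<open>The gradient bound up to the boundary\<close>

lemma harmonic_abs_le_frontier:
  fixes u :: "real^'n \<Rightarrow> real"
  assumes "open \<Omega>" "bounded \<Omega>" "Ck_on 2 \<Omega> u" "continuous_on (closure \<Omega>) u"
    and harm: "\<And>x. x \<in> \<Omega> \<Longrightarrow> laplacian u x = 0"
    and bd: "\<And>x. x \<in> frontier \<Omega> \<Longrightarrow> \<bar>u x\<bar> \<le> \<epsilon>" and "x \<in> closure \<Omega>"
  shows "\<bar>u x\<bar> \<le> \<epsilon>"
proof -
  have lap: "has_laplacian u y 0" if "y \<in> \<Omega>" for y
    using Ck_on_2_has_laplacian[OF assms(1,3) that] harm[OF that] by simp
  have "u x \<le> \<epsilon>"
    using lap bd by (intro maximum_principle[OF assms(1,2,4) _ _ assms(7)]) force+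
  moreover have "- u x \<le> \<epsilon>"
  proof (rule maximum_principle[OF assms(1,2) _ _ _ assms(7)])
    show "continuous_on (closure \<Omega>) (\<lambda>x. - u x)" using assms(4) by (intro continuous_intros)
    show "\<exists>l\<ge>0. has_laplacian (\<lambda>x. - u x) y l" if "y \<in> \<Omega>" for y
      using has_laplacian_cmult[OF lap[OF that], of "-1"] by auto
    show "- u y \<le> \<epsilon>" if "y \<in> frontier \<Omega>" for y using bd[OF that] by linarith
  qed
  ultimately show ?thesis by linarith
qed

lemma dirichlet_diff_le:
  fixes u v :: "real^'n \<Rightarrow> real"
  assumes "open \<Omega>" "bounded \<Omega>" "solves_dirichlet \<Omega> g u" "solves_dirichlet \<Omega> h v"
    and "\<And>x. x \<in> frontier \<Omega> \<Longrightarrow> \<bar>g x - h x\<bar> \<le> \<epsilon>" and "x \<in> closure \<Omega>"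
  shows "\<bar>u x - v x\<bar> \<le> \<epsilon>"
proof (rule harmonic_abs_le_frontier[OF assms(1,2) _ _ _ _ assms(6)])
  have C: "Ck_on 2 \<Omega> u" "Ck_on 2 \<Omega> v" and c: "continuous_on (closure \<Omega>) u" "continuous_on (closure \<Omega>) v"
    and l: "\<forall>x\<in>\<Omega>. laplacian u x = 0" "\<forall>x\<in>\<Omega>. laplacian v x = 0"
    and f: "\<forall>x\<in>frontier \<Omega>. u x = g x" "\<forall>x\<in>frontier \<Omega>. v x = h x"
    using assms(3,4) unfolding solves_dirichlet_def by simp_all
  show "Ck_on 2 \<Omega> (\<lambda>x. u x - v x)" by (intro Ck_on_diff C assms(1))
  show "continuous_on (closure \<Omega>) (\<lambda>x. u x - v x)" by (intro continuous_intros c)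
  show "laplacian (\<lambda>x. u x - v x) x = 0" if "x \<in> \<Omega>" for x
    using laplacian_diff[OF assms(1) C that] l that by simp
  show "\<bar>u x - v x\<bar> \<le> \<epsilon>" if "x \<in> frontier \<Omega>" for x using assms(5)[OF that] f that by simp
qed

lemma ball_infdist_frontier_subset:
  fixes x :: "'a::real_normed_vector"
  assumes "x \<in> \<Omega>"
  shows "ball x (infdist x (frontier \<Omega>)) \<subseteq> \<Omega>"
proof (rule ccontr)
  let ?B = "ball x (infdist x (frontier \<Omega>))"
  assume no: "\<not> ?thesis"
  have "0 < infdist x (frontier \<Omega>)"
  proof (rule ccontr)
    assume "\<not> 0 < infdist x (frontier \<Omega>)"
    then have "?B = {}" by simp
    then have "?B \<subseteq> \<Omega>" by (simp only: empty_subsetI)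
    then show False using no by blast
  qed
  then have "x \<in> ?B" by simp
  then have 1: "?B \<inter> \<Omega> \<noteq> {}" and 2: "?B - \<Omega> \<noteq> {}" using assms no by blast+
  obtain y where "y \<in> ?B" "y \<in> frontier \<Omega>"
    using connected_Int_frontier[OF connected_ball 1 2] by blast
  then show False using infdist_le[of y "frontier \<Omega>" x] by simp
qed

text \<open>Let \<open>y\<close> be a boundary point nearest to \<open>x\<close>, at distance \<open>d\<close>. Comparison with \<open>L\<close> times the barrier
  at \<open>y\<close> bounds \<open>u - g y\<close> on the ball of radius \<open>d / 2\<close> around \<open>x\<close>, all of whose points have distance
  at most \<open>2 d\<close> from \<open>y\<close>; then the interior gradient estimate applies on this ball.\<close>

lemma gradient_bound_log:
  fixes \<Omega> :: "(real^'n) set"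
  assumes "open \<Omega>" "bounded \<Omega>" "C2_boundary \<Omega>" "frontier \<Omega> \<noteq> {}"
  obtains c where "c > 0"
    "\<forall>L g u. 0 \<le> L \<and> (\<forall>y\<in>frontier \<Omega>. \<forall>z\<in>frontier \<Omega>. \<bar>g y - g z\<bar> \<le> L * norm (y - z)) \<and>
       solves_dirichlet \<Omega> g u \<longrightarrow>
       (\<forall>x\<in>\<Omega>. norm (gradient u x) \<le> L * (c * (1 + \<bar>ln (infdist x (frontier \<Omega>))\<bar>)))"
proof -
  obtain M where M: "M > 0" and ext: "\<And>y. y \<in> frontier \<Omega> \<Longrightarrow>
      \<exists>e. norm e = 1 \<and> (\<forall>x\<in>\<Omega>. 0 < exterior_quadric M e y x)"
    using uniform_exterior_quadric[OF assms(1-3)] by blast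
  have "bounded (closure \<Omega>)" using assms(2) by (rule bounded_closure)
  then obtain B where B: "B > 0" "\<And>y. y \<in> closure \<Omega> \<Longrightarrow> norm y \<le> B" unfolding bounded_pos by blast
  define D where "D = 2 * B"
  have D: "D > 0" using B by (simp add: D_def)
  have diam: "norm (y - z) \<le> D" if "y \<in> closure \<Omega>" "z \<in> closure \<Omega>" for y z
    using B(2)[OF that(1)] B(2)[OF that(2)] norm_triangle_ineq4[of y z] by (simp add: D_def)
  obtain K where K: "K > 0" and bar: "\<forall>(y::real^'n) e. norm e = 1 \<longrightarrow> (\<exists>W. is_log_barrier M D K e y W)"
    by (rule log_barrier_exists[OF M D])
  define n where "n = real CARD('n)"
  have n: "n > 0" by (simp add: n_def)
  show ?thesis
  proof (rule that[of "2 * n * n * K"])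
    show "0 < 2 * n * n * K" using n K by simp
    show "\<forall>L g u. 0 \<le> L \<and> (\<forall>y\<in>frontier \<Omega>. \<forall>z\<in>frontier \<Omega>. \<bar>g y - g z\<bar> \<le> L * norm (y - z)) \<and>
       solves_dirichlet \<Omega> g u \<longrightarrow>
       (\<forall>x\<in>\<Omega>. norm (gradient u x) \<le> L * ((2 * n * n * K) * (1 + \<bar>ln (infdist x (frontier \<Omega>))\<bar>)))"
    proof (intro allI impI ballI, elim conjE)
      fix L :: real and g u :: "real^'n \<Rightarrow> real" and x
      assume L: "L \<ge> 0" and Lip0: "\<forall>y\<in>frontier \<Omega>. \<forall>z\<in>frontier \<Omega>. \<bar>g y - g z\<bar> \<le> L * norm (y - z)"
        and u: "solves_dirichlet \<Omega> g u" and x: "x \<in> \<Omega>"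
      have Lip: "\<bar>g y - g z\<bar> \<le> L * norm (y - z)" if "y \<in> frontier \<Omega>" "z \<in> frontier \<Omega>" for y z
        using Lip0 that by blast
      have C: "Ck_on 2 \<Omega> u" and cu: "continuous_on (closure \<Omega>) u" and lapu: "\<And>y. y \<in> \<Omega> \<Longrightarrow> laplacian u y = 0"
        and ug: "\<And>y. y \<in> frontier \<Omega> \<Longrightarrow> u y = g y"
        using u unfolding solves_dirichlet_def by simp_all
      define d where "d = infdist x (frontier \<Omega>)"
      obtain x0 where x0: "x0 \<in> frontier \<Omega>" "d = dist x x0"
        using infdist_attains_inf[OF frontier_closed assms(4)] unfolding d_def by blast
      have "x \<noteq> x0" using x x0(1) assms(1) by (auto simp: frontier_def interior_open)
      then have d: "d > 0" using x0(2) by simp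
      obtain e where e: "norm e = 1" and epos: "\<forall>x\<in>\<Omega>. 0 < exterior_quadric M e x0 x"
        using ext[OF x0(1)] by blast
      define q where "q y = exterior_quadric M e x0 y" for y
      have qpos: "0 < q y" if "y \<in> \<Omega>" for y using epos that by (simp add: q_def)
      have "closed {y. 0 \<le> q y}" unfolding q_def by (intro closed_Collect_le continuous_intros)
      then have qcl: "closure \<Omega> \<subseteq> {y. 0 \<le> q y}"
        by (rule closure_minimal[rotated]) (use qpos in \<open>force intro: less_imp_le\<close>)
      obtain W where Wc: "continuous_on {y. 0 \<le> q y} W" and W1: "\<And>y. 0 \<le> q y \<Longrightarrow> norm (y - x0) \<le> W y"
        and W2: "\<And>y. 0 < q y \<Longrightarrow> norm (y - x0) \<le> D \<Longrightarrow> \<exists>l\<le>0. has_laplacian W y l"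
        and W3: "\<And>y t. 0 \<le> q y \<Longrightarrow> norm (y - x0) \<le> D \<Longrightarrow> 0 < t \<Longrightarrow> norm (y - x0) \<le> 2 * t \<Longrightarrow> W y \<le> K * t * (1 + \<bar>ln t\<bar>)"
        using bar[rule_format, OF e, of x0] unfolding is_log_barrier_def q_def[symmetric] by blast
      have x0cl: "x0 \<in> closure \<Omega>" using x0(1) by (simp add: frontier_def)
      \<comment> \<open>Comparison for \<open>u - g x0\<close> and for its negative at once.\<close>
      have comp: "\<sigma> * (u y - g x0) \<le> L * W y" if \<sigma>: "\<sigma> = 1 \<or> \<sigma> = -1" and y: "y \<in> closure \<Omega>" for \<sigma> y
      proof -
        have "\<sigma> * (u y - g x0) - L * W y \<le> 0"
        proof (rule maximum_principle[OF assms(1,2) _ _ _ y])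
          show "continuous_on (closure \<Omega>) (\<lambda>y. \<sigma> * (u y - g x0) - L * W y)"
            by (intro continuous_intros cu continuous_on_subset[OF Wc qcl])
          show "\<exists>l\<ge>0. has_laplacian (\<lambda>y. \<sigma> * (u y - g x0) - L * W y) z l" if z: "z \<in> \<Omega>" for z
          proof -
            have "z \<in> closure \<Omega>" using z closure_subset by blast
            then obtain l where l: "l \<le> 0" "has_laplacian W z l"
              using W2[OF qpos[OF z] diam[OF _ x0cl]] by blast
            have "has_laplacian u z 0" using Ck_on_2_has_laplacian[OF assms(1) C z] lapu[OF z] by simp
            then have "has_laplacian (\<lambda>y. \<sigma> * (u y - g x0) - L * W y) z (\<sigma> * (0 - 0) - L * l)"
              by (intro has_laplacian_diff has_laplacian_cmult has_laplacian_const l(2))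
            moreover have "\<sigma> * (0 - 0) - L * l \<ge> 0" using L l(1) by (simp add: mult_nonneg_nonpos)
            ultimately show ?thesis by blast
          qed
          show "\<sigma> * (u z - g x0) - L * W z \<le> 0" if z: "z \<in> frontier \<Omega>" for z
          proof -
            have "z \<in> closure \<Omega>" using z by (simp add: frontier_def)
            then have "norm (z - x0) \<le> W z" using W1 qcl by blast
            then have "L * norm (z - x0) \<le> L * W z" using L by (rule mult_left_mono)
            moreover have "\<bar>g z - g x0\<bar> \<le> L * norm (z - x0)" using Lip[OF z x0(1)] .
            moreover have "\<sigma> * (g z - g x0) \<le> \<bar>g z - g x0\<bar>" using \<sigma> by auto
            ultimately show ?thesis using ug[OF z] by simp
          qed
        qed
        then show ?thesis by simp
      qed
      have sub: "cball x (d / 2) \<subseteq> \<Omega>"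
      proof -
        have "cball x (d / 2) \<subseteq> ball x d" using d by auto
        then show ?thesis using ball_infdist_frontier_subset[OF x] unfolding d_def[symmetric] by blast
      qed
      define R where "R = L * (K * d * (1 + \<bar>ln d\<bar>))"
      have osc: "\<bar>u y - g x0\<bar> \<le> R" if y: "y \<in> cball x (d / 2)" for y
      proof -
        have ycl: "y \<in> closure \<Omega>" using y sub closure_subset by blast
        have "dist y x \<le> d / 2" using y by (simp add: dist_commute)
        then have "dist y x0 \<le> 2 * d" using dist_triangle[of y x0 x] x0(2) d by linarith
        then have "norm (y - x0) \<le> 2 * d" by (simp add: dist_norm)
        then have "W y \<le> K * d * (1 + \<bar>ln d\<bar>)" using W3[OF _ diam[OF ycl x0cl] d] ycl qcl by blast
        then have "L * W y \<le> R" unfolding R_def using L by (rule mult_left_mono)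
        then show ?thesis using comp[of 1 y] comp[of "-1" y] ycl by (simp add: abs_le_iff)
      qed
      have CW: "Ck_on 2 \<Omega> (\<lambda>y. u y - g x0)" by (intro Ck_on_diff Ck_on_const C assms(1))
      have lapW: "laplacian (\<lambda>y. u y - g x0) y = 0" if "y \<in> \<Omega>" for y
        using laplacian_diff[OF assms(1) C Ck_on_const that] lapu[OF that] by (simp add: laplacian_const)
      have "\<bar>partial i u x\<bar> \<le> n * R / (d / 2)" for i
      proof -
        have "\<bar>partial i (\<lambda>y. u y - g x0) x\<bar> \<le> n * R / (d / 2)"
          unfolding n_def using d by (intro harmonic_partial_bound[OF assms(1) CW lapW sub _ osc]) auto
        then show ?thesis using Ck_on_2D(1)[OF C x] by (simp add: partial_diff partial_const)
      qed
      then have "norm (gradient u x) \<le> n * (n * R / (d / 2))"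
        unfolding n_def by (rule norm_gradient_le)
      also have "\<dots> = L * (2 * n * n * K * (1 + \<bar>ln d\<bar>))" using d by (simp add: R_def)
      finally show "norm (gradient u x) \<le> L * (2 * n * n * K * (1 + \<bar>ln (infdist x (frontier \<Omega>))\<bar>))"
        by (simp add: d_def)
    qed
  qed
qed

text \<open>The two opposite rays from an interior point leave a bounded set at different points. With a single
  boundary point there would be no difference quotients, and \<open>Lip_const\<close> would be the supremum of the
  empty set, an arbitrary number.\<close>

lemma frontier_two_points:
  fixes \<Omega> :: "(real^'n) set"
  assumes "open \<Omega>" "bounded \<Omega>" "\<Omega> \<noteq> {}"
  obtains y z where "y \<in> frontier \<Omega>" "z \<in> frontier \<Omega>" "y \<noteq> z"
proof -
  obtain x where "x \<in> \<Omega>" using assms(3) by blast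
  then have x: "x \<in> interior \<Omega>" using assms(1) by (simp add: interior_open)
  define v :: "real^'n" where "v = axis undefined 1"
  have v: "v \<noteq> 0" by (simp add: v_def axis_eq_0_iff)
  obtain s where s: "0 < s" "x + s *\<^sub>R v \<in> frontier \<Omega>"
    using ray_to_frontier[OF assms(2) x v] by metis
  obtain t where t: "0 < t" "x + t *\<^sub>R (- v) \<in> frontier \<Omega>"
    using ray_to_frontier[OF assms(2) x, of "- v"] v neg_equal_0_iff_equal by metis
  have diff: "x + s *\<^sub>R v - (x + t *\<^sub>R (- v)) = (s + t) *\<^sub>R v" by (simp add: scaleR_add_left)
  have "x + s *\<^sub>R v \<noteq> x + t *\<^sub>R (- v)"
  proof
    assume "x + s *\<^sub>R v = x + t *\<^sub>R (- v)"
    then have "(s + t) *\<^sub>R v = 0" unfolding diff[symmetric] by (simp only: diff_self)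
    then show False using s(1) t(1) v by simp
  qed
  then show ?thesis using that s(2) t(2) by blast
qed

lemma Lip_on_bound:
  assumes "Lip_on S g" "y \<in> S" "z \<in> S"
  shows "\<bar>g y - g z\<bar> \<le> Lip_const g S * norm (y - z)"
proof (cases "y = z")
  case False
  then have "\<bar>g y - g z\<bar> / norm (y - z) \<in> difference_quotients g S"
    using assms unfolding difference_quotients_def by blast
  then have "\<bar>g y - g z\<bar> / norm (y - z) \<le> Lip_const g S"
    unfolding Lip_const_def using assms(1) by (intro cSup_upper) (auto simp: Lip_on_def)
  then show ?thesis using False by (simp add: divide_le_eq)
qed simp

lemma Lip_const_nonneg:
  assumes "Lip_on S g" "y \<in> S" "z \<in> S" "y \<noteq> z"
  shows "0 \<le> Lip_const g S"
proof -
  have "0 \<le> Lip_const g S * norm (y - z)" using Lip_on_bound[OF assms(1-3)] by linarith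
  then show ?thesis using assms(4) by (simp add: zero_le_mult_iff)
qed

lemma Lp_on_const: 
  fixes \<Omega> :: "(real^'n) set" and c :: real
  assumes "open \<Omega>" "bounded \<Omega>"
  shows "Lp_on \<Omega> p (\<lambda>x. c)"
proof -
  have \<Omega>: "\<Omega> \<in> lmeasurable" using assms by (simp add: lmeasurable_open)
  have "integrable (lebesgue_on \<Omega>) (\<lambda>x. \<bar>c\<bar> powr p)"
    by (rule finite_measure.integrable_const[OF finite_measure_lebesgue_on[OF \<Omega>]])
  then show ?thesis by (simp add: Lp_on_def)
qed

lemma gradient_bound_Lp:
  fixes \<Omega> :: "(real^'n) set"
  assumes "open \<Omega>" "bounded \<Omega>" "C2_boundary \<Omega>"
  obtains f :: "real^'n \<Rightarrow> real" where "\<forall>x\<in>\<Omega>. f x > 0" "\<forall>p\<ge>1. Lp_on \<Omega> p f" "continuous_on \<Omega> f"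
    "\<forall>g u. Lip_on (frontier \<Omega>) g \<and> solves_dirichlet \<Omega> g u \<longrightarrow>
           (\<forall>x\<in>\<Omega>. norm (gradient u x) \<le> Lip_const g (frontier \<Omega>) * f x)"
proof (cases "\<Omega> = {}")
  case True
  then show ?thesis using that[of "\<lambda>x. 1"] Lp_on_const[OF assms(1,2)] by simp
next
  case False
  obtain y z where yz: "y \<in> frontier \<Omega>" "z \<in> frontier \<Omega>" "y \<noteq> z"
    by (rule frontier_two_points[OF assms(1,2) False])
  then have ne: "frontier \<Omega> \<noteq> {}" by blast
  obtain c where c: "c > 0" and bound:
    "\<forall>L g u. 0 \<le> L \<and> (\<forall>y\<in>frontier \<Omega>. \<forall>z\<in>frontier \<Omega>. \<bar>g y - g z\<bar> \<le> L * norm (y - z)) \<and>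
       solves_dirichlet \<Omega> g u \<longrightarrow>
       (\<forall>x\<in>\<Omega>. norm (gradient u x) \<le> L * (c * (1 + \<bar>ln (infdist x (frontier \<Omega>))\<bar>)))"
    by (rule gradient_bound_log[OF assms ne])
  define f where "f x = c * (1 + \<bar>ln (infdist x (frontier \<Omega>))\<bar>)" for x
  show ?thesis
  proof (rule that[of f])
    show "\<forall>x\<in>\<Omega>. f x > 0" using c by (auto simp: f_def intro!: mult_pos_pos add_pos_nonneg)
    show "\<forall>p\<ge>1. Lp_on \<Omega> p f"
      unfolding f_def using Lp_on_log_infdist[OF assms ne] c by simp
    have "infdist x (frontier \<Omega>) \<noteq> 0" if "x \<in> \<Omega>" for x
    proof -
      have "x \<notin> frontier \<Omega>" using that assms(1) by (simp add: frontier_def interior_open)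
      then show ?thesis using infdist_pos_not_in_closed[OF frontier_closed ne, of x] by simp
    qed
    then show "continuous_on \<Omega> f" unfolding f_def by (intro continuous_intros) auto
    show "\<forall>g u. Lip_on (frontier \<Omega>) g \<and> solves_dirichlet \<Omega> g u \<longrightarrow>
           (\<forall>x\<in>\<Omega>. norm (gradient u x) \<le> Lip_const g (frontier \<Omega>) * f x)"
    proof (intro allI impI ballI)
      fix g u x assume gu: "Lip_on (frontier \<Omega>) g \<and> solves_dirichlet \<Omega> g u" and x: "x \<in> \<Omega>"
      show "norm (gradient u x) \<le> Lip_const g (frontier \<Omega>) * f x"
        unfolding f_def
      proof (rule bound[rule_format, where g = g, OF _ x], intro conjI ballI)
        show "0 \<le> Lip_const g (frontier \<Omega>)" using Lip_const_nonneg[OF _ yz] gu by simp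
        show "\<bar>g y - g z\<bar> \<le> Lip_const g (frontier \<Omega>) * norm (y - z)" if "y \<in> frontier \<Omega>" "z \<in> frontier \<Omega>" for y z
          using Lip_on_bound[OF _ that] gu by simp
        show "solves_dirichlet \<Omega> g u" using gu by simp
      qed
    qed
  qed
qed

section \<open>Convergence in \<open>W\<^sup>1\<^sup>,\<^sup>p\<close>\<close>

lemma Lp_on_dominated:
  fixes \<Omega> :: "(real^'n) set" and h :: "real^'n \<Rightarrow> 'b::euclidean_space" and G :: "real^'n \<Rightarrow> real"
  assumes "open \<Omega>" "continuous_on \<Omega> h" "Lp_on \<Omega> p G" "p \<ge> 1" "c \<ge> 0"
    and dom: "\<And>x. x \<in> \<Omega> \<Longrightarrow> norm (h x) \<le> c * \<bar>G x\<bar>"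
  shows "Lp_on \<Omega> p h"
proof -
  have \<Omega>: "\<Omega> \<in> sets lebesgue" using assms(1) by (simp add: borel_open)
  have h: "h \<in> borel_measurable (lebesgue_on \<Omega>)"
    using assms(2) \<Omega> by (rule continuous_imp_measurable_on_sets_lebesgue)
  have "integrable (lebesgue_on \<Omega>) (\<lambda>x. norm (h x) powr p)"
  proof (rule Bochner_Integration.integrable_bound)
    show "integrable (lebesgue_on \<Omega>) (\<lambda>x. c powr p * norm (G x) powr p)"
      using assms(3) by (simp add: Lp_on_def)
    show "(\<lambda>x. norm (h x) powr p) \<in> borel_measurable (lebesgue_on \<Omega>)" using h by measurable
    have "norm (norm (h x) powr p) \<le> norm (c powr p * norm (G x) powr p)" if "x \<in> \<Omega>" for x
    proof -
      have "norm (h x) powr p \<le> (c * \<bar>G x\<bar>) powr p"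
        using dom[OF that] assms(4) by (intro powr_mono2) auto
      then show ?thesis using assms(5) by (simp add: powr_mult)
    qed
    then show "AE x in lebesgue_on \<Omega>. norm (norm (h x) powr p) \<le> norm (c powr p * norm (G x) powr p)"
      by (intro AE_I2) simp
  qed
  with h show ?thesis by (simp add: Lp_on_def)
qed

lemma W1p_on_classical:
  fixes \<Omega> :: "(real^'n) set" and u G :: "real^'n \<Rightarrow> real"
  assumes "open \<Omega>" "bounded \<Omega>" "Ck_on 2 \<Omega> u" "p \<ge> 1" "C \<ge> 0" "Lp_on \<Omega> p G"
    and "\<And>x. x \<in> \<Omega> \<Longrightarrow> \<bar>u x\<bar> \<le> C" "\<And>x. x \<in> \<Omega> \<Longrightarrow> norm (gradient u x) \<le> C * \<bar>G x\<bar>"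
  shows "W1p_on \<Omega> p u"
proof -
  have "Lp_on \<Omega> p u"
    by (rule Lp_on_dominated[OF assms(1) Ck_on_2D(3)[OF assms(3)] Lp_on_const[OF assms(1,2), of p 1] assms(4,5)])
       (use assms(7) in simp)
  moreover have "Lp_on \<Omega> p (gradient u)"
    by (rule Lp_on_dominated[OF assms(1) continuous_on_gradient[OF assms(3)] assms(6,4,5,8)])
  ultimately show ?thesis
    unfolding W1p_on_def using is_weak_gradient_gradient[OF assms(1,3)] by blast
qed

text \<open>The chosen weak gradient is only known to be measurable because it agrees almost everywhere with
  the continuous classical gradient and Lebesgue measure is complete.\<close>

lemma W1p_norm_classical:
  fixes \<Omega> :: "(real^'n) set"
  assumes "open \<Omega>" "Ck_on 2 \<Omega> u"
  shows "W1p_norm \<Omega> p u =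
     (integral\<^sup>L (lebesgue_on \<Omega>) (\<lambda>x. \<bar>u x\<bar> powr p) +
      integral\<^sup>L (lebesgue_on \<Omega>) (\<lambda>x. norm (gradient u x) powr p)) powr (1 / p)"
proof -
  have \<Omega>: "\<Omega> \<in> sets lebesgue" using assms(1) by (simp add: borel_open)
  have g: "gradient u \<in> borel_measurable (lebesgue_on \<Omega>)"
    using continuous_on_gradient[OF assms(2)] \<Omega> by (rule continuous_imp_measurable_on_sets_lebesgue)
  have ae: "AE x in lebesgue_on \<Omega>. weak_gradient \<Omega> u x = gradient u x"
    by (rule weak_gradient_eq_gradient[OF assms])
  have "AE x in lebesgue. (if x \<in> \<Omega> then gradient u x else 0) = (if x \<in> \<Omega> then weak_gradient \<Omega> u x else 0)"
  proof -
    have "AE x in lebesgue. x \<in> \<Omega> \<longrightarrow> weak_gradient \<Omega> u x = gradient u x"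
      using ae \<Omega> by (simp add: AE_restrict_space_iff)
    then show ?thesis by eventually_elim simp
  qed
  then have "(\<lambda>x. if x \<in> \<Omega> then weak_gradient \<Omega> u x else 0) \<in> borel_measurable lebesgue"
    by (rule borel_measurable_AE[rotated]) (use g borel_measurable_if[OF \<Omega>, of "gradient u"] in simp)
  then have wm: "weak_gradient \<Omega> u \<in> borel_measurable (lebesgue_on \<Omega>)"
    using borel_measurable_if[OF \<Omega>, of "weak_gradient \<Omega> u"] by simp
  have "integral\<^sup>L (lebesgue_on \<Omega>) (\<lambda>x. norm (weak_gradient \<Omega> u x) powr p) =
      integral\<^sup>L (lebesgue_on \<Omega>) (\<lambda>x. norm (gradient u x) powr p)"
  proof (rule integral_cong_AE)
    show "(\<lambda>x. norm (weak_gradient \<Omega> u x) powr p) \<in> borel_measurable (lebesgue_on \<Omega>)" using wm by measurable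
    show "(\<lambda>x. norm (gradient u x) powr p) \<in> borel_measurable (lebesgue_on \<Omega>)" using g by measurable
    show "AE x in lebesgue_on \<Omega>. norm (weak_gradient \<Omega> u x) powr p = norm (gradient u x) powr p"
      using ae by eventually_elim simp
  qed
  then show ?thesis by (simp add: W1p_norm_def)
qed

lemma integral_powr_tendsto_0:
  fixes \<Omega> :: "(real^'n) set" and h :: "nat \<Rightarrow> real^'n \<Rightarrow> 'b::euclidean_space" and G :: "real^'n \<Rightarrow> real"
  assumes "open \<Omega>" "\<And>k. continuous_on \<Omega> (h k)" "Lp_on \<Omega> p G" "p \<ge> 1" "c \<ge> 0"
    and dom: "\<And>k x. x \<in> \<Omega> \<Longrightarrow> norm (h k x) \<le> c * \<bar>G x\<bar>"
    and lim: "\<And>x. x \<in> \<Omega> \<Longrightarrow> (\<lambda>k. h k x) \<longlonglongrightarrow> 0"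
  shows "(\<lambda>k. integral\<^sup>L (lebesgue_on \<Omega>) (\<lambda>x. norm (h k x) powr p)) \<longlonglongrightarrow> 0"
proof -
  have \<Omega>: "\<Omega> \<in> sets lebesgue" using assms(1) by (simp add: borel_open)
  have h: "h k \<in> borel_measurable (lebesgue_on \<Omega>)" for k
    using assms(2) \<Omega> by (rule continuous_imp_measurable_on_sets_lebesgue)
  have "(\<lambda>k. integral\<^sup>L (lebesgue_on \<Omega>) (\<lambda>x. norm (h k x) powr p)) \<longlonglongrightarrow> integral\<^sup>L (lebesgue_on \<Omega>) (\<lambda>x. 0 :: real)"
  proof (rule integral_dominated_convergence[where w = "\<lambda>x. c powr p * norm (G x) powr p"])
    show "integrable (lebesgue_on \<Omega>) (\<lambda>x. c powr p * norm (G x) powr p)"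
      using assms(3) by (simp add: Lp_on_def)
    show "(\<lambda>x. norm (h k x) powr p) \<in> borel_measurable (lebesgue_on \<Omega>)" for k using h[of k] by measurable
    have "(\<lambda>k. norm (h k x) powr p) \<longlonglongrightarrow> 0" if "x \<in> \<Omega>" for x
    proof -
      have "(\<lambda>k. norm (h k x)) \<longlonglongrightarrow> 0" using tendsto_norm_zero[OF lim[OF that]] .
      then show ?thesis
        using tendsto_powr2[of "\<lambda>k. norm (h k x)" 0 sequentially "\<lambda>_. p" p] assms(4) by simp
    qed
    then show "AE x in lebesgue_on \<Omega>. (\<lambda>k. norm (h k x) powr p) \<longlonglongrightarrow> 0" by (intro AE_I2) simp
    have "norm (norm (h k x) powr p) \<le> c powr p * norm (G x) powr p" if "x \<in> \<Omega>" for k x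
    proof -
      have "norm (h k x) powr p \<le> (c * \<bar>G x\<bar>) powr p"
        using dom[OF that] assms(4) by (intro powr_mono2) auto
      then show ?thesis using assms(5) by (simp add: powr_mult)
    qed
    then show "AE x in lebesgue_on \<Omega>. norm (norm (h k x) powr p) \<le> c powr p * norm (G x) powr p" for k
      by (intro AE_I2) simp
  qed simp
  then show ?thesis by simp
qed

lemma converges_W1_subseq:
  assumes "converges_W1 \<Omega> U v" "strict_mono \<tau>"
  shows "converges_W1 \<Omega> (\<lambda>k. U (\<tau> k)) v"
  unfolding converges_W1_def
proof (intro allI impI conjI)
  fix p :: real assume "p \<ge> 1"
  then have U: "\<forall>k. W1p_on \<Omega> p (U k)" "W1p_on \<Omega> p v" "(\<lambda>k. W1p_norm \<Omega> p (\<lambda>x. U k x - v x)) \<longlonglongrightarrow> 0"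
    using assms(1) unfolding converges_W1_def by simp_all
  show "W1p_on \<Omega> p (U (\<tau> k))" for k using U(1) by simp
  show "W1p_on \<Omega> p v" by (rule U(2))
  show "(\<lambda>k. W1p_norm \<Omega> p (\<lambda>x. U (\<tau> k) x - v x)) \<longlonglongrightarrow> 0"
    using LIMSEQ_subseq_LIMSEQ[OF U(3) assms(2)] by (simp add: o_def)
qed

lemma Lp_on_1_integrable:
  fixes u :: "real^'n \<Rightarrow> real"
  assumes "Lp_on \<Omega> 1 u"
  shows "integrable (lebesgue_on \<Omega>) u"
proof -
  have m: "u \<in> borel_measurable (lebesgue_on \<Omega>)" and "integrable (lebesgue_on \<Omega>) (\<lambda>x. norm (u x))"
    using assms by (simp_all add: Lp_on_def)
  then show ?thesis using integrable_norm_iff[OF m] by blast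
qed

lemma converges_W1_integral_diff:
  fixes \<Omega> :: "(real^'n) set"
  assumes "converges_W1 \<Omega> U v"
  shows "(\<lambda>k. integral\<^sup>L (lebesgue_on \<Omega>) (\<lambda>x. \<bar>U k x - v x\<bar>)) \<longlonglongrightarrow> 0"
proof (rule tendsto_sandwich[OF _ _ tendsto_const])
  show "(\<lambda>k. W1p_norm \<Omega> 1 (\<lambda>x. U k x - v x)) \<longlonglongrightarrow> 0"
    using assms unfolding converges_W1_def by auto
  have "integral\<^sup>L (lebesgue_on \<Omega>) (\<lambda>x. \<bar>U k x - v x\<bar>) \<le> W1p_norm \<Omega> 1 (\<lambda>x. U k x - v x)" for k
  proof -
    have "0 \<le> integral\<^sup>L (lebesgue_on \<Omega>) (\<lambda>x. \<bar>U k x - v x\<bar>)" by (rule integral_nonneg_AE) simp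
    moreover have "0 \<le> integral\<^sup>L (lebesgue_on \<Omega>) (\<lambda>x. norm (weak_gradient \<Omega> (\<lambda>x. U k x - v x) x))"
      by (rule integral_nonneg_AE) simp
    ultimately show ?thesis by (simp add: W1p_norm_def)
  qed
  then show "\<forall>\<^sub>F k in sequentially. integral\<^sup>L (lebesgue_on \<Omega>) (\<lambda>x. \<bar>U k x - v x\<bar>) \<le> W1p_norm \<Omega> 1 (\<lambda>x. U k x - v x)"
    by simp
  show "\<forall>\<^sub>F k in sequentially. 0 \<le> integral\<^sup>L (lebesgue_on \<Omega>) (\<lambda>x. \<bar>U k x - v x\<bar>)"
    by (intro always_eventually allI integral_nonneg_AE) simp
qed

text \<open>Convergence for \<open>p = 1\<close> suffices: it implies convergence in \<open>L\<^sup>1\<close>.\<close>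

lemma converges_W1_unique:
  fixes \<Omega> :: "(real^'n) set"
  assumes "converges_W1 \<Omega> U v" "converges_W1 \<Omega> U w"
  shows "AE x in lebesgue_on \<Omega>. v x = w x"
proof -
  have int: "integrable (lebesgue_on \<Omega>) v" "integrable (lebesgue_on \<Omega>) w" "integrable (lebesgue_on \<Omega>) (U k)" for k
    using assms unfolding converges_W1_def W1p_on_def by (auto intro!: Lp_on_1_integrable)
  let ?I = "integral\<^sup>L (lebesgue_on \<Omega>)"
  have "?I (\<lambda>x. \<bar>v x - w x\<bar>) \<le> ?I (\<lambda>x. \<bar>U k x - v x\<bar>) + ?I (\<lambda>x. \<bar>U k x - w x\<bar>)" for k
  proof -
    have "?I (\<lambda>x. \<bar>v x - w x\<bar>) \<le> ?I (\<lambda>x. \<bar>U k x - v x\<bar> + \<bar>U k x - w x\<bar>)"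
      using int by (intro integral_mono) auto
    then show ?thesis using int by simp
  qed
  moreover have "(\<lambda>k. ?I (\<lambda>x. \<bar>U k x - v x\<bar>) + ?I (\<lambda>x. \<bar>U k x - w x\<bar>)) \<longlonglongrightarrow> 0 + 0"
    by (intro tendsto_add converges_W1_integral_diff assms)
  ultimately have "?I (\<lambda>x. \<bar>v x - w x\<bar>) \<le> 0"
    by (intro LIMSEQ_le_const[of _ 0]) auto
  then have "?I (\<lambda>x. \<bar>v x - w x\<bar>) = 0"
    by (intro antisym integral_nonneg_AE) auto
  then have "AE x in lebesgue_on \<Omega>. \<bar>v x - w x\<bar> = 0"
    using int by (subst (asm) integral_nonneg_eq_0_iff_AE) auto
  then show ?thesis by eventually_elim simp
qed

text \<open>The set where the two functions differ is open in \<open>\<Omega>\<close>, and a nonempty open set is not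
  negligible.\<close>

lemma AE_eq_continuous_imp_eq_closure:
  fixes \<Omega> :: "(real^'n) set" and v w :: "real^'n \<Rightarrow> real"
  assumes "open \<Omega>" "continuous_on (closure \<Omega>) v" "continuous_on (closure \<Omega>) w"
    and ae: "AE x in lebesgue_on \<Omega>. v x = w x" and x: "x \<in> closure \<Omega>"
  shows "v x = w x"
proof -
  have c: "continuous_on (closure \<Omega>) (\<lambda>x. v x - w x)" by (intro continuous_intros assms)
  have \<Omega>: "\<Omega> \<in> sets lebesgue" using assms(1) by (simp add: borel_open)
  define N where "N = {x \<in> \<Omega>. v x - w x \<noteq> 0}"
  have "open N"
  proof -
    have "continuous_on \<Omega> (\<lambda>x. v x - w x)" using c closure_subset by (rule continuous_on_subset)
    then have "open (\<Omega> \<inter> (\<lambda>x. v x - w x) -` (- {0}))"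
      using assms(1) by (intro continuous_open_preimage) auto
    then show ?thesis by (simp add: N_def vimage_def Int_def)
  qed
  have "AE x in lebesgue. x \<notin> N"
  proof -
    have "AE x in lebesgue. x \<in> \<Omega> \<longrightarrow> v x = w x" using ae \<Omega> by (simp add: AE_restrict_space_iff)
    then show ?thesis by eventually_elim (simp add: N_def)
  qed
  then have "N \<in> null_sets lebesgue" using \<open>open N\<close> by (simp add: AE_iff_null_sets borel_open)
  then have "negligible N" by (simp add: negligible_iff_null_sets)
  then have "N = {}" using open_not_negligible[OF \<open>open N\<close>] by blast
  then have "v y - w y = 0" if "y \<in> \<Omega>" for y using that by (auto simp: N_def)
  from continuous_constant_on_closure[OF c this x] show ?thesis by simp
qed

text \<open>Functions and gradients converge pointwise, the latter by \<open>harmonic_uniform_limit\<close>. The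
  \<open>p\<close>-th powers of their norms are dominated by constants and by multiples of \<open>\<bar>f\<bar>\<^sup>p\<close>, which are
  integrable.\<close>

lemma converges_W1_of_bounds:
  fixes \<Omega> :: "(real^'n) set" and f :: "real^'n \<Rightarrow> real"
  assumes "open \<Omega>" "bounded \<Omega>" and C2: "\<And>k. Ck_on 2 \<Omega> (U k)" and harm: "\<And>k x. x \<in> \<Omega> \<Longrightarrow> laplacian (U k) x = 0"
    and lim: "uniform_limit \<Omega> U w sequentially" and f: "\<forall>p\<ge>1. Lp_on \<Omega> p f" and "C \<ge> 0"
    and bd: "\<And>k x. x \<in> \<Omega> \<Longrightarrow> \<bar>U k x\<bar> \<le> C"
    and gbd: "\<And>k x. x \<in> \<Omega> \<Longrightarrow> norm (gradient (U k) x) \<le> C * \<bar>f x\<bar>"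
  shows "converges_W1 \<Omega> U w"
  unfolding converges_W1_def
proof (intro allI impI conjI)
  fix p :: real assume p: "p \<ge> 1"
  note hl = harmonic_uniform_limit[OF assms(1) C2 harm lim]
  have pw: "(\<lambda>k. U k x) \<longlonglongrightarrow> w x" if "x \<in> \<Omega>" for x using lim that by (rule tendsto_uniform_limitI)
  have gpw: "(\<lambda>k. gradient (U k) x) \<longlonglongrightarrow> gradient w x" if "x \<in> \<Omega>" for x
    unfolding gradient_def by (intro tendsto_vec_lambda hl(3) that)
  have wbd: "\<bar>w x\<bar> \<le> C" if "x \<in> \<Omega>" for x
    using tendsto_rabs[OF pw[OF that]] bd[OF that] by (intro LIMSEQ_le_const2) auto
  have wgbd: "norm (gradient w x) \<le> C * \<bar>f x\<bar>" if "x \<in> \<Omega>" for x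
    using tendsto_norm[OF gpw[OF that]] gbd[OF that] by (intro LIMSEQ_le_const2) auto
  have Lf: "Lp_on \<Omega> p f" using f p by blast
  show "W1p_on \<Omega> p (U k)" for k
    by (rule W1p_on_classical[OF assms(1,2) C2 p \<open>C \<ge> 0\<close> Lf bd gbd])
  show "W1p_on \<Omega> p w"
    by (rule W1p_on_classical[OF assms(1,2) hl(1) p \<open>C \<ge> 0\<close> Lf wbd wgbd])
  have Cd: "Ck_on 2 \<Omega> (\<lambda>x. U k x - w x)" for k by (intro Ck_on_diff C2 hl(1) assms(1))
  have gd: "gradient (\<lambda>x. U k x - w x) x = gradient (U k) x - gradient w x" if "x \<in> \<Omega>" for k x
    using Ck_on_2D(1)[OF C2 that] Ck_on_2D(1)[OF hl(1) that] by (simp add: gradient_def vec_eq_iff partial_diff)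
  have A: "(\<lambda>k. integral\<^sup>L (lebesgue_on \<Omega>) (\<lambda>x. norm (U k x - w x) powr p)) \<longlonglongrightarrow> 0"
  proof (rule integral_powr_tendsto_0[OF assms(1) Ck_on_2D(3)[OF Cd] Lp_on_const[OF assms(1,2), of p 1] p])
    show "0 \<le> 2 * C" using \<open>C \<ge> 0\<close> by simp
    show "norm (U k x - w x) \<le> 2 * C * \<bar>1\<bar>" if "x \<in> \<Omega>" for k x using bd[OF that, of k] wbd[OF that] by simp
    show "(\<lambda>k. U k x - w x) \<longlonglongrightarrow> 0" if "x \<in> \<Omega>" for x using tendsto_diff[OF pw[OF that] tendsto_const, of "w x"] by simp
  qed
  have B: "(\<lambda>k. integral\<^sup>L (lebesgue_on \<Omega>) (\<lambda>x. norm (gradient (\<lambda>x. U k x - w x) x) powr p)) \<longlonglongrightarrow> 0"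
  proof (rule integral_powr_tendsto_0[OF assms(1) continuous_on_gradient[OF Cd] Lf p])
    show "0 \<le> 2 * C" using \<open>C \<ge> 0\<close> by simp
    show "norm (gradient (\<lambda>x. U k x - w x) x) \<le> 2 * C * \<bar>f x\<bar>" if "x \<in> \<Omega>" for k x
      using norm_triangle_ineq4[of "gradient (U k) x" "gradient w x"] gbd[OF that, of k] wgbd[OF that] gd[OF that] by simp
    show "(\<lambda>k. gradient (\<lambda>x. U k x - w x) x) \<longlonglongrightarrow> 0" if "x \<in> \<Omega>" for x
      unfolding gd[OF that] using tendsto_diff[OF gpw[OF that] tendsto_const, of "gradient w x"] by simp
  qed
  have "(\<lambda>k. (integral\<^sup>L (lebesgue_on \<Omega>) (\<lambda>x. norm (U k x - w x) powr p) +
      integral\<^sup>L (lebesgue_on \<Omega>) (\<lambda>x. norm (gradient (\<lambda>x. U k x - w x) x) powr p)) powr (1 / p)) \<longlonglongrightarrow> 0"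
  proof -
    have "(\<lambda>k. integral\<^sup>L (lebesgue_on \<Omega>) (\<lambda>x. norm (U k x - w x) powr p) +
      integral\<^sup>L (lebesgue_on \<Omega>) (\<lambda>x. norm (gradient (\<lambda>x. U k x - w x) x) powr p)) \<longlonglongrightarrow> 0"
      using tendsto_add[OF A B] by simp
    from tendsto_powr2[OF this tendsto_const[of "1 / p"]] show ?thesis
      using p by (simp add: integral_nonneg_AE add_nonneg_nonneg)
  qed
  then show "(\<lambda>k. W1p_norm \<Omega> p (\<lambda>x. U k x - w x)) \<longlonglongrightarrow> 0"
    by (simp add: W1p_norm_classical[OF assms(1) Cd])
qed

text \<open>By the maximum principle the solutions are uniformly Cauchy on the closure of \<open>\<Omega>\<close> as soon as the
  boundary values are uniformly Cauchy.\<close>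

lemma dirichlet_limit:
  fixes \<Omega> :: "(real^'n) set" and f :: "real^'n \<Rightarrow> real" and g u :: "nat \<Rightarrow> real^'n \<Rightarrow> real"
  assumes "open \<Omega>" "bounded \<Omega>" and u: "\<And>k. solves_dirichlet \<Omega> (g k) (u k)"
    and lim: "uniform_limit (frontier \<Omega>) g h sequentially" and f: "\<forall>p\<ge>1. Lp_on \<Omega> p f" and "C \<ge> 0"
    and bd: "\<And>k x. x \<in> \<Omega> \<Longrightarrow> \<bar>u k x\<bar> \<le> C"
    and gbd: "\<And>k x. x \<in> \<Omega> \<Longrightarrow> norm (gradient (u k) x) \<le> C * \<bar>f x\<bar>"
  obtains w where "solves_dirichlet \<Omega> h w" "converges_W1 \<Omega> u w"
proof -
  have C2: "Ck_on 2 \<Omega> (u k)" and cont: "continuous_on (closure \<Omega>) (u k)"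
    and harm: "x \<in> \<Omega> \<Longrightarrow> laplacian (u k) x = 0" and bv: "x \<in> frontier \<Omega> \<Longrightarrow> u k x = g k x" for k x
    using u[of k] unfolding solves_dirichlet_def by simp_all
  have "uniformly_Cauchy_on (closure \<Omega>) u"
  proof (rule uniformly_Cauchy_onI)
    fix e :: real assume "e > 0"
    then have e4: "e / 4 > 0" by simp
    obtain N where N: "\<And>k x. k \<ge> N \<Longrightarrow> x \<in> frontier \<Omega> \<Longrightarrow> \<bar>g k x - h x\<bar> < e / 4"
      using uniform_limitD[OF lim e4] unfolding eventually_sequentially dist_real_def by blast
    have "dist (u k x) (u l x) < e" if "x \<in> closure \<Omega>" "k \<ge> N" "l \<ge> N" for x k l
    proof -
      have "\<bar>u k x - u l x\<bar> \<le> e / 2"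
      proof (rule dirichlet_diff_le[OF assms(1,2) u u _ that(1)])
        show "\<bar>g k y - g l y\<bar> \<le> e / 2" if "y \<in> frontier \<Omega>" for y
          using N[OF \<open>k \<ge> N\<close> that] N[OF \<open>l \<ge> N\<close> that] by linarith
      qed
      then show ?thesis using \<open>e > 0\<close> by (simp add: dist_real_def)
    qed
    then show "\<exists>N. \<forall>x\<in>closure \<Omega>. \<forall>k\<ge>N. \<forall>l\<ge>N. dist (u k x) (u l x) < e" by blast
  qed
  then have "uniformly_convergent_on (closure \<Omega>) u" by (rule Cauchy_uniformly_convergent)
  then obtain w where w: "uniform_limit (closure \<Omega>) u w sequentially"
    unfolding uniformly_convergent_on_def by blast
  then have w\<Omega>: "uniform_limit \<Omega> u w sequentially"
    using closure_subset by (rule uniform_limit_on_subset)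
  have cw: "continuous_on (closure \<Omega>) w"
    by (rule uniform_limit_theorem[OF _ w]) (auto intro!: always_eventually cont)
  have "w x = h x" if x: "x \<in> frontier \<Omega>" for x
  proof -
    have "x \<in> closure \<Omega>" using x by (simp add: frontier_def)
    then have "(\<lambda>k. u k x) \<longlonglongrightarrow> w x" by (rule tendsto_uniform_limitI[OF w])
    moreover have "(\<lambda>k. u k x) \<longlonglongrightarrow> h x"
      using tendsto_uniform_limitI[OF lim x] bv[OF x] by simp
    ultimately show ?thesis by (rule LIMSEQ_unique)
  qed
  then have "solves_dirichlet \<Omega> h w"
    unfolding solves_dirichlet_def
    using cw harmonic_uniform_limit(1,2)[OF assms(1) C2 harm w\<Omega>] by blast
  moreover have "converges_W1 \<Omega> u w"
    by (rule converges_W1_of_bounds[OF assms(1,2) C2 harm w\<Omega> f \<open>C \<ge> 0\<close> bd gbd])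
  ultimately show ?thesis by (rule that)
qed

section \<open>Compactness of families of Dirichlet solutions\<close>

lemma equi_Lipschitz_subsequence:
  fixes g :: "nat \<Rightarrow> 'a::euclidean_space \<Rightarrow> real"
  assumes "compact S" "C > 0" "\<And>k x. x \<in> S \<Longrightarrow> \<bar>g k x\<bar> \<le> C"
    and Lip: "\<And>k x y. x \<in> S \<Longrightarrow> y \<in> S \<Longrightarrow> \<bar>g k x - g k y\<bar> \<le> C * norm (x - y)"
  obtains \<tau> h where "strict_mono \<tau>" "uniform_limit S (\<lambda>k. g (\<tau> k)) h sequentially"
proof (rule Arzela_Ascoli[OF assms(1), of g C])
  show "norm (g n x) \<le> C" if "x \<in> S" for n x using assms(3)[OF that] by simp
  show "\<exists>d>0. \<forall>n y. y \<in> S \<and> norm (x - y) < d \<longrightarrow> norm (g n x - g n y) < e" if x: "x \<in> S" and e: "0 < e" for x e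
  proof (intro exI[of _ "e / C"] conjI allI impI)
    show "0 < e / C" using e assms(2) by simp
    fix n y assume y: "y \<in> S \<and> norm (x - y) < e / C"
    then have "C * norm (x - y) < e" using assms(2) by (simp add: pos_less_divide_eq mult.commute)
    then show "norm (g n x - g n y) < e" using Lip[of x y n] x y by simp
  qed
  fix h \<tau> assume \<tau>: "strict_mono (\<tau> :: nat \<Rightarrow> nat)"
    and lim: "\<And>e. 0 < e \<Longrightarrow> \<exists>N. \<forall>n x. n \<ge> N \<and> x \<in> S \<longrightarrow> norm (g (\<tau> n) x - h x) < e"
  have "uniform_limit S (\<lambda>k. g (\<tau> k)) h sequentially"
    unfolding uniform_limit_sequentially_iff dist_norm using lim by blast
  with \<tau> show thesis by (rule that)
qed

text \<open>Both summands of the assumed bound are nonnegative, so each of them is at most \<open>C\<close>; the rest is the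
  maximum principle and the gradient bound. For the Lipschitz constant, nonnegativity needs two boundary
  points, whence the case distinction on whether \<open>\<Omega>\<close> is empty.\<close>

lemma dirichlet_data_bounds:
  fixes \<Omega> :: "(real^'n) set" and f g u :: "real^'n \<Rightarrow> real"
  assumes "open \<Omega>" "bounded \<Omega>" and Lip: "Lip_on (frontier \<Omega>) g"
    and C: "Lip_const g (frontier \<Omega>) + (SUP x\<in>frontier \<Omega>. \<bar>g x\<bar>) \<le> C" and u: "solves_dirichlet \<Omega> g u"
    and f: "\<forall>x\<in>\<Omega>. f x > 0"
    and grad: "\<forall>x\<in>\<Omega>. norm (gradient u x) \<le> Lip_const g (frontier \<Omega>) * f x"
  shows "\<And>x. x \<in> frontier \<Omega> \<Longrightarrow> \<bar>g x\<bar> \<le> C"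
    and "\<And>x y. x \<in> frontier \<Omega> \<Longrightarrow> y \<in> frontier \<Omega> \<Longrightarrow> \<bar>g x - g y\<bar> \<le> C * norm (x - y)"
    and "\<And>x. x \<in> \<Omega> \<Longrightarrow> \<bar>u x\<bar> \<le> C"
    and "\<And>x. x \<in> \<Omega> \<Longrightarrow> norm (gradient u x) \<le> C * \<bar>f x\<bar>"
proof -
  have bounds: "0 \<le> Lip_const g (frontier \<Omega>) \<and> Lip_const g (frontier \<Omega>) \<le> C \<and> (\<forall>x\<in>frontier \<Omega>. \<bar>g x\<bar> \<le> C)" if ne: "\<Omega> \<noteq> {}"
  proof -
    obtain y z where yz: "y \<in> frontier \<Omega>" "z \<in> frontier \<Omega>" "y \<noteq> z"
      by (rule frontier_two_points[OF assms(1,2) ne])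
    have L: "0 \<le> Lip_const g (frontier \<Omega>)" by (rule Lip_const_nonneg[OF Lip yz])
    have "compact (frontier \<Omega>)" using assms(2) by (simp add: compact_frontier_bounded)
    moreover have "continuous_on (frontier \<Omega>) (\<lambda>x. \<bar>g x\<bar>)"
      using Lip by (intro continuous_intros) (simp add: Lip_on_def)
    ultimately have "bdd_above ((\<lambda>x. \<bar>g x\<bar>) ` frontier \<Omega>)"
      by (intro bounded_imp_bdd_above compact_imp_bounded compact_continuous_image)
    then have S: "\<bar>g x\<bar> \<le> (SUP x\<in>frontier \<Omega>. \<bar>g x\<bar>)" if "x \<in> frontier \<Omega>" for x
      using that by (intro cSUP_upper)
    have "Lip_const g (frontier \<Omega>) \<le> C" using S[OF yz(1)] C by linarith
    moreover have "\<bar>g x\<bar> \<le> C" if "x \<in> frontier \<Omega>" for x using S[OF that] C L by linarith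
    ultimately show ?thesis using L by blast
  qed
  have ne: "\<Omega> \<noteq> {}" if "x \<in> frontier \<Omega>" for x using that by (auto simp: frontier_def)
  show gC: "\<bar>g x\<bar> \<le> C" if "x \<in> frontier \<Omega>" for x using bounds[OF ne[OF that]] that by blast
  show "\<bar>g x - g y\<bar> \<le> C * norm (x - y)" if "x \<in> frontier \<Omega>" "y \<in> frontier \<Omega>" for x y
  proof -
    have "Lip_const g (frontier \<Omega>) * norm (x - y) \<le> C * norm (x - y)"
      using bounds[OF ne[OF that(1)]] by (intro mult_right_mono) auto
    then show ?thesis using Lip_on_bound[OF Lip that] by linarith
  qed
  show "\<bar>u x\<bar> \<le> C" if "x \<in> \<Omega>" for x
  proof (rule harmonic_abs_le_frontier[OF assms(1,2)])
    show "Ck_on 2 \<Omega> u" "continuous_on (closure \<Omega>) u" using u by (simp_all add: solves_dirichlet_def)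
    show "laplacian u y = 0" if "y \<in> \<Omega>" for y using u that by (simp add: solves_dirichlet_def)
    show "\<bar>u y\<bar> \<le> C" if "y \<in> frontier \<Omega>" for y using u gC[OF that] that by (simp add: solves_dirichlet_def)
    show "x \<in> closure \<Omega>" using that closure_subset by blast
  qed
  show "norm (gradient u x) \<le> C * \<bar>f x\<bar>" if x: "x \<in> \<Omega>" for x
  proof -
    have "\<Omega> \<noteq> {}" using x by blast
    then have "Lip_const g (frontier \<Omega>) \<le> C" "0 \<le> C" using bounds by auto
    moreover have "0 < f x" using f x by blast
    ultimately have "Lip_const g (frontier \<Omega>) * f x \<le> C * \<bar>f x\<bar>" by (intro mult_mono) auto
    moreover have "norm (gradient u x) \<le> Lip_const g (frontier \<Omega>) * f x" using grad x by blast
    ultimately show ?thesis by linarith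
  qed
qed

lemma dirichlet_precompact_W1:
  fixes \<Omega> :: "(real^'n) set" and f :: "real^'n \<Rightarrow> real" and g u :: "nat \<Rightarrow> real^'n \<Rightarrow> real"
  assumes "open \<Omega>" and "bounded \<Omega>" and f: "\<forall>x\<in>\<Omega>. f x > 0" "\<forall>p\<ge>1. Lp_on \<Omega> p f"
    and grad: "\<forall>g u. Lip_on (frontier \<Omega>) g \<and> solves_dirichlet \<Omega> g u \<longrightarrow>
           (\<forall>x\<in>\<Omega>. norm (gradient u x) \<le> Lip_const g (frontier \<Omega>) * f x)"
    and C: "C > 0" and Lip: "\<forall>m. Lip_on (frontier \<Omega>) (g m)"
    and gC: "\<forall>m. Lip_const (g m) (frontier \<Omega>) + (SUP x\<in>frontier \<Omega>. \<bar>g m x\<bar>) \<le> C"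
    and u: "\<forall>m. solves_dirichlet \<Omega> (g m) (u m)"
  shows "precompact_W1 \<Omega> u"
proof -
  have "\<forall>x\<in>\<Omega>. norm (gradient (u m) x) \<le> Lip_const (g m) (frontier \<Omega>) * f x" for m
    using grad Lip u by blast
  note bounds = dirichlet_data_bounds[OF assms(1,2) Lip[rule_format] gC[rule_format] u[rule_format] f(1) this]
  show ?thesis
    unfolding precompact_W1_def
  proof (intro conjI allI impI)
    fix p :: real and m assume p: "p \<ge> 1"
    have "Ck_on 2 \<Omega> (u m)" using u by (simp add: solves_dirichlet_def)
    then show "W1p_on \<Omega> p (u m)"
      by (rule W1p_on_classical[OF assms(1,2) _ p less_imp_le[OF C] f(2)[rule_format, OF p] bounds(3,4)])
  next
    fix \<sigma> :: "nat \<Rightarrow> nat"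
    have "compact (frontier \<Omega>)" using assms(2) by (simp add: compact_frontier_bounded)
    then obtain \<tau> h where \<tau>: "strict_mono \<tau>" "uniform_limit (frontier \<Omega>) (\<lambda>k. g (\<sigma> (\<tau> k))) h sequentially"
      by (rule equi_Lipschitz_subsequence[OF _ C bounds(1,2), of "frontier \<Omega>" \<sigma>])
    obtain w where "converges_W1 \<Omega> (\<lambda>k. u (\<sigma> (\<tau> k))) w"
      by (rule dirichlet_limit[OF assms(1,2) u[rule_format] \<tau>(2) f(2) less_imp_le[OF C] bounds(3,4)])
    then show "\<exists>v. limit_point_W1 \<Omega> (\<lambda>k. u (\<sigma> k)) v"
      unfolding limit_point_W1_def using \<tau>(1) by blast
  qed
qed

text \<open>The whole sequence converges to the solution \<open>w\<close> with boundary values \<open>h\<close>, so every limit point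
  agrees with \<open>w\<close> almost everywhere, and everywhere on the closure if it is continuous there.\<close>

lemma dirichlet_unique_limit_point_W1:
  fixes \<Omega> :: "(real^'n) set" and f :: "real^'n \<Rightarrow> real" and g u :: "nat \<Rightarrow> real^'n \<Rightarrow> real"
  assumes "open \<Omega>" and "bounded \<Omega>" and f: "\<forall>x\<in>\<Omega>. f x > 0" "\<forall>p\<ge>1. Lp_on \<Omega> p f"
    and grad: "\<forall>g u. Lip_on (frontier \<Omega>) g \<and> solves_dirichlet \<Omega> g u \<longrightarrow>
           (\<forall>x\<in>\<Omega>. norm (gradient u x) \<le> Lip_const g (frontier \<Omega>) * f x)"
    and C: "C > 0" and Lip: "\<forall>m. Lip_on (frontier \<Omega>) (g m)"
    and gC: "\<forall>m. Lip_const (g m) (frontier \<Omega>) + (SUP x\<in>frontier \<Omega>. \<bar>g m x\<bar>) \<le> C"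
    and u: "\<forall>m. solves_dirichlet \<Omega> (g m) (u m)"
    and h: "uniform_limit (frontier \<Omega>) (\<lambda>k. g (s k)) h sequentially"
  shows "\<exists>w. Ck_on 2 \<Omega> w \<and> continuous_on (closure \<Omega>) w \<and>
              limit_point_W1 \<Omega> (\<lambda>k. u (s k)) w \<and>
              (\<forall>v. limit_point_W1 \<Omega> (\<lambda>k. u (s k)) v \<longrightarrow> (AE x in lebesgue_on \<Omega>. v x = w x)) \<and>
              (\<forall>v. Ck_on 2 \<Omega> v \<and> continuous_on (closure \<Omega>) v \<and>
                 limit_point_W1 \<Omega> (\<lambda>k. u (s k)) v \<longrightarrow> (\<forall>x\<in>closure \<Omega>. v x = w x)) \<and>
              solves_dirichlet \<Omega> h w"
proof -
  have "\<forall>x\<in>\<Omega>. norm (gradient (u m) x) \<le> Lip_const (g m) (frontier \<Omega>) * f x" for m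
    using grad Lip u by blast
  note bounds = dirichlet_data_bounds[OF assms(1,2) Lip[rule_format] gC[rule_format] u[rule_format] f(1) this]
  obtain w where w: "solves_dirichlet \<Omega> h w" "converges_W1 \<Omega> (\<lambda>k. u (s k)) w"
    by (rule dirichlet_limit[OF assms(1,2) u[rule_format] h f(2) less_imp_le[OF C] bounds(3,4)])
  have Cw: "Ck_on 2 \<Omega> w" "continuous_on (closure \<Omega>) w" using w(1) by (simp_all add: solves_dirichlet_def)
  have lp: "limit_point_W1 \<Omega> (\<lambda>k. u (s k)) w"
    unfolding limit_point_W1_def using w(2) by (intro exI[of _ "\<lambda>k. k"]) (simp add: strict_mono_def)
  have uniq: "AE x in lebesgue_on \<Omega>. v x = w x" if v: "limit_point_W1 \<Omega> (\<lambda>k. u (s k)) v" for v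
  proof -
    obtain \<tau> where \<tau>: "strict_mono \<tau>" "converges_W1 \<Omega> (\<lambda>k. u (s (\<tau> k))) v"
      using v unfolding limit_point_W1_def by blast
    show ?thesis by (rule converges_W1_unique[OF \<tau>(2) converges_W1_subseq[OF w(2) \<tau>(1)]])
  qed
  show ?thesis
  proof (intro exI[of _ w] conjI Cw lp w(1) allI impI ballI)
    show "AE x in lebesgue_on \<Omega>. v x = w x" if "limit_point_W1 \<Omega> (\<lambda>k. u (s k)) v" for v
      by (rule uniq[OF that])
    show "v x = w x" if "Ck_on 2 \<Omega> v \<and> continuous_on (closure \<Omega>) v \<and> limit_point_W1 \<Omega> (\<lambda>k. u (s k)) v"
      and "x \<in> closure \<Omega>" for v x
      using that uniq[of v] by (intro AE_eq_continuous_imp_eq_closure[OF assms(1) _ Cw(2)]) auto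
  qed
qed

text \<open>The function \<open>f\<close> of the first part serves as the common majorant in the second one.\<close>

theorem theorem1:
  fixes \<Omega> :: "(real^'n) set"
  assumes "CARD('n) \<ge> 2"
    and "open \<Omega>" and "bounded \<Omega>" and "C2_boundary \<Omega>"
  shows
    "(\<exists>f :: real^'n \<Rightarrow> real.
        (\<forall>x\<in>\<Omega>. f x > 0) \<and> (\<forall>p\<ge>1. Lp_on \<Omega> p f) \<and> continuous_on \<Omega> f \<and>
        (\<forall>g u. Lip_on (frontier \<Omega>) g \<and> solves_dirichlet \<Omega> g u \<longrightarrow>
           (\<forall>x\<in>\<Omega>. norm (gradient u x) \<le> Lip_const g (frontier \<Omega>) * f x)))
     \<and>
     (\<forall>(g :: nat \<Rightarrow> real^'n \<Rightarrow> real) (u :: nat \<Rightarrow> real^'n \<Rightarrow> real) (C :: real).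
        C > 0 \<and>
        (\<forall>m. Lip_on (frontier \<Omega>) (g m)) \<and>
        (\<forall>m. Lip_const (g m) (frontier \<Omega>) + (SUP x\<in>frontier \<Omega>. \<bar>g m x\<bar>) \<le> C) \<and>
        (\<forall>m. solves_dirichlet \<Omega> (g m) (u m)) \<longrightarrow>
        precompact_W1 \<Omega> u \<and>
        (\<forall>s h. strict_mono (s :: nat \<Rightarrow> nat) \<and>
           uniform_limit (frontier \<Omega>) (\<lambda>k. g (s k)) h sequentially \<longrightarrow>
           (\<exists>w. Ck_on 2 \<Omega> w \<and> continuous_on (closure \<Omega>) w \<and>
              limit_point_W1 \<Omega> (\<lambda>k. u (s k)) w \<and>
              (\<forall>v. limit_point_W1 \<Omega> (\<lambda>k. u (s k)) v \<longrightarrow> (AE x in lebesgue_on \<Omega>. v x = w x)) \<and>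
              (\<forall>v. Ck_on 2 \<Omega> v \<and> continuous_on (closure \<Omega>) v \<and>
                 limit_point_W1 \<Omega> (\<lambda>k. u (s k)) v \<longrightarrow> (\<forall>x\<in>closure \<Omega>. v x = w x)) \<and>
              solves_dirichlet \<Omega> h w)))"
proof -
  obtain f :: "real^'n \<Rightarrow> real" where f: "\<forall>x\<in>\<Omega>. f x > 0" "\<forall>p\<ge>1. Lp_on \<Omega> p f" "continuous_on \<Omega> f"
    and grad: "\<forall>g u. Lip_on (frontier \<Omega>) g \<and> solves_dirichlet \<Omega> g u \<longrightarrow>
           (\<forall>x\<in>\<Omega>. norm (gradient u x) \<le> Lip_const g (frontier \<Omega>) * f x)"
    by (rule gradient_bound_Lp[OF assms(2-4)])
  note ii = dirichlet_precompact_W1[OF assms(2,3) f(1,2) grad]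
    dirichlet_unique_limit_point_W1[OF assms(2,3) f(1,2) grad]
  show ?thesis
    by (rule conjI, intro exI[of _ f] conjI f grad, intro allI impI, elim conjE, rule conjI,
        rule ii(1), assumption+, intro allI impI, elim conjE, rule ii(2), assumption+)
qed

end
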